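(* Let $m>0$, let $S=\mathrm{Cat}_m=\{(y,x_3)\in\mathbb R^2\times\mathbb R:|y|=m\cosh(x_3/m)\}$, let $M=M(\mathrm{Cat}_m)$ be the component of $\mathbb R^3\setminus\mathrm{Cat}_m$ containing the axis $\{y=0\}$, and designate either of the two ends as the distinguished end $\mathcal E_+$. Then $$m_+(\mathrm{Cat}_m)=m,\qquad A_{\mathrm{Cat}_m}=\pi m^2.$$ Thus equality $m_+(S)=\sqrt{A_S/\pi}$ holds for $S=\mathrm{Cat}_m$.
   Context: $S=\partial M$ has two ends: the distinguished end $\mathcal E_+$ and one remaining end $\mathcal E_1$. $|\Sigma|$ denotes area. Mass: after a rigid motion, the distinguished end of $S$ is a graph $S_+=\{(y,\psi(y)):|y|>R_0\}$ of a smooth function $\psi$ on $\mathbb R^2\setminus B_{R_0}$, with $M$ lying locally above the graph (the outward normal of $M$ is $(D\psi,-1)/\sqrt{1+|D\psi|^2}$) and $|D\psi(y)|+|y||D^2\psi(y)|=O(|y|^{-\tau})$ for some $\tau>1/2$. The extrinsic mass is $m_+(S)=\lim_{r\to\infty}\frac1{2\pi r}\int_{|y|=r}y\cdot D\psi\,d\mathcal H^1$. Separating area: a compact smooth two-sided properly embedded surface $\Sigma\subset\overline M$ is an admissible separator if $\partial\Sigma=\Sigma\cap S$, the intersection is transverse, no component of $\Sigma$ is closed in $M$ (i.e. without boundary), and there is a relatively open set $\Omega(\Sigma)\subset\overline M$ whose boundary in $\overline M$ is $\Sigma$ and which contains (a full tail of) $\mathcal E_1$ and is disjoint from (a full tail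 of) $\mathcal E_+$. $\Sigma$ and $\Omega(\Sigma)$ may be disconnected. $A_S$ is the infimum of $|\Sigma|$ over all admissible separators. *)

theory Defs
  imports "HOL-Analysis.Analysis"
begin

type_synonym space3 = "(real^2) \<times> real"

section \<open>Hausdorff measures\<close>

(* The normalisation by unit_ball_vol k makes the k-dimensional measure agree with k-dimensional
   length, area, ... on smooth submanifolds. The empty set is given weight 0 explicitly so that
   the case k = 0 is correct too; boundedness is demanded because diameter is a junk value on
   unbounded sets. *)
definition hausdorff_weight :: "nat \<Rightarrow> 'a::metric_space set \<Rightarrow> ennreal" where
  "hausdorff_weight k U =
     (if U = {} then 0 else ennreal (unit_ball_vol (real k) * (diameter U / 2) ^ k))"

definition hausdorff_premeasure :: "nat \<Rightarrow> real \<Rightarrow> 'a::metric_space set \<Rightarrow> ennreal" where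
  "hausdorff_premeasure k \<delta> A =
     (INF U \<in> {U :: nat \<Rightarrow> 'a set.
                 A \<subseteq> (\<Union>i. U i) \<and> (\<forall>i. bounded (U i) \<and> diameter (U i) \<le> \<delta>)}.
        \<Sum>i. hausdorff_weight k (U i))"

definition hausdorff_outer :: "nat \<Rightarrow> 'a::metric_space set \<Rightarrow> ennreal" where
  "hausdorff_outer k A = (SUP \<delta> \<in> {0<..}. hausdorff_premeasure k \<delta> A)"

definition hausdorff_measure :: "nat \<Rightarrow> 'a::metric_space measure" where
  "hausdorff_measure k = measure_of UNIV (sets borel) (hausdorff_outer k)"

section \<open>Smooth maps and embedded surfaces\<close>

primrec Ck_on :: "nat \<Rightarrow> ('a::euclidean_space \<Rightarrow> 'b::real_normed_vector) \<Rightarrow> 'a set \<Rightarrow> bool" where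
  "Ck_on 0 f U \<longleftrightarrow> continuous_on U f"
| "Ck_on (Suc k) f U \<longleftrightarrow>
     (\<forall>x\<in>U. f differentiable (at x)) \<and> (\<forall>v. Ck_on k (\<lambda>x. frechet_derivative f (at x) v) U)"

definition smooth_on :: "('a::euclidean_space \<Rightarrow> 'b::real_normed_vector) \<Rightarrow> 'a set \<Rightarrow> bool" where
  "smooth_on f U \<longleftrightarrow> open U \<and> (\<forall>k. Ck_on k f U)"

definition gradient :: "('a::euclidean_space \<Rightarrow> real) \<Rightarrow> 'a \<Rightarrow> 'a" where
  "gradient f x = (\<Sum>b\<in>Basis. frechet_derivative f (at x) b *\<^sub>R b)"

definition diffeomorphism_on ::
  "'a::euclidean_space set \<Rightarrow> 'b::euclidean_space set \<Rightarrow> ('a \<Rightarrow> 'b) \<Rightarrow> ('b \<Rightarrow> 'a) \<Rightarrow> bool" where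
  "diffeomorphism_on U V \<Phi> \<Psi> \<longleftrightarrow> homeomorphism U V \<Phi> \<Psi> \<and> smooth_on \<Phi> U \<and> smooth_on \<Psi> V"

(* Slice charts: near the point, an ambient diffeomorphism flattens the set onto the plane
   snd z = 0, respectively onto a half-plane of it with the point on the bounding line. *)
definition surface_interior :: "space3 set \<Rightarrow> space3 set" where
  "surface_interior \<Sigma> = {p\<in>\<Sigma>. \<exists>U V (\<Phi> :: space3 \<Rightarrow> space3) \<Psi>.
     diffeomorphism_on U V \<Phi> \<Psi> \<and> p \<in> U \<and> \<Phi> ` (\<Sigma> \<inter> U) = V \<inter> {z. snd z = 0}}"

definition surface_boundary :: "space3 set \<Rightarrow> space3 set" where
  "surface_boundary \<Sigma> = {p\<in>\<Sigma>. \<exists>U V (\<Phi> :: space3 \<Rightarrow> space3) \<Psi>.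
     diffeomorphism_on U V \<Phi> \<Psi> \<and> p \<in> U \<and> fst (\<Phi> p) $ 1 = 0 \<and>
     \<Phi> ` (\<Sigma> \<inter> U) = V \<inter> {z. snd z = 0 \<and> fst z $ 1 \<ge> 0}}"

definition smooth_embedded_surface :: "space3 set \<Rightarrow> bool" where
  "smooth_embedded_surface \<Sigma> \<longleftrightarrow> \<Sigma> = surface_interior \<Sigma> \<union> surface_boundary \<Sigma>"

(* One-sided velocities suffice: at a boundary point they fill a half-plane, whose span is the
   tangent plane. *)
definition tangent_space :: "'a::real_normed_vector set \<Rightarrow> 'a \<Rightarrow> 'a set" where
  "tangent_space \<Sigma> p = span {v. \<exists>\<gamma> :: real \<Rightarrow> 'a. \<gamma> 0 = p \<and> (\<forall>t\<in>{0..1}. \<gamma> t \<in> \<Sigma>) \<and>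
     (\<gamma> has_vector_derivative v) (at 0 within {0..1})}"

definition two_sided :: "'a::real_inner set \<Rightarrow> bool" where
  "two_sided \<Sigma> \<longleftrightarrow> (\<exists>\<nu> :: 'a \<Rightarrow> 'a. continuous_on \<Sigma> \<nu> \<and>
     (\<forall>p\<in>\<Sigma>. norm (\<nu> p) = 1 \<and> (\<forall>v\<in>tangent_space \<Sigma> p. \<nu> p \<bullet> v = 0)))"

definition transverse :: "'a::real_normed_vector set \<Rightarrow> 'a set \<Rightarrow> bool" where
  "transverse A B \<longleftrightarrow>
     (\<forall>p\<in>A \<inter> B. {u + v | u v. u \<in> tangent_space A p \<and> v \<in> tangent_space B p} = UNIV)"

section \<open>Ends, mass and separating area\<close>

(* Freudenthal ends: an end E picks, compatibly, a component E K of the complement of every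
   compact K; the sets E K are the full tails of E. *)
definition ends :: "'a::topological_space set \<Rightarrow> ('a set \<Rightarrow> 'a set) set" where
  "ends S = {E \<in> (\<Pi>\<^sub>E K\<in>{K. compact K \<and> K \<subseteq> S}. components (S - K)).
     \<forall>K K'. compact K \<and> compact K' \<and> K \<subseteq> K' \<and> K' \<subseteq> S \<longrightarrow> E K' \<subseteq> E K}"

definition full_tail :: "'a::topological_space set \<Rightarrow> ('a set \<Rightarrow> 'a set) \<Rightarrow> 'a set \<Rightarrow> bool" where
  "full_tail S E A \<longleftrightarrow> (\<exists>K. compact K \<and> K \<subseteq> S \<and> A = E K)"

definition rigid_motion :: "('a::euclidean_space \<Rightarrow> 'a) \<Rightarrow> bool" where
  "rigid_motion T \<longleftrightarrow> (\<exists>Q c. orthogonal_transformation Q \<and> T = (\<lambda>x. Q x + c))"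

(* The last conjunct says that T ` M lies locally above the graph; equivalently, the outward
   normal of T ` M there is (D\<psi>, -1) / sqrt (1 + |D\<psi>|^2). *)
definition graph_end ::
  "space3 set \<Rightarrow> space3 set \<Rightarrow> (space3 set \<Rightarrow> space3 set) \<Rightarrow>
   (space3 \<Rightarrow> space3) \<Rightarrow> real \<Rightarrow> (real^2 \<Rightarrow> real) \<Rightarrow> bool" where
  "graph_end S M E T R\<^sub>0 \<psi> \<longleftrightarrow>
     rigid_motion T \<and> R\<^sub>0 > 0 \<and> smooth_on \<psi> {y. norm y > R\<^sub>0} \<and>
     (\<exists>\<tau>>1/2. (\<lambda>y. norm (gradient \<psi> y)
                  + norm y * onorm (frechet_derivative (gradient \<psi>) (at y)))
               \<in> O[at_infinity](\<lambda>y. norm y powr (- \<tau>))) \<and>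
     (\<exists>A. full_tail S E A \<and> T ` A = {(y, \<psi> y) | y. norm y > R\<^sub>0}) \<and>
     (\<forall>y. norm y > R\<^sub>0 \<longrightarrow>
        (\<exists>\<epsilon>>0. \<forall>x\<in>ball (y, \<psi> y) \<epsilon>. x \<in> T ` M \<longleftrightarrow> snd x > \<psi> (fst x)))"

definition has_extrinsic_mass ::
  "space3 set \<Rightarrow> space3 set \<Rightarrow> (space3 set \<Rightarrow> space3 set) \<Rightarrow> real \<Rightarrow> bool" where
  "has_extrinsic_mass S M E \<mu> \<longleftrightarrow> (\<exists>T R\<^sub>0 \<psi>. graph_end S M E T R\<^sub>0 \<psi> \<and>
     ((\<lambda>r. 1 / (2 * pi * r) * (LINT y:sphere 0 r|hausdorff_measure 1. y \<bullet> gradient \<psi> y))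
        \<longlongrightarrow> \<mu>) at_top)"

definition extrinsic_mass ::
  "space3 set \<Rightarrow> space3 set \<Rightarrow> (space3 set \<Rightarrow> space3 set) \<Rightarrow> real" where
  "extrinsic_mass S M E = (THE \<mu>. has_extrinsic_mass S M E \<mu>)"

(* Ep is the distinguished end, E1 the remaining one. Properness of the embedding in
   closure M amounts to compactness together with surface_boundary \<Sigma> = \<Sigma> \<inter> S. *)
definition admissible_separator ::
  "space3 set \<Rightarrow> space3 set \<Rightarrow> (space3 set \<Rightarrow> space3 set) \<Rightarrow> (space3 set \<Rightarrow> space3 set) \<Rightarrow>
   space3 set \<Rightarrow> bool" where
  "admissible_separator S M Ep E1 \<Sigma> \<longleftrightarrow>
     compact \<Sigma> \<and> \<Sigma> \<subseteq> closure M \<and> smooth_embedded_surface \<Sigma> \<and> two_sided \<Sigma> \<and>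
     surface_boundary \<Sigma> = \<Sigma> \<inter> S \<and> transverse \<Sigma> S \<and>
     (\<forall>C\<in>components \<Sigma>. C \<inter> surface_boundary \<Sigma> \<noteq> {}) \<and>
     (\<exists>\<Omega>. openin (top_of_set (closure M)) \<Omega> \<and> (top_of_set (closure M)) frontier_of \<Omega> = \<Sigma> \<and>
        (\<exists>A. full_tail S E1 A \<and> A \<subseteq> \<Omega>) \<and> (\<exists>A. full_tail S Ep A \<and> A \<inter> \<Omega> = {}))"

definition separating_area ::
  "space3 set \<Rightarrow> space3 set \<Rightarrow> (space3 set \<Rightarrow> space3 set) \<Rightarrow> (space3 set \<Rightarrow> space3 set) \<Rightarrow>
   ennreal" where
  "separating_area S M Ep E1 =
     (INF \<Sigma> \<in> {\<Sigma>. admissible_separator S M Ep E1 \<Sigma>}. emeasure (hausdorff_measure 2) \<Sigma>)"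

definition catenoid :: "real \<Rightarrow> space3 set" where
  "catenoid m = {(y, x\<^sub>3) | y x\<^sub>3. norm y = m * cosh (x\<^sub>3 / m)}"

end

theory Submission
  imports Defs "HOL-Real_Asymp.Real_Asymp"
begin

text \<open>
  The catenoid end is a graph over the horizontal plane, and the decay of its gradient forces every
  admissible rigid motion to preserve the horizontal plane and the side of \<open>M\<close>. Up to a translation
  the graph function is therefore \<open>m arcosh (|y| / m)\<close>, whose flux through large circles tends
  to \<open>2 \<pi> m\<close>.

  For the area, the waist disc of radius \<open>m\<close> is an admissible separator. Conversely a separator is
  compact, so \<open>\<Omega>\<close> contains everything far out on one side of the neck and nothing far out on the
  other; every vertical line through the open waist disc hits the separator, and vertical projection
  does not increase the Hausdorff measure. The identification of the two-dimensional Hausdorff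
  measure of a disc rests on Vitali's covering theorem for the upper bound and on the isodiametric
  inequality in the plane for the lower bound.
\<close>

section \<open>Hausdorff measures are Borel measures\<close>

text \<open>Two defaults shape the proof. \<open>measure_of\<close> assigns 0 to every set unless
  the given set function is countably additive on the Borel sets, so no value of
  \<open>hausdorff_measure\<close> can be computed before Caratheodory's criterion is established
  for it. \<open>extrinsic_mass\<close> is a definite description over all rigid motions, radii and
  graph functions, so exhibiting one graph of mass \<open>m\<close> is not enough: every graph
  representation must give the same limit. The obstacle there is that a full tail may come from a
  compact set that does not separate the catenoid, so that it could reach into both ends. The area
  is attained by the disc, so no constant may be lost: the lower bound requires the sharp
  isodiametric constant, matching \<open>unit_ball_vol\<close>, and the upper bound requires
  disjoint balls whose total volume does not exceed that of the set. Both ends are handled at once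
  by a sign \<open>s\<close>, chosen so that \<open>s * x_3\<close> grows towards the end in
  question.\<close>

lemma hausdorff_premeasure_le:
  assumes "A \<subseteq> (\<Union>i. U i)" "\<And>i. bounded (U i)" "\<And>i. diameter (U i) \<le> \<delta>"
  shows "hausdorff_premeasure k \<delta> A \<le> (\<Sum>i. hausdorff_weight k (U i))"
  unfolding hausdorff_premeasure_def using assms by (intro INF_lower) auto

lemma hausdorff_premeasure_greatest:
  assumes "\<And>U. A \<subseteq> (\<Union>i. U i) \<Longrightarrow> (\<And>i. bounded (U i)) \<Longrightarrow> (\<And>i. diameter (U i) \<le> \<delta>) \<Longrightarrow>
    x \<le> (\<Sum>i. hausdorff_weight k (U i))"
  shows "x \<le> hausdorff_premeasure k \<delta> A"
  unfolding hausdorff_premeasure_def using assms by (intro INF_greatest) auto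

lemma hausdorff_premeasure_mono:
  assumes "A \<subseteq> B" "\<delta>' \<le> \<delta>"
  shows "hausdorff_premeasure k \<delta> A \<le> hausdorff_premeasure k \<delta>' B"
  by (rule hausdorff_premeasure_greatest, rule hausdorff_premeasure_le) (use assms in \<open>auto intro: order_trans\<close>)

lemma hausdorff_weight_empty [simp]: "hausdorff_weight k {} = 0"
  by (simp add: hausdorff_weight_def)

lemma hausdorff_premeasure_empty:
  assumes "\<delta> > 0"
  shows "hausdorff_premeasure k \<delta> ({} :: 'a::metric_space set) = 0"
proof -
  have "hausdorff_premeasure k \<delta> ({} :: 'a set) \<le> (\<Sum>i. hausdorff_weight k ((\<lambda>i::nat. {} :: 'a set) i))"
    by (rule hausdorff_premeasure_le) (use assms in auto)
  thus ?thesis by simp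
qed

text \<open>Covers of the sets \<open>A n\<close> with excess at most \<open>e / 2 ^ (n + 1)\<close>
  are merged into a single cover, indexed by pairs and renumbered with
  \<open>prod_decode\<close>.\<close>

lemma hausdorff_premeasure_countably_subadditive:
  fixes A :: "nat \<Rightarrow> 'a::metric_space set"
  shows "hausdorff_premeasure k \<delta> (\<Union>n. A n) \<le> (\<Sum>n. hausdorff_premeasure k \<delta> (A n))"
proof (rule ennreal_le_epsilon)
  let ?O = "\<lambda>A::'a set. hausdorff_premeasure k \<delta> A"
  fix e :: real assume e: "0 < e" and fin: "(\<Sum>n. ?O (A n)) < top"
  have "\<exists>U. A n \<subseteq> (\<Union>i. U i) \<and> (\<forall>i. bounded (U i) \<and> diameter (U i) \<le> \<delta>) \<and>
      (\<Sum>i. hausdorff_weight k (U i)) \<le> ?O (A n) + ennreal (e * (1/2) ^ Suc n)" for n :: nat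
  proof -
    have "?O (A n) < ?O (A n) + ennreal (e * (1/2) ^ Suc n)"
      using fin e by (auto simp add: less_top dest!: ennreal_suminf_lessD)
    thus ?thesis
      unfolding hausdorff_premeasure_def[of k \<delta> "A n"] INF_less_iff by (auto intro: less_imp_le)
  qed
  then obtain U where U: "\<And>n. A n \<subseteq> (\<Union>i. U n i)" "\<And>n i. bounded (U n i)" "\<And>n i. diameter (U n i) \<le> \<delta>"
    "\<And>n. (\<Sum>i. hausdorff_weight k (U n i)) \<le> ?O (A n) + ennreal (e * (1/2) ^ Suc n)"
    by metis
  define C where "C = case_prod U \<circ> prod_decode"
  have "(\<Union>i. A i) \<subseteq> (\<Union>i. C i)"
    using U(1) by (auto simp add: C_def subset_eq) (metis prod.case prod_encode_inverse)
  hence "?O (\<Union>i. A i) \<le> (\<Sum>i. hausdorff_weight k (C i))"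
    by (rule hausdorff_premeasure_le) (auto simp: C_def U split: prod.splits)
  also have "\<dots> = (\<Sum>n. \<Sum>i. hausdorff_weight k (U n i))"
    using suminf_ennreal_2dimen[of "\<lambda>n. \<Sum>i. hausdorff_weight k (U n i)"
        "\<lambda>(n, i). hausdorff_weight k (U n i)"]
    by (simp add: C_def comp_def split_def)
  also have "\<dots> \<le> (\<Sum>n. ?O (A n) + ennreal (e * (1/2) ^ Suc n))"
    by (intro suminf_le allI U) auto
  also have "\<dots> = (\<Sum>n. ?O (A n)) + (\<Sum>n. ennreal e * ennreal ((1/2) ^ Suc n))"
    using \<open>0 < e\<close> by (subst suminf_add[symmetric])
                     (auto simp del: ennreal_suminf_cmult simp add: ennreal_mult[symmetric])
  also have "\<dots> = (\<Sum>n. ?O (A n)) + e"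
    unfolding ennreal_suminf_cmult
    by (subst suminf_ennreal_eq[OF zero_le_power power_half_series]) auto
  finally show "?O (\<Union>i. A i) \<le> (\<Sum>n. ?O (A n)) + e" .
qed

lemma hausdorff_outer_mono: "A \<subseteq> B \<Longrightarrow> hausdorff_outer k A \<le> hausdorff_outer k B"
  unfolding hausdorff_outer_def by (intro SUP_mono) (auto intro: hausdorff_premeasure_mono)

lemma hausdorff_outer_empty [simp]: "hausdorff_outer k {} = 0"
  unfolding hausdorff_outer_def by (simp add: hausdorff_premeasure_empty)

lemma hausdorff_outer_countably_subadditive:
  "hausdorff_outer k (\<Union>n. A n) \<le> (\<Sum>n. hausdorff_outer k (A n))"
proof -
  have "hausdorff_premeasure k \<delta> (\<Union>n. A n) \<le> (\<Sum>n. hausdorff_outer k (A n))" if "\<delta> > 0" for \<delta>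
  proof -
    have "hausdorff_premeasure k \<delta> (\<Union>n. A n) \<le> (\<Sum>n. hausdorff_premeasure k \<delta> (A n))"
      by (rule hausdorff_premeasure_countably_subadditive)
    also have "\<dots> \<le> (\<Sum>n. hausdorff_outer k (A n))"
      using that by (intro suminf_le) (auto simp: hausdorff_outer_def intro: SUP_upper)
    finally show ?thesis .
  qed
  thus ?thesis by (auto simp: hausdorff_outer_def[of k "\<Union>n. A n"] intro: SUP_least)
qed

lemma outer_measure_space_hausdorff: "outer_measure_space UNIV (hausdorff_outer k)"
  unfolding outer_measure_space_def positive_def increasing_def countably_subadditive_def
  by (auto intro: hausdorff_outer_mono hausdorff_outer_countably_subadditive)

section \<open>Caratheodory's criterion for closed sets\<close>

lemma hausdorff_outer_Un_le:
  "hausdorff_outer k (A \<union> B) \<le> hausdorff_outer k A + hausdorff_outer k B"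
proof -
  have "hausdorff_outer k (A \<union> B) \<le> (\<Sum>n. hausdorff_outer k (binaryset A B n))"
    using hausdorff_outer_countably_subadditive[of k "binaryset A B"] by (simp add: UN_binaryset_eq)
  also have "\<dots> = hausdorff_outer k A + hausdorff_outer k B"
    by (subst suminf_binaryset_eq) auto
  finally show ?thesis .
qed

text \<open>For mesh below \<open>d\<close> no covering set meets both \<open>A\<close> and
  \<open>B\<close>, so a cover of the union splits into covers of the two sets. This additivity on
  separated sets is what makes closed sets measurable.\<close>

lemma hausdorff_outer_separated:
  fixes A B :: "'a::metric_space set"
  assumes d: "d > 0" and sep: "\<And>a b. a \<in> A \<Longrightarrow> b \<in> B \<Longrightarrow> d \<le> dist a b"
  shows "hausdorff_outer k A + hausdorff_outer k B \<le> hausdorff_outer k (A \<union> B)"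
proof -
  let ?P = "\<lambda>\<delta> A. hausdorff_premeasure k \<delta> (A :: 'a set)"
  have small: "?P \<delta> A + ?P \<delta> B \<le> ?P \<delta> (A \<union> B)" if \<delta>: "0 < \<delta>" "\<delta> < d" for \<delta>
  proof (rule hausdorff_premeasure_greatest)
    fix U :: "nat \<Rightarrow> 'a set"
    assume U: "A \<union> B \<subseteq> (\<Union>i. U i)" "\<And>i. bounded (U i)" "\<And>i. diameter (U i) \<le> \<delta>"
    \<comment> \<open>Covering sets that miss \<open>A\<close> are replaced by the empty set, which
      has weight 0; \<open>W\<close> does the same for \<open>B\<close>. Since no \<open>U i\<close>
      meets both, each weight is counted at most once.\<close>
    define V where "V i = (if U i \<inter> A = {} then {} else U i)" for i
    define W where "W i = (if U i \<inter> B = {} then {} else U i)" for i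
    have "A \<subseteq> (\<Union>i. V i)" "B \<subseteq> (\<Union>i. W i)"
      using U(1) unfolding V_def W_def by (fastforce split: if_splits)+
    moreover have "bounded (V i) \<and> diameter (V i) \<le> \<delta>" "bounded (W i) \<and> diameter (W i) \<le> \<delta>" for i
      using U(2,3)[of i] \<delta> by (auto simp: V_def W_def)
    ultimately have "?P \<delta> A \<le> (\<Sum>i. hausdorff_weight k (V i))" "?P \<delta> B \<le> (\<Sum>i. hausdorff_weight k (W i))"
      by (intro hausdorff_premeasure_le; blast)+
    hence "?P \<delta> A + ?P \<delta> B \<le> (\<Sum>i. hausdorff_weight k (V i)) + (\<Sum>i. hausdorff_weight k (W i))"
      by (rule add_mono)
    also have "\<dots> = (\<Sum>i. hausdorff_weight k (V i) + hausdorff_weight k (W i))"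
      by (rule suminf_add) auto
    also have "\<dots> \<le> (\<Sum>i. hausdorff_weight k (U i))"
    proof (rule suminf_le)
      fix i
      have "U i \<inter> A = {} \<or> U i \<inter> B = {}"
      proof (rule ccontr)
        assume "\<not> ?thesis"
        then obtain a b where ab: "a \<in> U i" "a \<in> A" "b \<in> U i" "b \<in> B" by auto
        have "dist a b \<le> \<delta>" using diameter_bounded_bound[OF U(2) ab(1,3)] U(3)[of i] by linarith
        thus False using sep[OF ab(2,4)] \<delta> by linarith
      qed
      thus "hausdorff_weight k (V i) + hausdorff_weight k (W i) \<le> hausdorff_weight k (U i)"
        by (auto simp: V_def W_def)
    qed auto
    finally show "?P \<delta> A + ?P \<delta> B \<le> (\<Sum>i. hausdorff_weight k (U i))" .
  qed
  have "hausdorff_outer k A + hausdorff_outer k B = (SUP \<delta>\<in>{0<..}. ?P \<delta> A + ?P \<delta> B)"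
    unfolding hausdorff_outer_def
  proof (rule SUP_add_directed_ennreal[symmetric])
    fix i j :: real assume "i \<in> {0<..}" "j \<in> {0<..}"
    thus "\<exists>l\<in>{0<..}. ?P i A + ?P j B \<le> ?P l A + ?P l B"
      by (intro bexI[of _ "min i j"] add_mono hausdorff_premeasure_mono) auto
  qed
  also have "\<dots> \<le> hausdorff_outer k (A \<union> B)"
  proof (rule SUP_least)
    fix \<delta> :: real assume "\<delta> \<in> {0<..}"
    define \<epsilon> where "\<epsilon> = min \<delta> (d / 2)"
    have \<epsilon>: "0 < \<epsilon>" "\<epsilon> < d" "\<epsilon> \<le> \<delta>" using \<open>\<delta> \<in> {0<..}\<close> d by (auto simp: \<epsilon>_def)
    have "?P \<delta> A + ?P \<delta> B \<le> ?P \<epsilon> A + ?P \<epsilon> B"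
      using \<epsilon> by (intro add_mono hausdorff_premeasure_mono) auto
    also have "\<dots> \<le> ?P \<epsilon> (A \<union> B)" using \<epsilon> by (intro small)
    also have "\<dots> \<le> hausdorff_outer k (A \<union> B)"
      unfolding hausdorff_outer_def using \<epsilon> by (intro SUP_upper) auto
    finally show "?P \<delta> A + ?P \<delta> B \<le> hausdorff_outer k (A \<union> B)" .
  qed
  finally show ?thesis .
qed

lemma hausdorff_outer_separated_sum:
  fixes X :: "nat \<Rightarrow> 'a::metric_space set"
  assumes "\<And>n. \<exists>d>0. \<forall>i<n. \<forall>a\<in>X i. \<forall>b\<in>X n. d \<le> dist a b"
  shows "(\<Sum>i<n. hausdorff_outer k (X i)) \<le> hausdorff_outer k (\<Union>i<n. X i)"
proof (induction n)
  case (Suc n)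
  obtain d where d: "d > 0" "\<forall>i<n. \<forall>a\<in>X i. \<forall>b\<in>X n. d \<le> dist a b" using assms by blast
  have "(\<Sum>i<Suc n. hausdorff_outer k (X i)) \<le> hausdorff_outer k (\<Union>i<n. X i) + hausdorff_outer k (X n)"
    using Suc by (simp add: add_right_mono)
  also have "\<dots> \<le> hausdorff_outer k ((\<Union>i<n. X i) \<union> X n)"
    by (rule hausdorff_outer_separated[OF d(1)]) (use d in auto)
  also have "(\<Union>i<n. X i) \<union> X n = (\<Union>i<Suc n. X i)" by (auto simp: less_Suc_eq)
  finally show ?case .
qed auto

lemma suminf_even_odd_bounded:
  fixes f :: "nat \<Rightarrow> ennreal"
  assumes "\<And>n. (\<Sum>i<n. f (2 * i)) \<le> c" "\<And>n. (\<Sum>i<n. f (2 * i + 1)) \<le> c"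
  shows "(\<Sum>i. f i) \<le> c + c"
proof (rule suminf_le_const)
  fix n
  have "(\<Sum>i<n. f i) \<le> (\<Sum>i<2*n. f i)" by (rule sum_mono2) auto
  also have "\<dots> = (\<Sum>i<n. f (2 * i)) + (\<Sum>i<n. f (2 * i + 1))"
    by (induction n) (auto simp: algebra_simps)
  also have "\<dots> \<le> c + c" by (intro add_mono assms)
  finally show "(\<Sum>i<n. f i) \<le> c + c" .
qed auto

lemma ennreal_suminf_tail_tendsto_0:
  fixes f :: "nat \<Rightarrow> ennreal"
  assumes "(\<Sum>i. f i) < top"
  shows "(\<lambda>n. \<Sum>i. f (i + n)) \<longlonglongrightarrow> 0"
proof -
  have fin: "f i < top" for i using ennreal_suminf_lessD[OF assms] .
  define g where "g i = enn2real (f i)" for i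
  have fg: "f i = ennreal (g i)" for i using fin by (simp add: g_def)
  have g: "g i \<ge> 0" for i by (simp add: g_def)
  have "(\<Sum>i. ennreal (g i)) \<noteq> top" using assms unfolding fg by simp
  hence sm: "summable g" by (rule summable_suminf_not_top[OF g])
  have "(\<lambda>n. ennreal (\<Sum>i. g (i + n))) \<longlonglongrightarrow> ennreal 0"
    by (rule tendsto_ennrealI[OF suminf_exist_split2[OF sm]])
  moreover have "(\<Sum>i. f (i + n)) = ennreal (\<Sum>i. g (i + n))" for n
    unfolding fg by (rule suminf_ennreal2) (use g sm in \<open>simp_all add: summable_iff_shift\<close>)
  ultimately show ?thesis by simp
qed

text \<open>The points outside \<open>F\<close> are exhausted by the sets \<open>T n\<close> of points at distance at least
  \<open>1 / (n + 1)\<close>; every second shell between them is separated, so the outer measures of the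
  shells have a finite sum and the tails of that sum control what is lost.\<close>

lemma hausdorff_outer_caratheodory_closed:
  fixes F T :: "'a::metric_space set"
  assumes "closed F"
  shows "hausdorff_outer k (T \<inter> F) + hausdorff_outer k (T - F) \<le> hausdorff_outer k T"
proof (cases "F = {} \<or> hausdorff_outer k T = top")
  case False
  hence ne: "F \<noteq> {}" and fin: "hausdorff_outer k T < top" by (auto simp: less_top)
  let ?\<mu> = "hausdorff_outer k :: 'a set \<Rightarrow> ennreal"
  define Tn where "Tn n = {x\<in>T. infdist x F \<ge> 1 / real (Suc n)}" for n
  define S where "S n = Tn (Suc n) - Tn n" for n
  have Tn_mono: "Tn i \<subseteq> Tn j" if "i \<le> j" for i j
  proof -
    have "1 / real (Suc j) \<le> 1 / real (Suc i)" using that by (simp add: frac_le)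
    thus ?thesis unfolding Tn_def by auto
  qed
  \<comment> \<open>\<open>infdist\<close> is 1-Lipschitz, and \<open>S n\<close> lies at distance
    at least \<open>1 / (n + 2)\<close> and below \<open>1 / (n + 1)\<close> from \<open>F\<close>.
    The bound is positive only for \<open>j >= i + 2\<close>, which is why shells of equal parity
    are summed.\<close>
  have sep: "1 / real (Suc (Suc i)) - 1 / real (Suc j) \<le> dist a b"
    if "a \<in> S i" "b \<in> S j" for a b i j
    using that infdist_triangle_abs[of a F b] by (auto simp: S_def Tn_def)
  have sums: "(\<Sum>i<n. ?\<mu> (S (2 * i + c))) \<le> ?\<mu> T" for n c
  proof -
    have "(\<Sum>i<n. ?\<mu> (S (2 * i + c))) \<le> ?\<mu> (\<Union>i<n. S (2 * i + c))"
    proof (rule hausdorff_outer_separated_sum)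
      fix n
      show "\<exists>d>0. \<forall>i<n. \<forall>a\<in>S (2 * i + c). \<forall>b\<in>S (2 * n + c). d \<le> dist a b"
      proof (cases "n = 0")
        case False
        show ?thesis
        proof (intro exI[of _ "1 / real (2*n+c) - 1 / real (Suc (2*n+c))"] conjI allI impI ballI)
          show "1 / real (2*n+c) - 1 / real (Suc (2*n+c)) \<le> dist a b"
            if "i < n" and ab: "a \<in> S (2 * i + c)" "b \<in> S (2 * n + c)" for i a b
          proof -
            have "1 / real (2*n+c) \<le> 1 / real (Suc (Suc (2*i+c)))"
              using that(1) by (intro frac_le) auto
            thus ?thesis using sep[OF ab] by linarith
          qed
          show "1 / real (2*n+c) - 1 / real (Suc (2*n+c)) > 0"
            using False by (simp add: frac_less2)
        qed
      qed (auto intro: exI[of _ 1])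
    qed
    also have "\<dots> \<le> ?\<mu> T" by (rule hausdorff_outer_mono) (auto simp: S_def Tn_def)
    finally show ?thesis .
  qed
  have "(\<Sum>n. ?\<mu> (S n)) \<le> ?\<mu> T + ?\<mu> T"
    by (rule suminf_even_odd_bounded) (use sums[where c = 0] sums[where c = 1] in simp_all)
  also have "\<dots> < top" using fin by (simp add: ennreal_add_eq_top less_top)
  finally have tail: "(\<lambda>n. \<Sum>i. ?\<mu> (S (i + n))) \<longlonglongrightarrow> 0"
    by (rule ennreal_suminf_tail_tendsto_0)
  have bound: "?\<mu> (T \<inter> F) + ?\<mu> (T - F) \<le> ?\<mu> T + (\<Sum>i. ?\<mu> (S (i + n)))" for n
  proof -
    have "T - F \<subseteq> Tn n \<union> (\<Union>i. S (i + n))"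
    proof
      fix x assume x: "x \<in> T - F"
      hence "infdist x F > 0"
        using in_closed_iff_infdist_zero[OF assms ne, of x] infdist_nonneg[of x F] by auto
      then obtain N where "1 / real (Suc N) < infdist x F" using nat_approx_posE by blast
      hence "x \<in> Tn N" using x by (auto simp: Tn_def)
      define j where "j = (LEAST j. x \<in> Tn j)"
      have j: "x \<in> Tn j" "\<And>i. i < j \<Longrightarrow> x \<notin> Tn i"
        unfolding j_def using \<open>x \<in> Tn N\<close> by (auto intro: LeastI dest: not_less_Least)
      show "x \<in> Tn n \<union> (\<Union>i. S (i + n))"
      proof (cases "j \<le> n")
        case True
        thus ?thesis using j(1) Tn_mono by auto
      next
        case False
        hence "x \<in> S (j - 1 - n + n)" using j by (auto simp: S_def)
        thus ?thesis by blast
      qed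
    qed
    hence "?\<mu> (T - F) \<le> ?\<mu> (Tn n \<union> (\<Union>i. S (i + n)))" by (rule hausdorff_outer_mono)
    also have "\<dots> \<le> ?\<mu> (Tn n) + (\<Sum>i. ?\<mu> (S (i + n)))"
      by (rule order_trans[OF hausdorff_outer_Un_le add_left_mono])
         (rule hausdorff_outer_countably_subadditive)
    finally have "?\<mu> (T \<inter> F) + ?\<mu> (T - F) \<le> (?\<mu> (T \<inter> F) + ?\<mu> (Tn n)) + (\<Sum>i. ?\<mu> (S (i + n)))"
      by (simp add: add.assoc add_left_mono)
    moreover have "?\<mu> (T \<inter> F) + ?\<mu> (Tn n) \<le> ?\<mu> (T \<inter> F \<union> Tn n)"
    proof (rule hausdorff_outer_separated)
      show "1 / real (Suc n) \<le> dist a b" if "a \<in> T \<inter> F" "b \<in> Tn n" for a b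
        using that infdist_le[of a F b] by (auto simp: Tn_def dist_commute)
    qed auto
    moreover have "?\<mu> (T \<inter> F \<union> Tn n) \<le> ?\<mu> T" by (rule hausdorff_outer_mono) (auto simp: Tn_def)
    ultimately show ?thesis by (meson add_right_mono order_trans)
  qed
  show ?thesis
  proof (rule LIMSEQ_le_const)
    show "(\<lambda>n. ?\<mu> T + (\<Sum>i. ?\<mu> (S (i + n)))) \<longlonglongrightarrow> ?\<mu> T"
      using tendsto_add[OF tendsto_const tail, of "?\<mu> T"] by simp
  qed (use bound in auto)
qed auto

text \<open>This is what makes the defining \<open>measure_of\<close> nontrivial. Closed sets
  satisfy Caratheodory's criterion and generate the Borel sets, on which the outer measure is
  therefore countably additive.\<close>

lemma measure_space_hausdorff:
  "measure_space UNIV (sets borel) (hausdorff_outer k :: 'a::metric_space set \<Rightarrow> ennreal)"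
proof -
  let ?\<mu> = "hausdorff_outer k :: 'a set \<Rightarrow> ennreal"
  have ms: "measure_space UNIV (lambda_system UNIV UNIV ?\<mu>) ?\<mu>"
    using sigma_algebra.caratheodory_lemma[OF sigma_algebra_Pow[of UNIV], of ?\<mu>]
      outer_measure_space_hausdorff[of k] by simp
  interpret L: sigma_algebra UNIV "lambda_system UNIV UNIV ?\<mu>"
    using ms by (simp add: measure_space_def)
  have "F \<in> lambda_system UNIV UNIV ?\<mu>" if "closed F" for F
  proof -
    have "?\<mu> (F \<inter> x) + ?\<mu> ((UNIV - F) \<inter> x) = ?\<mu> x" for x
    proof (rule antisym)
      show "?\<mu> (F \<inter> x) + ?\<mu> ((UNIV - F) \<inter> x) \<le> ?\<mu> x"
        using hausdorff_outer_caratheodory_closed[OF that, of k x]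
        by (simp add: Int_commute Diff_eq)
      have "?\<mu> ((F \<inter> x) \<union> ((UNIV - F) \<inter> x)) \<le> ?\<mu> (F \<inter> x) + ?\<mu> ((UNIV - F) \<inter> x)"
        by (rule hausdorff_outer_Un_le)
      moreover have "(F \<inter> x) \<union> ((UNIV - F) \<inter> x) = x" by auto
      ultimately show "?\<mu> x \<le> ?\<mu> (F \<inter> x) + ?\<mu> ((UNIV - F) \<inter> x)" by simp
    qed
    thus ?thesis by (simp add: lambda_system_def)
  qed
  hence "sigma_sets UNIV (Collect closed) \<subseteq> lambda_system UNIV UNIV ?\<mu>"
    by (intro L.sigma_sets_subset) auto
  hence "sets borel \<subseteq> lambda_system UNIV UNIV ?\<mu>"
    unfolding borel_eq_closed by simp
  hence "countably_additive (sets borel) ?\<mu>"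
    using ms unfolding measure_space_def countably_additive_def by blast
  thus ?thesis
    using sets.sigma_algebra_axioms[of "borel :: 'a measure"]
    by (simp add: measure_space_def positive_def)
qed

lemma sets_hausdorff_measure [simp, measurable_cong]: "sets (hausdorff_measure k) = sets borel"
  unfolding hausdorff_measure_def using sets.sigma_sets_eq[of borel] by simp

lemma space_hausdorff_measure [simp]: "space (hausdorff_measure k) = UNIV"
  unfolding hausdorff_measure_def by (simp add: space_measure_of_conv)

lemma emeasure_hausdorff_measure:
  assumes "A \<in> sets borel"
  shows "emeasure (hausdorff_measure k) A = hausdorff_outer k A"
  unfolding hausdorff_measure_def
  by (rule emeasure_measure_of_sigma)
     (use measure_space_hausdorff[of k] assms in \<open>auto simp: measure_space_def\<close>)

section \<open>Hausdorff measure under maps that do not increase distances\<close>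

lemma hausdorff_weight_image_le:
  assumes f: "\<And>x y. dist (f x) (f y) \<le> dist x y" and U: "bounded U"
  shows "bounded (f ` U)" "diameter (f ` U) \<le> diameter U"
    "hausdorff_weight k (f ` U) \<le> hausdorff_weight k U"
proof -
  have d: "dist (f x) (f y) \<le> diameter U" if "x \<in> U" "y \<in> U" for x y
    using f[of x y] diameter_bounded_bound[OF U that] by linarith
  show "bounded (f ` U)"
    unfolding bounded_two_points using d by blast
  show *: "diameter (f ` U) \<le> diameter U"
    unfolding diameter_def[of "f ` U"] using d diameter_ge_0[OF U]
    by (auto intro!: cSUP_least)
  have "0 \<le> diameter (f ` U)" by (rule diameter_ge_0) fact
  with * show "hausdorff_weight k (f ` U) \<le> hausdorff_weight k U"
    unfolding hausdorff_weight_def by (auto intro!: ennreal_leI mult_left_mono power_mono)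
qed

text \<open>The images of a cover form a cover of the image at no greater cost. The map will be an
  arc-length parametrization, an orthogonal projection or an isometric embedding.\<close>

lemma hausdorff_outer_image_le:
  fixes f :: "'a::metric_space \<Rightarrow> 'b::metric_space"
  assumes f: "\<And>x y. dist (f x) (f y) \<le> dist x y"
  shows "hausdorff_outer k (f ` A) \<le> hausdorff_outer k A"
  unfolding hausdorff_outer_def
proof (rule SUP_mono)
  fix \<delta> :: real assume "\<delta> \<in> {0<..}"
  have "hausdorff_premeasure k \<delta> (f ` A) \<le> hausdorff_premeasure k \<delta> A"
  proof (rule hausdorff_premeasure_greatest)
    fix U :: "nat \<Rightarrow> 'a set"
    assume U: "A \<subseteq> (\<Union>i. U i)" "\<And>i. bounded (U i)" "\<And>i. diameter (U i) \<le> \<delta>"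
    have "f ` A \<subseteq> (\<Union>i. f ` U i)" using U(1) by blast
    hence "hausdorff_premeasure k \<delta> (f ` A) \<le> (\<Sum>i. hausdorff_weight k (f ` U i))"
      by (rule hausdorff_premeasure_le)
         (use U(3) hausdorff_weight_image_le[OF f U(2)] in \<open>blast intro: order_trans\<close>)+
    also have "\<dots> \<le> (\<Sum>i. hausdorff_weight k (U i))"
      by (intro suminf_le hausdorff_weight_image_le f U) auto
    finally show "hausdorff_premeasure k \<delta> (f ` A) \<le> (\<Sum>i. hausdorff_weight k (U i))" .
  qed
  thus "\<exists>m\<in>{0<..}. hausdorff_premeasure k \<delta> (f ` A) \<le> hausdorff_premeasure k m A"
    using \<open>\<delta> \<in> {0<..}\<close> by blast
qed

section \<open>Comparison of Hausdorff and Lebesgue measure\<close>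

lemma hausdorff_premeasure_Un_le:
  fixes A B :: "'a::metric_space set"
  assumes "\<delta> > 0"
  shows "hausdorff_premeasure k \<delta> (A \<union> B) \<le> hausdorff_premeasure k \<delta> A + hausdorff_premeasure k \<delta> B"
proof -
  have "hausdorff_premeasure k \<delta> (A \<union> B) \<le> (\<Sum>n. hausdorff_premeasure k \<delta> (binaryset A B n))"
    using hausdorff_premeasure_countably_subadditive[of k \<delta> "binaryset A B"] by (simp add: UN_binaryset_eq)
  also have "\<dots> = hausdorff_premeasure k \<delta> A + hausdorff_premeasure k \<delta> B"
    by (subst suminf_binaryset_eq) (auto simp: hausdorff_premeasure_empty[OF assms])
  finally show ?thesis .
qed

text \<open>A ball of radius \<open>c * r\<close> weighs exactly \<open>c ^ DIM('a)\<close> times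
  the volume of the ball of radius \<open>r\<close>, and disjointness keeps the total volume below
  that of \<open>T\<close>. The factor \<open>c\<close> leaves room for the enlargement in Vitali's
  covering lemma: \<open>c = 5\<close> for null sets and \<open>c = 1\<close> for open sets.\<close>

lemma hausdorff_premeasure_le_disjoint_cballs:
  fixes a :: "'i \<Rightarrow> 'a::euclidean_space"
  assumes "countable C" and c: "c > 0" and \<delta>: "\<delta> > 0"
    and disj: "pairwise (\<lambda>i j. disjnt (cball (a i) (r i)) (cball (a j) (r j))) C"
    and r: "\<And>i. i \<in> C \<Longrightarrow> r i > 0 \<and> 2 * (c * r i) \<le> \<delta>"
    and T: "\<And>i. i \<in> C \<Longrightarrow> cball (a i) (r i) \<subseteq> T" "T \<in> sets borel"
    and A: "A \<subseteq> (\<Union>i\<in>C. cball (a i) (c * r i))"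
  shows "hausdorff_premeasure DIM('a) \<delta> A \<le> ennreal (c ^ DIM('a)) * emeasure lborel T"
proof -
  let ?k = "DIM('a)"
  \<comment> \<open>The cover is renumbered by natural numbers; an index outside \<open>I\<close>
    carries the empty set.\<close>
  define g where "g = inv_into C (to_nat_on C)"
  define I where "I = to_nat_on C ` C"
  have inj: "inj_on (to_nat_on C) C" using \<open>countable C\<close> by (rule inj_on_to_nat_on)
  have gI: "g n \<in> C" if "n \<in> I" for n using that by (auto simp: g_def I_def inv_into_into)
  have g: "g (to_nat_on C i) = i" "to_nat_on C i \<in> I" if "i \<in> C" for i
    using that inj by (auto simp: g_def I_def)
  have g_inj: "inj_on g I" unfolding g_def I_def by (rule inj_on_inv_into) simp
  define U where "U n = (if n \<in> I then cball (a (g n)) (c * r (g n)) else {})" for n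
  define B where "B n = (if n \<in> I then cball (a (g n)) (r (g n)) else {})" for n
  have "A \<subseteq> (\<Union>n. U n)"
  proof
    fix x assume "x \<in> A"
    then obtain i where i: "i \<in> C" "x \<in> cball (a i) (c * r i)" using A by blast
    hence "x \<in> U (to_nat_on C i)" using g[OF i(1)] by (simp add: U_def)
    thus "x \<in> (\<Union>n. U n)" by blast
  qed
  moreover have "bounded (U n) \<and> diameter (U n) \<le> \<delta>" for n
    using r[OF gI, of n] c \<delta> by (auto simp: U_def)
  ultimately have "hausdorff_premeasure ?k \<delta> A \<le> (\<Sum>n. hausdorff_weight ?k (U n))"
    by (intro hausdorff_premeasure_le) auto
  also have "\<dots> = (\<Sum>n. ennreal (c ^ ?k) * emeasure lborel (B n))"
  proof (rule suminf_cong)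
    fix n
    show "hausdorff_weight ?k (U n) = ennreal (c ^ ?k) * emeasure lborel (B n)"
    proof (cases "n \<in> I")
      case True
      define q where "q = c * r (g n)"
      have q: "q > 0" "r (g n) > 0" using r[OF gI[OF True]] c by (auto simp: q_def)
      have "hausdorff_weight ?k (U n) = ennreal (unit_ball_vol ?k * q ^ ?k)"
        using True q by (simp add: U_def hausdorff_weight_def q_def[symmetric])
      also have "\<dots> = ennreal (c ^ ?k) * emeasure lborel (B n)"
        using True q c by (simp add: B_def emeasure_cball ennreal_mult[symmetric] q_def
            power_mult_distrib mult_ac)
      finally show ?thesis .
    qed (simp add: U_def B_def)
  qed
  also have "\<dots> = ennreal (c ^ ?k) * emeasure lborel (\<Union>n. B n)"
  proof -
    have "disjoint_family B"
      unfolding disjoint_family_on_def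
    proof (intro ballI impI)
      fix m n :: nat assume "m \<noteq> n"
      show "B m \<inter> B n = {}"
      proof (cases "m \<in> I \<and> n \<in> I")
        case True
        hence "g m \<noteq> g n" using g_inj \<open>m \<noteq> n\<close> by (auto dest: inj_onD)
        thus ?thesis using True pairwiseD[OF disj, of "g m" "g n"] gI
          by (auto simp: B_def disjnt_def)
      qed (auto simp: B_def)
    qed
    moreover have "range B \<subseteq> sets lborel" by (auto simp: B_def)
    ultimately have "(\<Sum>n. emeasure lborel (B n)) = emeasure lborel (\<Union>n. B n)"
      by (intro suminf_emeasure)
    thus ?thesis by simp
  qed
  also have "\<dots> \<le> ennreal (c ^ ?k) * emeasure lborel T"
    using T gI by (intro mult_left_mono emeasure_mono) (auto simp: B_def)
  finally show ?thesis .
qed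

lemma lmeasurable_outer_open:
  fixes S :: "'a::euclidean_space set"
  assumes S: "S \<in> lmeasurable" and e: "e > 0"
  obtains T where "open T" "S \<subseteq> T" "T \<in> lmeasurable" "measure lebesgue T < measure lebesgue S + e"
proof -
  obtain T where T: "open T" "S \<subseteq> T" "T - S \<in> lmeasurable" "emeasure lebesgue (T - S) < ennreal e"
    using sets_lebesgue_outer_open[OF fmeasurableD[OF S] e] by metis
  have eq: "S \<union> (T - S) = T" using T(2) by blast
  have "T \<in> lmeasurable" using fmeasurable.Un[OF S T(3)] unfolding eq .
  moreover have "measure lebesgue T \<le> measure lebesgue S + measure lebesgue (T - S)"
    using measure_Un_le[OF fmeasurableD[OF S] fmeasurableD[OF T(3)]] unfolding eq .
  moreover have "measure lebesgue (T - S) < e"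
    using T(3,4) e by (simp add: emeasure_eq_measure2 ennreal_less_iff del: emeasure_completion)
  ultimately show ?thesis using that T by force
qed

text \<open>Vitali's covering lemma covers all of \<open>N\<close> once the balls are enlarged five
  times. The loss \<open>5 ^ DIM('a)\<close> is absorbed by taking an open neighbourhood of measure
  below \<open>\<epsilon> / 5 ^ DIM('a)\<close>.\<close>

lemma hausdorff_premeasure_negligible:
  fixes N :: "'a::euclidean_space set"
  assumes "negligible N" and \<delta>: "\<delta> > 0"
  shows "hausdorff_premeasure DIM('a) \<delta> N = 0"
proof -
  have "hausdorff_premeasure DIM('a) \<delta> N \<le> ennreal \<epsilon>" if "\<epsilon> > 0" for \<epsilon>
  proof -
    have N: "N \<in> lmeasurable" "measure lebesgue N = 0"
      using assms(1) by (auto simp: negligible_iff_measure)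
    define e where "e = \<epsilon> / 5 ^ DIM('a)"
    have "e > 0" using that by (simp add: e_def)
    obtain T where T: "open T" "N \<subseteq> T" "T \<in> lmeasurable" "measure lebesgue T < e"
      using lmeasurable_outer_open[OF N(1) \<open>e > 0\<close>] N(2) by (metis add_0)
    \<comment> \<open>The enlarged balls have diameter \<open>10 * r\<close>, hence the bound
      \<open>\<delta> / 10\<close> on the radius.\<close>
    define K where "K = {(x, r). x \<in> N \<and> 0 < r \<and> r \<le> \<delta> / 10 \<and> cball x r \<subseteq> T}"
    have "N \<subseteq> (\<Union>i\<in>K. cball (fst i) (snd i))"
    proof
      fix x assume "x \<in> N"
      then obtain r where r: "r > 0" "cball x r \<subseteq> T"
        using T(1,2) by (meson open_contains_cball subset_eq)
      have "(x, min r (\<delta> / 10)) \<in> K"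
        using r \<delta> \<open>x \<in> N\<close> by (auto simp: K_def)
      thus "x \<in> (\<Union>i\<in>K. cball (fst i) (snd i))" using r \<delta> by force
    qed
    moreover have "0 < snd i \<and> snd i \<le> \<delta> / 10" if "i \<in> K" for i using that by (auto simp: K_def)
    ultimately obtain C where C: "countable C" "C \<subseteq> K"
      "pairwise (\<lambda>i j. disjnt (cball (fst i) (snd i)) (cball (fst j) (snd j))) C"
      "N \<subseteq> (\<Union>i\<in>C. cball (fst i) (5 * snd i))"
      by (rule Vitali_covering_lemma_cballs)
    note mT = T(4)
    have "hausdorff_premeasure DIM('a) \<delta> N \<le> ennreal (5 ^ DIM('a)) * emeasure lborel T"
    proof (rule hausdorff_premeasure_le_disjoint_cballs[OF C(1) _ \<delta> C(3) _ _ _ C(4)])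
      fix i assume "i \<in> C"
      hence "i \<in> K" using C(2) by blast
      thus "0 < snd i \<and> 2 * (5 * snd i) \<le> \<delta>" "cball (fst i) (snd i) \<subseteq> T"
        by (auto simp: K_def split: prod.splits)
    qed (use T in auto)
    also have "emeasure lborel T = ennreal (measure lebesgue T)"
      using T(1) emeasure_eq_measure2[OF T(3)] by simp
    also have "ennreal (5 ^ DIM('a)) * \<dots> \<le> ennreal \<epsilon>"
      using mT that by (auto simp: ennreal_mult[symmetric] e_def field_simps intro!: ennreal_leI)
    finally show ?thesis .
  qed
  hence "hausdorff_premeasure DIM('a) \<delta> N \<le> 0 + ennreal \<epsilon>" if "\<epsilon> > 0" for \<epsilon>
    using that by simp
  hence "hausdorff_premeasure DIM('a) \<delta> N \<le> 0" by (rule ennreal_le_epsilon)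
  thus ?thesis by simp
qed

text \<open>Vitali's covering theorem fills \<open>T\<close> up to a null set with disjoint balls
  that are not enlarged, so the constant is 1. The null set left over has premeasure 0.\<close>

lemma hausdorff_premeasure_le_open:
  fixes T :: "'a::euclidean_space set"
  assumes T: "open T" and \<delta>: "\<delta> > 0"
  shows "hausdorff_premeasure DIM('a) \<delta> T \<le> emeasure lborel T"
proof -
  define K where "K = {(x, r). x \<in> T \<and> 0 < r \<and> r \<le> \<delta> / 2 \<and> cball x r \<subseteq> T}"
  have K0: "0 < snd i" if "i \<in> K" for i using that by (auto simp: K_def)
  have K1: "\<exists>i. i \<in> K \<and> x \<in> cball (fst i) (snd i) \<and> snd i < d" if xT: "x \<in> T" "d > 0" for x d
  proof -
    obtain r where r: "r > 0" "cball x r \<subseteq> T"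
      using T xT unfolding open_contains_cball by blast
    show ?thesis
    proof (intro exI conjI)
      let ?i = "(x, min r (min (\<delta> / 2) (d / 2)))"
      show "?i \<in> K" using r \<delta> xT subset_cball[of "min r (min (\<delta> / 2) (d / 2))" r x] by (auto simp: K_def)
      show "x \<in> cball (fst ?i) (snd ?i)" "snd ?i < d" using r \<delta> xT by auto
    qed
  qed
  obtain C where C: "countable C" "C \<subseteq> K"
    "pairwise (\<lambda>i j. disjnt (cball (fst i) (snd i)) (cball (fst j) (snd j))) C"
    "negligible (T - (\<Union>i\<in>C. cball (fst i) (snd i)))"
    by (rule Vitali_covering_theorem_cballs[of K snd T fst, OF K0 K1])
  let ?B = "\<Union>i\<in>C. cball (fst i) (snd i)"
  have "hausdorff_premeasure DIM('a) \<delta> T \<le> hausdorff_premeasure DIM('a) \<delta> (?B \<union> (T - ?B))"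
    by (rule hausdorff_premeasure_mono) auto
  also have "\<dots> \<le> hausdorff_premeasure DIM('a) \<delta> ?B + hausdorff_premeasure DIM('a) \<delta> (T - ?B)"
    by (rule hausdorff_premeasure_Un_le[OF \<delta>])
  also have "hausdorff_premeasure DIM('a) \<delta> (T - ?B) = 0"
    by (rule hausdorff_premeasure_negligible[OF C(4) \<delta>])
  also have "hausdorff_premeasure DIM('a) \<delta> ?B + 0 \<le> ennreal (1 ^ DIM('a)) * emeasure lborel T"
    unfolding add_0_right
  proof (rule hausdorff_premeasure_le_disjoint_cballs[OF C(1) _ \<delta> C(3)])
    fix i assume "i \<in> C"
    hence "i \<in> K" using C(2) by blast
    thus "0 < snd i \<and> 2 * (1 * snd i) \<le> \<delta>" "cball (fst i) (snd i) \<subseteq> T"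
      by (auto simp: K_def split: prod.splits)
  qed (use T in auto)
  finally show ?thesis by simp
qed

lemma hausdorff_outer_le_lebesgue:
  fixes S :: "'a::euclidean_space set"
  assumes "S \<in> lmeasurable"
  shows "hausdorff_outer DIM('a) S \<le> ennreal (measure lebesgue S)"
proof (rule ennreal_le_epsilon)
  fix e :: real assume e: "e > 0"
  obtain T where T: "open T" "S \<subseteq> T" "T \<in> lmeasurable" "measure lebesgue T < measure lebesgue S + e"
    using lmeasurable_outer_open[OF assms e] by metis
  hence mT: "measure lebesgue T \<le> measure lebesgue S + e" by linarith
  have "hausdorff_outer DIM('a) S \<le> hausdorff_outer DIM('a) T"
    by (rule hausdorff_outer_mono[OF T(2)])
  also have "\<dots> \<le> emeasure lborel T"
    unfolding hausdorff_outer_def by (intro SUP_least hausdorff_premeasure_le_open T) auto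
  also have "\<dots> = ennreal (measure lebesgue T)"
    using T(1) emeasure_eq_measure2[OF T(3)] by simp
  also have "\<dots> \<le> ennreal (measure lebesgue S) + ennreal e"
    using mT e by (simp flip: ennreal_plus)
  finally show "hausdorff_outer DIM('a) S \<le> ennreal (measure lebesgue S) + ennreal e" .
qed

section \<open>Lower bound through the isodiametric inequality\<close>

lemma emeasure_lborel_le_diameter:
  fixes A :: "real set"
  assumes "\<And>x y. x \<in> A \<Longrightarrow> y \<in> A \<Longrightarrow> x - y \<le> w"
  shows "emeasure lborel A \<le> ennreal w"
proof (cases "A = {}")
  case False
  then obtain z where z: "z \<in> A" by blast
  have bdd: "bdd_below A" using assms[OF z] by (intro bdd_belowI[of _ "z - w"]) (auto simp: algebra_simps)
  have "A \<subseteq> {Inf A..Inf A + w}"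
  proof
    fix x assume x: "x \<in> A"
    have "x - w \<le> Inf A" using assms[OF x] False by (intro cInf_greatest) (auto simp: algebra_simps)
    thus "x \<in> {Inf A..Inf A + w}" using cInf_lower[OF x bdd] by auto
  qed
  hence "emeasure lborel A \<le> emeasure lborel {Inf A..Inf A + w}" by (intro emeasure_mono) auto
  also have "\<dots> = ennreal w" using assms[OF z z] by simp
  finally show ?thesis .
qed auto

text \<open>This is the diameter estimate behind Steiner symmetrization: of the four endpoints of the two
  slices, one pair on opposite sides has vertical distance at least \<open>t\<close>.\<close>

lemma slice_layer_bound:
  fixes S :: "(real \<times> real) set"
  assumes S: "compact S" and t: "t > 0"
    and x: "t \<le> measure lborel (Pair x -` S)" and y: "t \<le> measure lborel (Pair y -` S)"
  shows "(x - y)\<^sup>2 + t\<^sup>2 \<le> (diameter S)\<^sup>2"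
proof -
  have slice: "\<exists>a b. (z, a) \<in> S \<and> (z, b) \<in> S \<and> t \<le> b - a" if "t \<le> measure lborel (Pair z -` S)" for z
  proof -
    let ?A = "Pair z -` S"
    have cl: "closed ?A" by (intro closed_vimage compact_imp_closed S continuous_intros)
    have "?A \<subseteq> snd ` S" by force
    hence "bounded ?A" using bounded_snd[OF compact_imp_bounded[OF S]] by (rule bounded_subset[rotated])
    hence cpt: "compact ?A" using cl by (simp add: compact_eq_bounded_closed)
    have ne: "?A \<noteq> {}" using that t by (metis measure_empty not_le)
    obtain a b where ab: "a \<in> ?A" "\<forall>u\<in>?A. a \<le> u" "b \<in> ?A" "\<forall>u\<in>?A. u \<le> b"
      using compact_attains_inf[OF cpt ne] compact_attains_sup[OF cpt ne] by metis
    have "emeasure lborel ?A \<le> ennreal (b - a)"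
      by (rule emeasure_lborel_le_diameter) (use ab in \<open>simp add: diff_mono\<close>)
    hence "measure lborel ?A \<le> b - a"
      using ab by (simp add: measure_def enn2real_leI)
    thus ?thesis using that ab(1,3) by (intro exI[of _ a] exI[of _ b]) simp
  qed
  obtain a b where ab: "(x, a) \<in> S" "(x, b) \<in> S" "t \<le> b - a" using slice[OF x] by blast
  obtain a' b' where ab': "(y, a') \<in> S" "(y, b') \<in> S" "t \<le> b' - a'" using slice[OF y] by blast
  have *: "(x - y)\<^sup>2 + (u - v)\<^sup>2 \<le> (diameter S)\<^sup>2" if "(x, u) \<in> S" "(y, v) \<in> S" for u v
  proof -
    have "dist (x, u) (y, v) \<le> diameter S"
      using diameter_bounded_bound[OF compact_imp_bounded[OF S] that] .
    hence "(dist (x, u) (y, v))\<^sup>2 \<le> (diameter S)\<^sup>2" by (intro power_mono) auto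
    thus ?thesis by (simp add: dist_Pair_Pair dist_real_def)
  qed
  consider "t \<le> b - a'" | "t \<le> b' - a" using ab ab' by linarith
  thus ?thesis
  proof cases
    case 1
    hence "t\<^sup>2 \<le> (b - a')\<^sup>2" using t by (intro power_mono) auto
    thus ?thesis using *[OF ab(2) ab'(1)] by linarith
  next
    case 2
    hence "t\<^sup>2 \<le> (b' - a)\<^sup>2" using t by (intro power_mono) auto
    thus ?thesis using *[OF ab(1) ab'(2)] by (simp add: power2_commute)
  qed
qed

text \<open>A layer-cake argument: the layer of height \<open>t\<close> of the slice length is at most half as long as
  the slice at \<open>t\<close> of the disc of radius \<open>diameter S\<close>. Layers of both signs are used so that no
  integral has to be computed.\<close>

lemma isodiametric_plane:
  fixes S :: "(real \<times> real) set"
  assumes S: "compact S"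
  shows "emeasure lborel S \<le> ennreal (pi * (diameter S / 2)\<^sup>2)"
proof -
  define d where "d = diameter S"
  have d: "d \<ge> 0" unfolding d_def by (rule diameter_ge_0[OF compact_imp_bounded[OF S]])
  define l where "l x = measure lborel (Pair x -` S)" for x
  have Sm: "S \<in> sets (lborel \<Otimes>\<^sub>M lborel)" unfolding lborel_prod using S by (simp add: borel_compact)
  have lm: "(\<lambda>x. emeasure lborel (Pair x -` S)) \<in> borel_measurable lborel"
    using lborel.measurable_emeasure_Pair[OF Sm] by simp
  have [measurable]: "l \<in> borel_measurable borel"
    unfolding l_def measure_def using lm by measurable
  have emeasure_l: "emeasure lborel (Pair x -` S) = ennreal (l x)" for x
  proof -
    have "Pair x -` S \<subseteq> snd ` S" by force
    hence "emeasure lborel (Pair x -` S) \<le> emeasure lborel (snd ` S)"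
      using S by (intro emeasure_mono) (auto intro!: borel_compact compact_continuous_image continuous_intros)
    also have "\<dots> < \<infinity>"
      using S by (intro emeasure_compact_finite compact_continuous_image continuous_intros)
    finally show ?thesis unfolding l_def by (simp add: emeasure_eq_ennreal_measure)
  qed
  \<comment> \<open>\<open>G\<close> lies between the graphs of \<open>- l\<close> and
    \<open>l\<close>, so its slices are twice as long as those of \<open>S\<close>. The axis is left
    out because the layer at height 0 would otherwise be the whole line.\<close>
  define G where "G = {z :: real \<times> real. 0 < \<bar>snd z\<bar> \<and> \<bar>snd z\<bar> \<le> l (fst z)}"
  have "{z \<in> space (borel \<Otimes>\<^sub>M borel). 0 < \<bar>snd z\<bar> \<and> \<bar>snd z\<bar> \<le> l (fst z)} \<in> sets (borel \<Otimes>\<^sub>M borel)"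
    by measurable
  hence Gm: "G \<in> sets (lborel \<Otimes>\<^sub>M lborel)"
    by (simp add: G_def space_pair_measure cong: sets_pair_measure_cong)
  have l0: "l x \<ge> 0" for x by (simp add: l_def)
  have "2 * emeasure lborel S = 2 * emeasure (lborel \<Otimes>\<^sub>M lborel) S" by (simp add: lborel_prod)
  also have "\<dots> = (\<integral>\<^sup>+x. 2 * ennreal (l x) \<partial>lborel)"
    by (subst lborel.emeasure_pair_measure_alt[OF Sm]) (simp add: emeasure_l nn_integral_cmult)
  also have "\<dots> = (\<integral>\<^sup>+x. emeasure lborel (Pair x -` G) \<partial>lborel)"
  proof (rule nn_integral_cong)
    fix x
    have "Pair x -` G = {- l x..l x} - {0}" by (auto simp: G_def abs_le_iff)
    also have "emeasure lborel \<dots> = emeasure lborel {- l x..l x}"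
      by (rule emeasure_Diff_null_set) auto
    also have "\<dots> = 2 * ennreal (l x)" using l0[of x] by (simp add: ennreal_mult'')
    finally show "2 * ennreal (l x) = emeasure lborel (Pair x -` G)" by simp
  qed
  also have "\<dots> = emeasure (lborel \<Otimes>\<^sub>M lborel) G"
    by (rule lborel.emeasure_pair_measure_alt[OF Gm, symmetric])
  also have "\<dots> = (\<integral>\<^sup>+t. emeasure lborel ((\<lambda>x. (x, t)) -` G) \<partial>lborel)"
    by (rule lborel_pair.emeasure_pair_measure_alt2[OF Gm])
  finally have layers: "2 * emeasure lborel S = (\<integral>\<^sup>+t. emeasure lborel ((\<lambda>x. (x, t)) -` G) \<partial>lborel)" .
  let ?D = "cball 0 d :: (real \<times> real) set"
  have Dm: "?D \<in> sets (lborel \<Otimes>\<^sub>M lborel)" unfolding lborel_prod by simp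
  have layer: "2 * emeasure lborel ((\<lambda>x. (x, t)) -` G) \<le> emeasure lborel (Pair t -` ?D)" for t
  proof (cases "(\<lambda>x. (x, t)) -` G = {}")
    case False
    have E: "(x - y)\<^sup>2 + t\<^sup>2 \<le> d\<^sup>2" if "x \<in> (\<lambda>x. (x, t)) -` G" "y \<in> (\<lambda>x. (x, t)) -` G" for x y
      using slice_layer_bound[OF S, of "\<bar>t\<bar>" x y] that by (simp add: G_def l_def d_def)
    from False E have t: "t\<^sup>2 \<le> d\<^sup>2" by force
    define w where "w = sqrt (d\<^sup>2 - t\<^sup>2)"
    have "emeasure lborel ((\<lambda>x. (x, t)) -` G) \<le> ennreal w"
    proof (rule emeasure_lborel_le_diameter)
      fix x y assume "x \<in> (\<lambda>x. (x, t)) -` G" "y \<in> (\<lambda>x. (x, t)) -` G"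
      from E[OF this] show "x - y \<le> w" unfolding w_def by (intro real_le_rsqrt) linarith
    qed
    hence "2 * emeasure lborel ((\<lambda>x. (x, t)) -` G) \<le> 2 * ennreal w" by (rule mult_left_mono) simp
    also have "\<dots> = emeasure lborel {-w..w}" using t by (simp add: w_def ennreal_mult'')
    also have "{-w..w} = Pair t -` ?D"
    proof -
      have "u \<in> {-w..w} \<longleftrightarrow> u \<in> Pair t -` ?D" for u
      proof -
        have "u \<in> {-w..w} \<longleftrightarrow> \<bar>u\<bar> \<le> sqrt (d\<^sup>2 - t\<^sup>2)" by (auto simp: w_def)
        also have "\<dots> \<longleftrightarrow> t\<^sup>2 + u\<^sup>2 \<le> d\<^sup>2"
          using t by (metis (no_types) abs_ge_zero add.commute le_diff_eq power2_abs real_sqrt_abs real_sqrt_le_iff)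
        also have "\<dots> \<longleftrightarrow> u \<in> Pair t -` ?D"
          using d real_sqrt_le_iff[of "t\<^sup>2 + u\<^sup>2" "d\<^sup>2"] by (simp add: norm_Pair)
        finally show ?thesis .
      qed
      thus ?thesis by blast
    qed
    finally show ?thesis .
  qed auto
  \<comment> \<open>One factor 2 comes from the two signs in \<open>G\<close>, the other from
    \<open>layer\<close>. The disc of comparison therefore has radius \<open>d\<close> instead of
    \<open>d / 2\<close>.\<close>
  have "4 * emeasure lborel S = 2 * (\<integral>\<^sup>+t. emeasure lborel ((\<lambda>x. (x, t)) -` G) \<partial>lborel)"
    unfolding layers[symmetric] by (simp add: mult.assoc[symmetric])
  also have "\<dots> = (\<integral>\<^sup>+t. 2 * emeasure lborel ((\<lambda>x. (x, t)) -` G) \<partial>lborel)"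
    using lborel_pair.measurable_emeasure_Pair2[OF Gm] by (simp add: nn_integral_cmult)
  also have "\<dots> \<le> (\<integral>\<^sup>+t. emeasure lborel (Pair t -` ?D) \<partial>lborel)"
    by (intro nn_integral_mono layer)
  also have "\<dots> = emeasure lborel ?D"
    using lborel.emeasure_pair_measure_alt[OF Dm] by (simp add: lborel_prod)
  also have "\<dots> = ennreal (pi * d\<^sup>2)"
    using d by (simp add: emeasure_cball eval_unit_ball_vol power2_eq_square)
  finally have "4 * emeasure lborel S \<le> ennreal (pi * d\<^sup>2)" .
  moreover have "emeasure lborel S < \<infinity>" by (rule emeasure_compact_finite[OF S])
  ultimately show ?thesis
    by (cases "emeasure lborel S" rule: ennreal_cases)
       (auto simp: d_def field_simps ennreal_mult''[symmetric] ennreal_numeral[symmetric] simp del: ennreal_numeral)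
qed

text \<open>The sum over a cover dominates the volume whatever the mesh, so mesh 1 already gives the
  bound. Passing to closures makes the covering sets compact and keeps their diameters.\<close>

lemma lebesgue_le_hausdorff_outer:
  fixes A :: "'a::euclidean_space set"
  assumes iso: "\<And>S :: 'a set. compact S \<Longrightarrow>
      emeasure lborel S \<le> ennreal (unit_ball_vol (real k) * (diameter S / 2) ^ k)"
    and A: "A \<in> sets borel"
  shows "emeasure lborel A \<le> hausdorff_outer k A"
proof -
  have "emeasure lborel A \<le> hausdorff_premeasure k 1 A"
  proof (rule hausdorff_premeasure_greatest)
    fix U :: "nat \<Rightarrow> 'a set"
    assume U: "A \<subseteq> (\<Union>i. U i)" "\<And>i. bounded (U i)"
    have "A \<subseteq> (\<Union>i. closure (U i))"
      by (rule order_trans[OF U(1)]) (intro UN_mono closure_subset order_refl)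
    hence "emeasure lborel A \<le> emeasure lborel (\<Union>i. closure (U i))" by (intro emeasure_mono) auto
    also have "\<dots> \<le> (\<Sum>i. emeasure lborel (closure (U i)))" by (intro emeasure_subadditive_countably) auto
    also have "\<dots> \<le> (\<Sum>i. hausdorff_weight k (U i))"
    proof (rule suminf_le)
      fix i
      show "emeasure lborel (closure (U i)) \<le> hausdorff_weight k (U i)"
        using iso[of "closure (U i)"] U(2)[of i]
        by (cases "U i = {}") (auto simp: hausdorff_weight_def diameter_closure)
    qed auto
    finally show "emeasure lborel A \<le> (\<Sum>i. hausdorff_weight k (U i))" .
  qed
  also have "\<dots> \<le> hausdorff_outer k A" unfolding hausdorff_outer_def by (intro SUP_upper) auto
  finally show ?thesis .
qed

lemma lebesgue_le_hausdorff_outer_2: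
  fixes A :: "(real \<times> real) set"
  assumes "A \<in> sets borel"
  shows "emeasure lborel A \<le> hausdorff_outer 2 A"
  by (rule lebesgue_le_hausdorff_outer[OF _ assms])
     (use isodiametric_plane in \<open>simp add: eval_unit_ball_vol\<close>)

lemma lebesgue_le_hausdorff_outer_1:
  fixes A :: "real set"
  assumes "A \<in> sets borel"
  shows "emeasure lborel A \<le> hausdorff_outer 1 A"
proof (rule lebesgue_le_hausdorff_outer[OF _ assms])
  fix S :: "real set" assume "compact S"
  have "emeasure lborel S \<le> ennreal (diameter S)"
  proof (rule emeasure_lborel_le_diameter)
    show "x - y \<le> diameter S" if "x \<in> S" "y \<in> S" for x y
      using diameter_bounded_bound[OF compact_imp_bounded[OF \<open>compact S\<close>] that]
      by (simp add: dist_real_def)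
  qed
  thus "emeasure lborel S \<le> ennreal (unit_ball_vol (real 1) * (diameter S / 2) ^ 1)" by simp
qed

section \<open>The length of a circle\<close>

lemma norm_real2: "norm (v :: real^2) = sqrt ((v $ 1)\<^sup>2 + (v $ 2)\<^sup>2)"
  by (simp add: norm_vec_def L2_set_def sum_2)

lemma inner_real2: "(v :: real^2) \<bullet> w = v $ 1 * w $ 1 + v $ 2 * w $ 2"
  by (simp add: inner_vec_def sum_2)

definition circle_arc :: "real \<Rightarrow> real \<Rightarrow> real^2" where
  "circle_arc r t = vector [r * cos t, r * sin t]"

lemma circle_arc_nth [simp]: "circle_arc r t $ 1 = r * cos t" "circle_arc r t $ 2 = r * sin t"
  by (simp_all add: circle_arc_def)

lemma norm_circle_arc [simp]: "norm (circle_arc r t) = \<bar>r\<bar>"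
proof -
  have "(r * cos t)\<^sup>2 + (r * sin t)\<^sup>2 = r\<^sup>2 * ((cos t)\<^sup>2 + (sin t)\<^sup>2)"
    by (simp add: power_mult_distrib algebra_simps del: sin_cos_squared_add2)
  thus ?thesis by (simp add: norm_real2)
qed

lemma continuous_on_circle_arc [continuous_intros]:
  fixes f :: "'a::t2_space \<Rightarrow> real"
  assumes "continuous_on A f"
  shows "continuous_on A (\<lambda>x. circle_arc r (f x))"
proof -
  have "circle_arc r t = (r * cos t) *\<^sub>R axis 1 1 + (r * sin t) *\<^sub>R axis 2 1" for t
    by (simp add: vec_eq_iff forall_2 axis_def)
  thus ?thesis by (simp only:) (intro continuous_intros assms)
qed

lemma circle_arc_cases:
  assumes "norm y = r" "r \<ge> 0"
  obtains t where "0 \<le> t" "t < 2 * pi" "y = circle_arc r t"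
proof (cases "r = 0")
  case True
  thus ?thesis using that[of 0] assms by (auto simp: vec_eq_iff forall_2)
next
  case False
  hence r: "r > 0" using assms by simp
  have "(y $ 1)\<^sup>2 + (y $ 2)\<^sup>2 = r\<^sup>2"
    using assms by (metis norm_real2 real_sqrt_pow2 sum_power2_ge_zero)
  hence "(y $ 1 / r)\<^sup>2 + (y $ 2 / r)\<^sup>2 = 1"
    using r by (simp add: power_divide add_divide_distrib[symmetric])
  then obtain t where "0 \<le> t" "t < 2 * pi" "y $ 1 / r = cos t" "y $ 2 / r = sin t"
    using sincos_total_2pi by metis
  thus ?thesis using that[of t] r by (auto simp: vec_eq_iff forall_2 field_simps)
qed

lemma sphere_eq_circle_arc: "r \<ge> 0 \<Longrightarrow> sphere 0 r = circle_arc r ` {0..2 * pi}"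
proof (intro equalityI subsetI)
  fix y :: "real^2" assume "r \<ge> 0" "y \<in> sphere 0 r"
  hence "norm y = r" by simp
  thus "y \<in> circle_arc r ` {0..2 * pi}"
    using \<open>r \<ge> 0\<close> by (rule circle_arc_cases) auto
qed auto

text \<open>The chord over an angle \<open>h\<close> has length \<open>2 * r * sin (h / 2)\<close>
  up to sign, which is at most \<open>r * h\<close> in absolute value. Arc-length parametrization
  thus carries the upper bound for intervals over to the circle.\<close>

lemma dist_circle_arc:
  assumes "r > 0"
  shows "dist (circle_arc r (s / r)) (circle_arc r (t / r)) \<le> dist s t"
proof -
  let ?a = "s / r" and ?b = "t / r"
  have "(dist (circle_arc r ?a) (circle_arc r ?b))\<^sup>2 = r\<^sup>2 * ((cos ?a - cos ?b)\<^sup>2 + (sin ?a - sin ?b)\<^sup>2)"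
    by (simp add: dist_norm norm_real2 power_mult_distrib[symmetric] algebra_simps)
  also have "(cos ?a - cos ?b)\<^sup>2 + (sin ?a - sin ?b)\<^sup>2 = 2 - 2 * cos (?a - ?b)"
    using sin_cos_squared_add[of ?a] sin_cos_squared_add[of ?b]
    by (simp add: cos_diff power2_eq_square algebra_simps)
  also have "\<dots> = 4 * (sin ((?a - ?b) / 2))\<^sup>2"
  proof -
    define h where "h = (?a - ?b) / 2"
    have "?a - ?b = 2 * h" unfolding h_def by (simp only: mult_2 field_sum_of_halves)
    thus ?thesis unfolding h_def[symmetric] by (simp add: cos_double_sin)
  qed
  also have "\<dots> \<le> (?a - ?b)\<^sup>2"
    using power_mono[OF abs_sin_x_le_abs_x[of "(?a - ?b) / 2"], of 2] by (simp add: power_divide)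
  also have "r\<^sup>2 * (?a - ?b)\<^sup>2 = (s - t)\<^sup>2"
    using assms by (simp add: power_mult_distrib[symmetric] right_diff_distrib)
  finally have "(dist (circle_arc r ?a) (circle_arc r ?b))\<^sup>2 \<le> (dist s t)\<^sup>2"
    by (simp add: dist_real_def mult_left_mono)
  thus ?thesis by (rule power2_le_imp_le) simp
qed

lemma circle_arc_eq_imp:
  assumes "circle_arc r s = circle_arc r t" "r > 0"
  shows "\<exists>k::int. s = t + 2 * pi * real_of_int k"
proof -
  have "r * cos s = r * cos t" "r * sin s = r * sin t"
    using assms(1) by (metis circle_arc_nth)+
  thus ?thesis using assms(2) sin_cos_eq_iff[of s t] by (auto simp: mult.commute mult.left_commute)
qed

text \<open>Projecting the arc onto its chord loses only the difference between arc and chord length.\<close>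

lemma hausdorff_outer_arc_ge:
  assumes r: "r > 0" and a: "0 < a" "a \<le> pi / 2"
  shows "ennreal (2 * r * sin a) \<le> hausdorff_outer 1 (circle_arc r ` {c - a..c + a})"
proof -
  \<comment> \<open>The unit tangent at the midpoint of the arc, which is the direction of the
    chord.\<close>
  define u where "u = circle_arc 1 (c + pi / 2)"
  have u: "circle_arc r t \<bullet> u = r * sin (t - c)" for t
    by (simp add: u_def inner_real2 cos_add sin_add sin_diff algebra_simps)
  have cont: "continuous_on {c - a..c + a} (\<lambda>t. r * sin (t - c))" by (intro continuous_intros)
  have "{- (r * sin a)..r * sin a} \<subseteq> (\<lambda>y. y \<bullet> u) ` circle_arc r ` {c - a..c + a}"
  proof
    fix z assume "z \<in> {- (r * sin a)..r * sin a}"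
    then obtain t where "c - a \<le> t" "t \<le> c + a" "r * sin (t - c) = z"
      using IVT'[of "\<lambda>t. r * sin (t - c)" "c - a" z "c + a"] cont a by auto
    thus "z \<in> (\<lambda>y. y \<bullet> u) ` circle_arc r ` {c - a..c + a}"
      by (auto simp: image_image u intro!: image_eqI[of _ _ t])
  qed
  hence "hausdorff_outer 1 {- (r * sin a)..r * sin a} \<le> hausdorff_outer 1 ((\<lambda>y. y \<bullet> u) ` circle_arc r ` {c - a..c + a})"
    by (rule hausdorff_outer_mono)
  also have "\<dots> \<le> hausdorff_outer 1 (circle_arc r ` {c - a..c + a})"
  proof (rule hausdorff_outer_image_le)
    fix x y :: "real^2"
    have "\<bar>(x - y) \<bullet> u\<bar> \<le> norm (x - y) * norm u" by (rule Cauchy_Schwarz_ineq2)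
    thus "dist (x \<bullet> u) (y \<bullet> u) \<le> dist x y"
      by (simp add: dist_norm inner_diff_left u_def)
  qed
  finally have "hausdorff_outer 1 {- (r * sin a)..r * sin a} \<le> hausdorff_outer 1 (circle_arc r ` {c - a..c + a})" .
  moreover have "emeasure lborel {- (r * sin a)..r * sin a} \<le> hausdorff_outer 1 {- (r * sin a)..r * sin a}"
    by (rule lebesgue_le_hausdorff_outer_1) simp
  moreover have "sin a \<ge> 0" using a by (intro sin_ge_zero) auto
  ultimately show ?thesis using r by (simp add: mult.assoc)
qed

text \<open>The half-angle \<open>pi / (n + 1)\<close> is slightly below half the spacing
  \<open>2 * pi / n\<close> of the midpoints, so the closed arcs are disjoint and additivity of the
  measure applies. The gaps disappear in the limit.\<close>

lemma hausdorff_outer_circle_ge_polygon: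
  assumes r: "r > 0" and n: "n \<ge> (2::nat)"
  shows "ennreal (real n * (2 * r * sin (pi / (n + 1)))) \<le> hausdorff_outer 1 (sphere (0::real^2) r)"
proof -
  define a where "a = pi / (n + 1)"
  have a: "0 < a" "a \<le> pi / 2" "2 * a * (real n + 1) = 2 * pi"
    using n by (auto simp: a_def field_simps)
  define A where "A j = circle_arc r ` {2 * pi * real j / n - a..2 * pi * real j / n + a}" for j
  have cA: "compact (A j)" for j
    unfolding A_def by (intro compact_continuous_image continuous_intros) simp
  have disj: "disjoint_family_on A {..<n}"
  proof (unfold disjoint_family_on_def, intro ballI impI)
    have aux: "A i \<inter> A j = {}" if ij: "i < j" "j < n" for i j
    proof (rule ccontr)
      assume "A i \<inter> A j \<noteq> {}"
      then obtain s t where st: "circle_arc r s = circle_arc r t"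
        "s \<in> {2 * pi * real i / n - a..2 * pi * real i / n + a}"
        "t \<in> {2 * pi * real j / n - a..2 * pi * real j / n + a}"
        unfolding A_def by auto metis
      obtain k :: int where k: "t = s + 2 * pi * real_of_int k"
        using circle_arc_eq_imp[OF st(1)[symmetric] r] by blast
      \<comment> \<open>Together with \<open>2 * a < 2 * pi / n\<close> these bounds place
        \<open>t - s\<close> strictly between 0 and \<open>2 * pi\<close>, so it is no multiple of
        \<open>2 * pi\<close>.\<close>
      have d: "2 * pi / n - 2 * a \<le> t - s" "t - s \<le> 2 * pi * (real n - 1) / n + 2 * a"
      proof -
        have "2 * pi * real i / n + 2 * pi / n \<le> 2 * pi * real j / n"
          using mult_left_mono[of "real (Suc i)" "real j" "2 * pi / n"] ij
          by (simp add: distrib_left add_divide_distrib)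
        thus "2 * pi / n - 2 * a \<le> t - s" using st by auto
        have "2 * pi * real j / n \<le> 2 * pi * (real n - 1) / n"
          using ij n by (intro divide_right_mono mult_left_mono) auto
        moreover have "2 * pi * real i / n \<ge> 0" by simp
        moreover have "t \<le> 2 * pi * real j / n + a" "2 * pi * real i / n - a \<le> s" using st by auto
        ultimately show "t - s \<le> 2 * pi * (real n - 1) / n + 2 * a" by linarith
      qed
      have "2 * a < 2 * pi / n" using n by (simp add: a_def field_simps)
      hence "0 < t - s" using d(1) by linarith
      hence "k > 0" using k by (simp add: zero_less_mult_iff)
      hence "2 * pi * 1 \<le> 2 * pi * real_of_int k" by (intro mult_left_mono) auto
      hence "2 * pi \<le> t - s" using k by simp
      also have "\<dots> < 2 * pi * (real n - 1) / n + 2 * pi / n"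
        using d(2) \<open>2 * a < 2 * pi / n\<close> by linarith
      also have "\<dots> = 2 * pi" using n by (simp add: field_simps)
      finally show False by simp
    qed
    fix i j assume "i \<in> {..<n}" "j \<in> {..<n}" "i \<noteq> j"
    thus "A i \<inter> A j = {}" using aux[of i j] aux[of j i] by (cases i j rule: linorder_cases) auto
  qed
  have "ennreal (real n * (2 * r * sin a)) = (\<Sum>j<n. ennreal (2 * r * sin a))"
    using a r by (simp add: ennreal_mult' ennreal_of_nat_eq_real_of_nat)
  also have "\<dots> \<le> (\<Sum>j<n. emeasure (hausdorff_measure 1) (A j))"
    unfolding A_def using hausdorff_outer_arc_ge[OF r a(1,2)] cA
    by (intro sum_mono) (subst emeasure_hausdorff_measure, auto simp: borel_compact A_def)
  also have "\<dots> = emeasure (hausdorff_measure 1) (\<Union>j<n. A j)"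
    using cA disj by (intro sum_emeasure) (auto simp: borel_compact)
  also have "\<dots> = hausdorff_outer 1 (\<Union>j<n. A j)"
    using cA by (intro emeasure_hausdorff_measure sets.finite_UN) (auto simp: borel_compact)
  also have "\<dots> \<le> hausdorff_outer 1 (sphere (0::real^2) r)"
    using r by (intro hausdorff_outer_mono) (auto simp: A_def)
  finally show ?thesis by (simp add: a_def)
qed

lemma emeasure_hausdorff_circle:
  assumes r: "r > 0"
  shows "emeasure (hausdorff_measure 1) (sphere (0::real^2) r) = ennreal (2 * pi * r)"
proof -
  have "sphere (0::real^2) r = (\<lambda>s. circle_arc r (s / r)) ` {0..2 * pi * r}"
  proof -
    have "{0..2 * pi} = (\<lambda>s. s / r) ` {0..2 * pi * r}"
    proof (intro equalityI subsetI)
      fix t assume "t \<in> {0..2 * pi}"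
      thus "t \<in> (\<lambda>s. s / r) ` {0..2 * pi * r}" using r by (intro image_eqI[of _ _ "t * r"]) auto
    qed (use r in \<open>auto simp: field_simps\<close>)
    moreover have "sphere (0::real^2) r = circle_arc r ` {0..2 * pi}"
      using r by (intro sphere_eq_circle_arc) simp
    ultimately show ?thesis by (metis image_image)
  qed
  hence "hausdorff_outer 1 (sphere (0::real^2) r) \<le> hausdorff_outer 1 {0..2 * pi * r}"
    using hausdorff_outer_image_le[OF dist_circle_arc[OF r], of 1] by simp
  also have "\<dots> \<le> ennreal (2 * pi * r)"
    using hausdorff_outer_le_lebesgue[of "{0..2 * pi * r}"] r by (simp add: lmeasurable_cbox[of 0, simplified])
  finally have "hausdorff_outer 1 (sphere (0::real^2) r) \<le> ennreal (2 * pi * r)" .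
  moreover have "ennreal (2 * pi * r) \<le> hausdorff_outer 1 (sphere (0::real^2) r)"
  proof (rule LIMSEQ_le_const2)
    show "(\<lambda>n. ennreal (real n * (2 * r * sin (pi / (real n + 1))))) \<longlonglongrightarrow> ennreal (2 * pi * r)"
      by (rule tendsto_ennrealI) real_asymp
    show "\<exists>N. \<forall>n\<ge>N. ennreal (real n * (2 * r * sin (pi / (real n + 1)))) \<le> hausdorff_outer 1 (sphere (0::real^2) r)"
      using hausdorff_outer_circle_ge_polygon[OF r] by (intro exI[of _ 2]) (auto simp: add.commute)
  qed
  ultimately show ?thesis by (simp add: emeasure_hausdorff_measure)
qed

section \<open>The ends of the catenoid\<close>

lemma mem_catenoid: "x \<in> catenoid m \<longleftrightarrow> norm (fst x) = m * cosh (snd x / m)"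
  by (cases x) (auto simp: catenoid_def)

lemma closed_catenoid: "m > 0 \<Longrightarrow> closed (catenoid m)"
proof -
  assume "m > 0"
  have "catenoid m = {x. norm (fst x) = m * cosh (snd x / m)}" by (auto simp: mem_catenoid)
  thus ?thesis using \<open>m > 0\<close> by (simp only:) (intro closed_Collect_eq continuous_intros; simp)
qed

definition catenoid_region :: "real \<Rightarrow> space3 set" where
  "catenoid_region m = {x. norm (fst x) < m * cosh (snd x / m)}"

text \<open>The sign \<open>s\<close> selects the end, so that one argument serves both. For
  \<open>a >= 0\<close> the two halves are what remains of the catenoid after the slab of height
  \<open>a\<close> is removed.\<close>

definition cat_half :: "real \<Rightarrow> real \<Rightarrow> real \<Rightarrow> space3 set" where
  "cat_half m s a = {x \<in> catenoid m. s * snd x > a}"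
definition cat_slab :: "real \<Rightarrow> real \<Rightarrow> space3 set" where
  "cat_slab m a = {x \<in> catenoid m. \<bar>snd x\<bar> \<le> a}"

text \<open>The region is a union of horizontal discs, each joined to the axis, and all these
  connected sets share the axis.\<close>

lemma connected_catenoid_region:
  assumes m: "m > 0"
  shows "connected (catenoid_region m)"
proof -
  let ?L = "\<lambda>h. (\<lambda>y. (y, h)) ` ball (0::real^2) (m * cosh (h / m))"
  let ?A = "{0::real^2} \<times> (UNIV :: real set)"
  have "catenoid_region m = (\<Union>h. ?L h \<union> ?A)"
  proof (intro equalityI subsetI)
    fix x assume "x \<in> catenoid_region m"
    hence "x \<in> ?L (snd x)" by (intro image_eqI[of _ _ "fst x"]) (auto simp: catenoid_region_def)
    thus "x \<in> (\<Union>h. ?L h \<union> ?A)" by blast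
  qed (use m in \<open>auto simp: catenoid_region_def\<close>)
  also have "connected \<dots>"
  proof (rule connected_Union)
    fix T assume "T \<in> range (\<lambda>h. ?L h \<union> ?A)"
    then obtain h where T: "T = ?L h \<union> ?A" by blast
    have "(0, h) \<in> ?L h \<inter> ?A" using m by auto
    thus "connected T" unfolding T
      by (intro connected_Un connected_continuous_image continuous_intros) (auto simp: connected_Times)
  qed blast
  finally show ?thesis .
qed

text \<open>The function \<open>norm (fst x) - m * cosh (snd x / m)\<close> vanishes exactly on the
  catenoid, so on the connected set \<open>M\<close> it keeps the negative sign that it has at the
  origin.\<close>

lemma component_eq_catenoid_region:
  assumes m: "m > 0" and M: "M \<in> components (- catenoid m)" "{x. fst x = 0} \<subseteq> M"
  shows "M = catenoid_region m"
proof -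
  have sub: "catenoid_region m \<subseteq> - catenoid m" by (auto simp: catenoid_region_def mem_catenoid)
  have 0: "0 \<in> catenoid_region m" "0 \<in> M" using m M(2) by (auto simp: catenoid_region_def)
  have 1: "catenoid_region m \<subseteq> M"
    by (rule components_maximal[OF M(1) connected_catenoid_region[OF m] sub]) (use 0 in blast)
  have "connected M" "M \<subseteq> - catenoid m" using M(1) by (auto simp: in_components_connected in_components_subset)
  have "M \<subseteq> catenoid_region m"
  proof (rule ccontr)
    assume "\<not> ?thesis"
    then obtain x where x: "x \<in> M" "x \<notin> catenoid_region m" by blast
    let ?f = "\<lambda>x::space3. norm (fst x) - m * cosh (snd x / m)"
    have "connected (?f ` M)"
      using m by (intro connected_continuous_image \<open>connected M\<close> continuous_intros) auto
    moreover have "?f 0 \<in> ?f ` M" "?f x \<in> ?f ` M" using x 0 by blast+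
    moreover have "?f 0 \<le> 0" "0 \<le> ?f x" using m x by (auto simp: catenoid_region_def)
    ultimately have "0 \<in> ?f ` M" using connected_contains_Icc[of "?f ` M" "?f 0" "?f x"] by auto
    thus False using \<open>M \<subseteq> - catenoid m\<close> by (auto simp: mem_catenoid)
  qed
  with 1 show ?thesis by blast
qed

text \<open>Scaling the horizontal coordinates by a factor \<open>t < 1\<close> moves any point of
  the closed set into the region.\<close>

lemma closure_catenoid_region:
  assumes m: "m > 0"
  shows "closure (catenoid_region m) = {x. norm (fst x) \<le> m * cosh (snd x / m)}"
proof (rule antisym)
  show "closure (catenoid_region m) \<subseteq> {x. norm (fst x) \<le> m * cosh (snd x / m)}"
  proof (rule closure_minimal)
    show "closed {x::space3. norm (fst x) \<le> m * cosh (snd x / m)}"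
      using m by (intro closed_Collect_le continuous_intros) auto
  qed (auto simp: catenoid_region_def)
  show "{x. norm (fst x) \<le> m * cosh (snd x / m)} \<subseteq> closure (catenoid_region m)"
  proof
    fix x :: space3 assume x: "x \<in> {x. norm (fst x) \<le> m * cosh (snd x / m)}"
    have "((\<lambda>t. (t *\<^sub>R fst x, snd x)) \<longlongrightarrow> (1 *\<^sub>R fst x, snd x)) (at_left (1::real))"
      by (intro tendsto_intros)
    hence "((\<lambda>t. (t *\<^sub>R fst x, snd x)) \<longlongrightarrow> x) (at_left (1::real))" by simp
    moreover have "eventually (\<lambda>t. (t *\<^sub>R fst x, snd x) \<in> catenoid_region m) (at_left (1::real))"
      unfolding eventually_at_left_field
    proof (intro exI[of _ 0] conjI allI impI)
      fix t :: real assume t: "0 < t" "t < 1"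
      have "0 < m * cosh (snd x / m)" using m by simp
      hence "t * norm (fst x) < m * cosh (snd x / m)"
        using t x by (cases "fst x = 0") (auto intro: less_le_trans[of _ "norm (fst x)"])
      thus "(t *\<^sub>R fst x, snd x) \<in> catenoid_region m" using t by (simp add: catenoid_region_def)
    qed simp
    ultimately show "x \<in> closure (catenoid_region m)"
      by (intro Lim_in_closed_set[OF closed_closure _ trivial_limit_at_left_real])
         (auto elim!: eventually_mono intro: closure_subset[THEN subsetD])
  qed
qed

lemma cat_half_nonempty: 
  assumes "m > 0" "s \<in> {1, -1}"
  shows "\<exists>x. x \<in> cat_half m s a \<and> x \<in> cat_half m s b"
proof -
  define t where "t = s * (max a b + 1)"
  have "s * t = max a b + 1" using assms(2) by (auto simp: t_def)
  thus ?thesis using assms(1)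
    by (intro exI[of _ "(circle_arc (m * cosh (t / m)) 0, t)"]) (auto simp: cat_half_def mem_catenoid)
qed

lemma connected_cat_half:
  assumes m: "m > 0" and s: "s \<in> {1, -1}"
  shows "connected (cat_half m s a)"
proof -
  let ?F = "\<lambda>(\<theta>, t). (circle_arc (m * cosh (t / m)) \<theta>, t)"
  have "cat_half m s a = ?F ` (UNIV \<times> {t. a < s * t})"
  proof (intro equalityI subsetI)
    fix x assume x: "x \<in> cat_half m s a"
    hence "norm (fst x) = m * cosh (snd x / m)" by (simp add: cat_half_def mem_catenoid)
    then obtain \<theta> where "fst x = circle_arc (m * cosh (snd x / m)) \<theta>"
      using circle_arc_cases[of "fst x" "m * cosh (snd x / m)"] m by auto
    thus "x \<in> ?F ` (UNIV \<times> {t. a < s * t})"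
      using x by (intro image_eqI[of _ _ "(\<theta>, snd x)"]) (auto simp: cat_half_def prod_eq_iff)
  qed (use m in \<open>auto simp: cat_half_def mem_catenoid\<close>)
  also have "connected \<dots>"
  proof (rule connected_continuous_image)
    \<comment> \<open>The continuity rule for \<open>circle_arc\<close> treats a fixed radius;
      factoring the variable radius out makes it applicable.\<close>
    have "circle_arc (m * cosh (t / m)) \<theta> = (m * cosh (t / m)) *\<^sub>R circle_arc 1 \<theta>" for t \<theta>
      by (simp add: vec_eq_iff forall_2)
    hence "?F = (\<lambda>p. ((m * cosh (snd p / m)) *\<^sub>R circle_arc 1 (fst p), snd p))" by (auto simp: fun_eq_iff)
    thus "continuous_on (UNIV \<times> {t. a < s * t}) ?F" using m
      by (simp only:) (intro continuous_intros; simp)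
    have "{t. a < s * t} = (if s = 1 then {a<..} else {..< - a})" using s by auto
    thus "connected ((UNIV :: real set) \<times> {t. a < s * t})" by (simp add: connected_Times)
  qed
  finally show ?thesis .
qed

lemma compact_cat_slab:
  assumes m: "m > 0"
  shows "compact (cat_slab m a)"
proof -
  have "cat_slab m a = catenoid m \<inter> {x. \<bar>snd x\<bar> \<le> a}" by (auto simp: cat_slab_def)
  hence "closed (cat_slab m a)"
    using closed_catenoid[OF m] by (simp only:) (intro closed_Int closed_Collect_le continuous_intros; simp)
  moreover have "cat_slab m a \<subseteq> cball 0 (m * cosh (a / m)) \<times> cball 0 a"
  proof
    fix x assume x: "x \<in> cat_slab m a"
    hence "cosh (\<bar>snd x\<bar> / m) \<le> cosh (a / m)"
      using m by (subst cosh_real_nonneg_le_iff) (auto simp: cat_slab_def divide_right_mono)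
    moreover have "cosh (\<bar>snd x\<bar> / m) = cosh (snd x / m)" by (cases "snd x \<ge> 0") auto
    ultimately have "m * cosh (snd x / m) \<le> m * cosh (a / m)" using m by simp
    thus "x \<in> cball 0 (m * cosh (a / m)) \<times> cball 0 a"
      using x by (simp add: cat_slab_def mem_catenoid mem_Times_iff)
  qed
  ultimately show ?thesis
    using bounded_subset[OF bounded_Times[OF bounded_cball bounded_cball]]
    by (auto simp: compact_eq_bounded_closed)
qed

section \<open>Classification of the ends by the sign of the height\<close>

lemma compact_subset_cat_slab:
  assumes "compact K" "K \<subseteq> catenoid m"
  obtains a where "a > 0" "K \<subseteq> cat_slab m a"
proof -
  obtain B where B: "\<forall>x\<in>K. norm x \<le> B" using compact_imp_bounded[OF assms(1)] by (auto simp: bounded_iff)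
  have "\<bar>snd x\<bar> \<le> max B 1" if "x \<in> K" for x
    using B[rule_format, OF that] norm_snd_le[of "snd x" "fst x"] by simp
  hence "K \<subseteq> cat_slab m (max B 1)" using assms(2) by (auto simp: cat_slab_def)
  thus ?thesis using that[of "max B 1"] by simp
qed

text \<open>On \<open>C\<close> the height stays outside the interval from \<open>- a\<close> to
  \<open>a\<close>, so by connectedness it keeps its sign.\<close>

lemma connected_avoiding_slab:
  assumes C: "connected C" "C \<subseteq> catenoid m - cat_slab m a" and a: "a \<ge> 0"
    and x: "x \<in> C" "s * snd x > 0" and s: "s \<in> {1, -1}"
  shows "C \<subseteq> cat_half m s a"
proof
  fix y assume y: "y \<in> C"
  have abs: "\<bar>s * snd z\<bar> > a" if "z \<in> C" for z
    using that C(2) s by (auto simp: cat_slab_def)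
  let ?f = "\<lambda>z::space3. s * snd z"
  have "connected (?f ` C)" by (intro connected_continuous_image C continuous_intros)
  hence "s * snd y > 0"
    using connected_contains_Icc[of "?f ` C" "?f y" "?f x"] x y abs a
    by (cases "s * snd y > 0") (fastforce simp: not_less)+
  thus "y \<in> cat_half m s a" using abs[OF y] y C(2) by (auto simp: cat_half_def)
qed

lemma components_slab_complement:
  assumes m: "m > 0" and a: "a \<ge> 0" and C: "C \<in> components (catenoid m - cat_slab m a)"
  shows "\<exists>s\<in>{1, -1}. C = cat_half m s a"
proof -
  have C': "C \<noteq> {}" "connected C" "C \<subseteq> catenoid m - cat_slab m a"
    using C in_components_nonempty in_components_connected in_components_subset by blast+
  then obtain x where x: "x \<in> C" by blast
  have "\<bar>snd x\<bar> > a" using x C'(3) by (auto simp: cat_slab_def)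
  then obtain s :: real where s: "s \<in> {1, -1}" "s * snd x > a"
    using that[of 1] that[of "-1"] by (cases "snd x > 0") auto
  hence "C \<subseteq> cat_half m s a"
    using connected_avoiding_slab[OF C'(2,3) a x _ s(1)] a by auto
  moreover have "cat_half m s a \<subseteq> C"
  proof (rule components_maximal[OF C connected_cat_half[OF m s(1)]])
    show "cat_half m s a \<subseteq> catenoid m - cat_slab m a"
      using s(1) by (auto simp: cat_half_def cat_slab_def)
    show "C \<inter> cat_half m s a \<noteq> {}" using x \<open>C \<subseteq> cat_half m s a\<close> by blast
  qed
  ultimately show ?thesis using s(1) by blast
qed

text \<open>An end chooses a component for every compact set. The sign of the half that every tail
  eventually contains determines all these choices, which reduces ends to two signs.\<close>

definition end_side :: "real \<Rightarrow> (space3 set \<Rightarrow> space3 set) \<Rightarrow> real \<Rightarrow> bool" where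
  "end_side m E s \<longleftrightarrow> E \<in> ends (catenoid m) \<and> s \<in> {1, -1} \<and>
     (\<forall>K. compact K \<and> K \<subseteq> catenoid m \<longrightarrow> (\<exists>a. cat_half m s a \<subseteq> E K))"

lemma end_sideD:
  assumes "end_side m E s"
  shows "E \<in> ends (catenoid m)" "s \<in> {1, -1}"
    "compact K \<Longrightarrow> K \<subseteq> catenoid m \<Longrightarrow> \<exists>a. cat_half m s a \<subseteq> E K"
  using assms unfolding end_side_def by blast+

lemma endsD:
  assumes "E \<in> ends S" "compact K" "K \<subseteq> S"
  shows "E K \<in> components (S - K)" "\<And>K'. compact K' \<Longrightarrow> K \<subseteq> K' \<Longrightarrow> K' \<subseteq> S \<Longrightarrow> E K' \<subseteq> E K"
  using assms unfolding ends_def by (auto simp: PiE_iff)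

lemma end_slab:
  assumes "m > 0" "a \<ge> 0" "E \<in> ends (catenoid m)"
  shows "\<exists>s\<in>{1, -1}. E (cat_slab m a) = cat_half m s a"
proof (rule components_slab_complement[OF assms(1,2)])
  show "E (cat_slab m a) \<in> components (catenoid m - cat_slab m a)"
    by (rule endsD(1)[OF assms(3) compact_cat_slab[OF assms(1)]]) (auto simp: cat_slab_def)
qed

text \<open>The sign is read off at the slab of height 1. The tails of larger slabs are nested in
  that half, which forces the same sign, and every compact set lies in a slab.\<close>

lemma end_side_exists:
  assumes m: "m > 0" and E: "E \<in> ends (catenoid m)"
  shows "\<exists>s. end_side m E s"
proof -
  obtain s :: real where s: "s \<in> {1, -1}" "E (cat_slab m 1) = cat_half m s 1"
    using end_slab[OF m _ E, of 1] by auto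
  have "\<exists>a. cat_half m s a \<subseteq> E K" if K: "compact K" "K \<subseteq> catenoid m" for K
  proof -
    obtain b where b: "b > 0" "K \<subseteq> cat_slab m b" using compact_subset_cat_slab[OF K] by blast
    define a where "a = max b 1"
    have a: "a \<ge> 1" "K \<subseteq> cat_slab m a" "cat_slab m 1 \<subseteq> cat_slab m a" "cat_slab m a \<subseteq> catenoid m"
      using b by (auto simp: a_def cat_slab_def)
    obtain s' :: real where s': "s' \<in> {1, -1}" "E (cat_slab m a) = cat_half m s' a"
      using end_slab[OF m _ E, of a] a by auto
    have "cat_half m s' a \<subseteq> cat_half m s 1"
      using endsD(2)[OF E compact_cat_slab[OF m] _ compact_cat_slab[OF m] a(3,4)] s(2) s'(2) a(3,4)
      by auto
    moreover obtain x where "x \<in> cat_half m s' a" using cat_half_nonempty[OF m s'(1)] by blast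
    ultimately have "s' = s" using s(1) s'(1) a(1) by (auto simp: cat_half_def)
    hence "cat_half m s a \<subseteq> E K"
      using endsD(2)[OF E K compact_cat_slab[OF m] a(2,4)] s'(2) by simp
    thus ?thesis by blast
  qed
  thus ?thesis using s(1) E by (auto simp: end_side_def)
qed

lemma end_side_slab:
  assumes m: "m > 0" and E: "end_side m E s" and a: "a \<ge> 0"
  shows "E (cat_slab m a) = cat_half m s a"
proof -
  obtain s' :: real where s': "s' \<in> {1, -1}" "E (cat_slab m a) = cat_half m s' a"
    using end_slab[OF m a end_sideD(1)[OF E]] by blast
  obtain b where b: "cat_half m s b \<subseteq> E (cat_slab m a)"
    using end_sideD(3)[OF E compact_cat_slab[OF m]] by (auto simp: cat_slab_def)
  have s: "s \<in> {1, -1}" using E by (simp add: end_side_def)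
  obtain x where "x \<in> cat_half m s b" "x \<in> cat_half m s a" using cat_half_nonempty[OF m s] by blast
  hence "s * snd x > a" "s' * snd x > a" using b s'(2) by (auto simp: cat_half_def)
  hence "s = s'" using s s'(1) a by auto
  thus ?thesis using s'(2) by simp
qed

text \<open>Two far halves of the same sign always meet, and components that meet coincide.\<close>

lemma end_side_component:
  assumes "end_side m E s" "compact K" "K \<subseteq> catenoid m" "C \<in> components (catenoid m - K)"
    "cat_half m s a \<subseteq> C" "m > 0"
  shows "E K = C"
proof -
  obtain b where b: "cat_half m s b \<subseteq> E K" using assms by (auto simp: end_side_def)
  have "E K \<in> components (catenoid m - K)" using assms by (intro endsD(1)) (auto simp: end_side_def)
  moreover obtain x where "x \<in> cat_half m s a" "x \<in> cat_half m s b"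
    using cat_half_nonempty[of m s a b] assms by (auto simp: end_side_def)
  ultimately show ?thesis using components_nonoverlap[of "E K" _ C] assms(4,5) b by blast
qed

lemma end_side_unique:
  assumes "end_side m E s" "end_side m E' s" "m > 0"
  shows "E = E'"
proof (rule extensionalityI)
  let ?D = "{K. compact K \<and> K \<subseteq> catenoid m}"
  \<comment> \<open>Away from the compact subsets of the catenoid both functions take the default
    value of the extensional function space.\<close>
  show "E \<in> extensional ?D" "E' \<in> extensional ?D"
    using assms by (auto simp: end_side_def ends_def PiE_def)
  fix K assume "K \<in> ?D"
  moreover then obtain a where "cat_half m s a \<subseteq> E' K" using assms by (auto simp: end_side_def)
  moreover have "E' K \<in> components (catenoid m - K)"
    using assms calculation by (intro endsD(1)) (auto simp: end_side_def)
  ultimately show "E K = E' K" using assms by (intro end_side_component) auto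
qed

text \<open>For each compact set a component containing a far half is chosen. Compatibility holds
  because two far halves of the same sign meet, so the component for the larger compact set is a
  connected set meeting the other one.\<close>

lemma end_side_existence:
  assumes m: "m > 0" and s: "s \<in> {1, -1}"
  shows "\<exists>E. end_side m E s"
proof -
  let ?D = "{K. compact K \<and> K \<subseteq> catenoid m}"
  have "\<forall>K\<in>?D. \<exists>C. C \<in> components (catenoid m - K) \<and> (\<exists>a. cat_half m s a \<subseteq> C)"
  proof
    fix K assume K: "K \<in> ?D"
    obtain a where a: "a > 0" "K \<subseteq> cat_slab m a" using compact_subset_cat_slab K by blast
    have "cat_half m s a \<subseteq> catenoid m - K" using a s by (auto simp: cat_half_def cat_slab_def)
    moreover have "catenoid m - K \<noteq> {}" using calculation cat_half_nonempty[OF m s, of a a] by blast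
    ultimately show "\<exists>C. C \<in> components (catenoid m - K) \<and> (\<exists>a. cat_half m s a \<subseteq> C)"
      using exists_component_superset[OF _ _ connected_cat_half[OF m s]] by blast
  qed
  from bchoice[OF this] obtain F where F: "\<And>K. K \<in> ?D \<Longrightarrow> F K \<in> components (catenoid m - K)"
    "\<And>K. K \<in> ?D \<Longrightarrow> \<exists>a. cat_half m s a \<subseteq> F K" by blast
  define E where "E = restrict F ?D"
  have "E \<in> ends (catenoid m)"
    unfolding ends_def
  proof (intro CollectI conjI allI impI)
    show "E \<in> (\<Pi>\<^sub>E K\<in>?D. components (catenoid m - K))" using F(1) by (auto simp: E_def)
    fix K K' assume K: "compact K \<and> compact K' \<and> K \<subseteq> K' \<and> K' \<subseteq> catenoid m"
    hence D: "K \<in> ?D" "K' \<in> ?D" by auto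
    obtain a b where "cat_half m s a \<subseteq> F K" "cat_half m s b \<subseteq> F K'"
      using F(2)[OF D(1)] F(2)[OF D(2)] by blast
    hence "F K \<inter> F K' \<noteq> {}" using cat_half_nonempty[OF m s, of a b] by blast
    moreover have "connected (F K')" "F K' \<subseteq> catenoid m - K"
      using in_components_connected in_components_subset F(1)[OF D(2)] K by blast+
    ultimately have "F K' \<subseteq> F K" using components_maximal[OF F(1)[OF D(1)]] by blast
    thus "E K' \<subseteq> E K" using D by (simp add: E_def)
  qed
  thus ?thesis using F(2) s by (auto simp: end_side_def E_def)
qed

lemma end_side_sign_unique:
  assumes "end_side m E s" "end_side m E s'" "m > 0"
  shows "s = s'"
proof -
  have "cat_half m s 0 = cat_half m s' 0"
    using end_side_slab[OF assms(3,1), of 0] end_side_slab[OF assms(3,2), of 0] by simp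
  moreover obtain x where "x \<in> cat_half m s 0"
    using cat_half_nonempty[OF assms(3) end_sideD(2)[OF assms(1)]] by blast
  ultimately have "x \<in> cat_half m s 0" "x \<in> cat_half m s' 0" by auto
  thus ?thesis using assms(1,2) by (auto simp: end_side_def cat_half_def)
qed

lemma card_ends_catenoid:
  assumes m: "m > 0"
  shows "card (ends (catenoid m)) = 2"
proof -
  obtain E F where E: "end_side m E 1" and F: "end_side m F (-1)"
    using end_side_existence[OF m, of 1] end_side_existence[OF m, of "-1"] by auto
  have "E \<noteq> F" using end_side_sign_unique[OF E _ m, of "-1"] F by auto
  moreover have "ends (catenoid m) = {E, F}"
  proof (intro equalityI subsetI)
    fix G assume "G \<in> ends (catenoid m)"
    then obtain s where G: "end_side m G s" using end_side_exists[OF m] by blast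
    hence "s = 1 \<or> s = -1" by (auto simp: end_side_def)
    thus "G \<in> {E, F}" using end_side_unique[OF _ E m, of G] end_side_unique[OF _ F m, of G] G by auto
  qed (use E F in \<open>auto simp: end_side_def\<close>)
  ultimately show ?thesis by simp
qed

lemma other_end_side:
  assumes "end_side m E s" "F \<in> ends (catenoid m) - {E}" "m > 0"
  shows "end_side m F (- s)"
proof -
  obtain s' where s': "end_side m F s'" using end_side_exists assms by blast
  moreover have "s' \<noteq> s" using end_side_unique[of m F s E] s' assms by auto
  ultimately have "s' = - s" using assms(1) by (auto simp: end_side_def)
  thus ?thesis using s' by simp
qed

lemma full_tail_cat_half:
  assumes "end_side m E s" "a \<ge> 0" "m > 0"
  shows "full_tail (catenoid m) E (cat_half m s a)"
  unfolding full_tail_def using end_side_slab[OF assms(3,1,2)] compact_cat_slab[OF assms(3), of a]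
  by (intro exI[of _ "cat_slab m a"]) (auto simp: cat_slab_def)

text \<open>The compact set behind a full tail may fail to separate the ends, and the tail then
  contains far parts of both halves. The final alternative records this: far out, the opposite half
  lies in \<open>A\<close> entirely or not at all.\<close>

lemma full_tailE:
  assumes A: "full_tail (catenoid m) E A" and E: "end_side m E s" and m: "m > 0"
  obtains a where "a > 0" "cat_half m s a \<subseteq> A" "A \<subseteq> catenoid m"
    "cat_half m (- s) a \<subseteq> A \<or> cat_half m (- s) a \<inter> A = {}"
proof -
  obtain K where K: "compact K" "K \<subseteq> catenoid m" "A = E K" using A by (auto simp: full_tail_def)
  have s: "- s \<in> {1, -1}" and C: "A \<in> components (catenoid m - K)"
    using E endsD(1)[of E, OF _ K(1,2)] K(3) by (auto simp: end_side_def)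
  obtain b where b: "cat_half m s b \<subseteq> A" using E K by (auto simp: end_side_def)
  obtain c where c: "c > 0" "K \<subseteq> cat_slab m c" using compact_subset_cat_slab K by blast
  define a where "a = max b c"
  have "cat_half m (- s) a \<subseteq> catenoid m - K"
    using c s by (auto simp: cat_half_def cat_slab_def a_def)
  hence "cat_half m (- s) a \<subseteq> A \<or> cat_half m (- s) a \<inter> A = {}"
    using components_maximal[OF C connected_cat_half[OF m s]] by blast
  moreover have "cat_half m s a \<subseteq> A" using b by (auto simp: cat_half_def a_def)
  moreover have "A \<subseteq> catenoid m" using in_components_subset[OF C] by blast
  ultimately show ?thesis using that[of a] c by (auto simp: a_def)
qed

section \<open>Smooth functions and the height of the catenoid\<close>

lemma Ck_on_cong:
  assumes "open U" "\<And>x. x \<in> U \<Longrightarrow> f x = g x" "Ck_on k f U"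
  shows "Ck_on k g U"
  using assms(2,3)
proof (induction k arbitrary: f g)
  case 0
  thus ?case by (metis Ck_on.simps(1) continuous_on_cong)
next
  case (Suc k)
  have D: "(g has_derivative frechet_derivative f (at x)) (at x)" if "x \<in> U" for x
  proof (rule has_derivative_transform_within_open[OF _ \<open>open U\<close> that Suc.prems(1)])
    show "(f has_derivative frechet_derivative f (at x)) (at x)"
      using Suc.prems(2) that by (simp add: frechet_derivative_works)
  qed
  have "Ck_on k (\<lambda>x. frechet_derivative g (at x) v) U" for v
  proof (rule Suc.IH)
    show "Ck_on k (\<lambda>x. frechet_derivative f (at x) v) U" using Suc.prems(2) by simp
  qed (use frechet_derivative_at[OF D] in simp)
  thus ?case using D by (auto simp: differentiable_def)
qed

text \<open>\<open>Ck_on\<close> is phrased with \<open>frechet_derivative\<close>; this rule lets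
  the inductions below work with an explicit derivative \<open>f'\<close>.\<close>

lemma Ck_on_derivI:
  assumes "open U" "\<And>x. x \<in> U \<Longrightarrow> (f has_derivative f' x) (at x)"
    and "\<And>v. Ck_on k (\<lambda>x. f' x v) U"
  shows "Ck_on (Suc k) f U"
proof -
  have "Ck_on k (\<lambda>x. frechet_derivative f (at x) v) U" for v
    by (rule Ck_on_cong[OF assms(1) _ assms(3)[of v]]) (use frechet_derivative_at[OF assms(2)] in simp)
  thus ?thesis using assms(2) by (auto simp: differentiable_def)
qed

lemma Ck_on_SucD:
  assumes "Ck_on (Suc k) f U" "x \<in> U"
  shows "(f has_derivative frechet_derivative f (at x)) (at x)"
  using assms by (simp add: frechet_derivative_works)

lemma Ck_on_continuous: "Ck_on k f U \<Longrightarrow> continuous_on U f"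
  by (cases k) (auto intro!: continuous_at_imp_continuous_on differentiable_imp_continuous_within)

lemma Ck_on_Suc_imp: "Ck_on (Suc k) f U \<Longrightarrow> Ck_on k f U"
proof (induction k arbitrary: f)
  case 0
  thus ?case using Ck_on_continuous[OF 0] by simp
next
  case (Suc k)
  from Suc.prems show ?case
    unfolding Ck_on.simps(2)[of "Suc k"] Ck_on.simps(2)[of k f] using Suc.IH by blast
qed

lemma Ck_on_const: "open U \<Longrightarrow> Ck_on k (\<lambda>x. c) U"
  by (induction k arbitrary: c) (auto intro!: Ck_on_derivI[where f' = "\<lambda>x v. 0"])

lemma Ck_on_linear:
  assumes "open U" "bounded_linear L"
  shows "Ck_on k L U"
proof (cases k)
  case 0
  thus ?thesis using assms linear_continuous_on by auto
next
  case (Suc l)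
  show ?thesis unfolding Suc
    by (rule Ck_on_derivI[OF assms(1), where f' = "\<lambda>x. L"])
       (use assms in \<open>auto intro: bounded_linear_imp_has_derivative Ck_on_const\<close>)
qed

lemma Ck_on_compose_linear:
  assumes "open U" "bounded_linear L" "Ck_on k f U"
  shows "Ck_on k (\<lambda>x. L (f x)) U"
  using assms(3)
proof (induction k arbitrary: f)
  case 0
  thus ?case by (simp add: bounded_linear.continuous_on[OF assms(2)])
next
  case (Suc k)
  show ?case
    by (rule Ck_on_derivI[OF assms(1), where f' = "\<lambda>x v. L (frechet_derivative f (at x) v)"])
       (use Suc in \<open>auto intro!: bounded_linear.has_derivative[OF assms(2)] Ck_on_SucD\<close>)
qed

lemma Ck_on_add:
  assumes "open U" "Ck_on k f U" "Ck_on k g U"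
  shows "Ck_on k (\<lambda>x. f x + g x) U"
  using assms(2,3)
proof (induction k arbitrary: f g)
  case 0
  thus ?case by (simp add: continuous_on_add)
next
  case (Suc k)
  show ?case
    by (rule Ck_on_derivI[OF assms(1),
          where f' = "\<lambda>x v. frechet_derivative f (at x) v + frechet_derivative g (at x) v"])
       (use Suc in \<open>auto intro!: has_derivative_add Ck_on_SucD\<close>)
qed

text \<open>Serves products, scalar multiples and inner products at once. By the product rule the
  induction step involves the factors themselves at the lower order, supplied by
  \<open>Ck_on_Suc_imp\<close>.\<close>

lemma Ck_on_bilinear:
  assumes "open U" "bounded_bilinear B" "Ck_on k f U" "Ck_on k g U"
  shows "Ck_on k (\<lambda>x. B (f x) (g x)) U"
  using assms(3,4)
proof (induction k arbitrary: f g)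
  case 0
  thus ?case by (simp add: bounded_bilinear.continuous_on[OF assms(2)])
next
  case (Suc k)
  have "Ck_on k f U" "Ck_on k g U" using Suc.prems by (auto intro: Ck_on_Suc_imp)
  thus ?case
    by (intro Ck_on_derivI[OF assms(1), where f' = "\<lambda>x v. B (f x) (frechet_derivative g (at x) v)
          + B (frechet_derivative f (at x) v) (g x)"])
       (use Suc in \<open>auto intro!: bounded_bilinear.FDERIV[OF assms(2)] Ck_on_add assms(1) Ck_on_SucD\<close>)
qed

text \<open>\<open>h\<close> is a sequence of successive derivatives. Generalizing over
  \<open>n\<close> closes the induction, because differentiating \<open>h n\<close> brings in
  \<open>h (Suc n)\<close>.\<close>

lemma Ck_on_compose_real:
  fixes h :: "nat \<Rightarrow> real \<Rightarrow> real"
  assumes "open U" and h: "\<And>n t. t \<in> I \<Longrightarrow> (h n has_real_derivative h (Suc n) t) (at t)"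
    and g: "\<And>x. x \<in> U \<Longrightarrow> g x \<in> I" "Ck_on k g U"
  shows "Ck_on k (\<lambda>x. h n (g x)) U"
  using g(2)
proof (induction k arbitrary: n)
  case 0
  have "continuous_on (g ` U) (h n)"
    using h g(1) by (intro continuous_at_imp_continuous_on) (auto intro: DERIV_isCont)
  thus ?case using 0 by (auto intro: continuous_on_compose2)
next
  case (Suc k)
  have "Ck_on k g U" using Suc.prems by (rule Ck_on_Suc_imp)
  show ?case
  proof (rule Ck_on_derivI[OF assms(1), where f' = "\<lambda>x v. h (Suc n) (g x) * frechet_derivative g (at x) v"])
    fix x assume "x \<in> U"
    show "((\<lambda>x. h n (g x)) has_derivative (\<lambda>v. h (Suc n) (g x) * frechet_derivative g (at x) v)) (at x)"
      using has_derivative_compose[OF Ck_on_SucD[OF Suc.prems \<open>x \<in> U\<close>]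
        h[OF g(1)[OF \<open>x \<in> U\<close>], unfolded has_field_derivative_def]] .
  next
    fix v
    show "Ck_on k (\<lambda>x. h (Suc n) (g x) * frechet_derivative g (at x) v) U"
      using Suc by (intro Ck_on_bilinear[OF assms(1) bounded_bilinear_mult] Suc.IH \<open>Ck_on k g U\<close>) auto
  qed
qed

lemma Ck_on_powr:
  fixes g :: "'a::euclidean_space \<Rightarrow> real"
  assumes "open U" "\<And>x. x \<in> U \<Longrightarrow> g x > 0" "Ck_on k g U"
  shows "Ck_on k (\<lambda>x. g x powr a) U"
proof -
  \<comment> \<open>The \<open>n\<close>-th derivative of \<open>t powr a\<close>, with a falling
    factorial as coefficient.\<close>
  have "((\<lambda>t. (\<Prod>i<n. a - real i) * t powr (a - real n)) has_real_derivative
      (\<Prod>i<Suc n. a - real i) * t powr (a - real (Suc n))) (at t)" if "t \<in> {0<..}" for n t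
    using that by (auto intro!: derivative_eq_intros simp: algebra_simps)
  from Ck_on_compose_real[where h = "\<lambda>n t. (\<Prod>i<n. a - real i) * t powr (a - real n)"
      and n = 0 and I = "{0<..}", OF assms(1) this _ assms(3)] assms(2) show ?thesis by simp
qed

lemma smooth_onI: "open U \<Longrightarrow> (\<And>k. Ck_on k f U) \<Longrightarrow> smooth_on f U"
  by (simp add: smooth_on_def)

lemma gradient_eq:
  assumes "(f has_derivative (\<lambda>v. w \<bullet> v)) (at x)"
  shows "gradient f x = w"
  unfolding gradient_def using frechet_derivative_at[OF assms, symmetric] by (simp add: euclidean_representation)

section \<open>The height function of the catenoid and its decay\<close>

definition cat_height :: "real \<Rightarrow> real^2 \<Rightarrow> real" where
  "cat_height m y = m * arcosh (norm y / m)"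

text \<open>The gradient of \<open>cat_height\<close>: \<open>arcosh\<close> has derivative
  \<open>1 / sqrt (t^2 - 1)\<close>, taken at \<open>t = norm y / m\<close>, and the norm has
  gradient \<open>y / norm y\<close>.\<close>

definition cat_grad :: "real \<Rightarrow> real^2 \<Rightarrow> real^2" where
  "cat_grad m y = (m / (norm y * sqrt ((norm y)\<^sup>2 - m\<^sup>2))) *\<^sub>R y"

lemma cat_height_pos: "m > 0 \<Longrightarrow> norm y > m \<Longrightarrow> cat_height m y > 0"
  using arcosh_real_strict_mono[of 1 "norm y / m"] by (simp add: cat_height_def)

lemma norm_eq_cosh_iff:
  assumes "m > 0" "norm y \<ge> m" "t \<ge> 0"
  shows "norm y = m * cosh (t / m) \<longleftrightarrow> t = cat_height m y"
    "norm y < m * cosh (t / m) \<longleftrightarrow> cat_height m y < t"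
proof -
  define a where "a = arcosh (norm y / m)"
  have a: "a \<ge> 0" "norm y = m * cosh a" "cat_height m y = m * a"
    using assms by (auto simp: a_def cat_height_def)
  show "norm y = m * cosh (t / m) \<longleftrightarrow> t = cat_height m y"
    using assms a cosh_real_nonneg_le_iff[of a "t / m"] cosh_real_nonneg_le_iff[of "t / m" a]
    by (auto simp: field_simps)
  show "norm y < m * cosh (t / m) \<longleftrightarrow> cat_height m y < t"
    using assms a cosh_real_nonneg_less_iff[of a "t / m"] by (auto simp: field_simps)
qed

lemma has_derivative_cat_height:
  assumes "m > 0" "norm y > m"
  shows "(cat_height m has_derivative (\<lambda>v. cat_grad m y \<bullet> v)) (at y)"
proof -
  have y: "y \<noteq> 0" "norm y / m > 1" using assms by auto
  have "((\<lambda>y. m * arcosh (norm y / m)) has_derivative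
      (\<lambda>v. m * (1 / sqrt ((norm y / m)\<^sup>2 - 1) * (y \<bullet> v / norm y / m)))) (at y)"
  proof -
    have 1: "((\<lambda>y. norm y / m) has_derivative (\<lambda>v. y \<bullet> v / norm y / m)) (at y)"
      using bounded_linear.has_derivative[OF bounded_linear_divide[of m] has_derivative_norm[OF y(1)]]
      by (simp add: sgn_div_norm divide_inverse inner_commute mult_ac)
    have 2: "(arcosh has_derivative (\<lambda>t. 1 / sqrt ((norm y / m)\<^sup>2 - 1) * t)) (at (norm y / m))"
      using arcosh_real_has_field_derivative[OF y(2)] by (simp only: has_field_derivative_def)
    show ?thesis by (rule has_derivative_mult_right[OF has_derivative_compose[OF 1 2]])
  qed
  moreover have "m * (1 / sqrt ((norm y / m)\<^sup>2 - 1) * (y \<bullet> v / norm y / m)) = cat_grad m y \<bullet> v" for v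
  proof -
    have "(norm y / m)\<^sup>2 - 1 = ((norm y)\<^sup>2 - m\<^sup>2) / m\<^sup>2" using assms(1) by (simp add: field_simps)
    hence "sqrt ((norm y / m)\<^sup>2 - 1) = sqrt ((norm y)\<^sup>2 - m\<^sup>2) / m"
      using assms(1) by (simp add: real_sqrt_divide)
    thus ?thesis using assms(1) by (simp add: cat_grad_def)
  qed
  ultimately show ?thesis by (simp add: cat_height_def[abs_def])
qed

text \<open>In terms of \<open>y \<bullet> y\<close> the gradient is built from a polynomial, a real
  power and a scalar multiplication. The \<open>Ck_on\<close> rules apply to this form, and it is
  easily differentiated once more.\<close>

lemma cat_grad_powr:
  assumes "m > 0" "norm y > m"
  shows "cat_grad m y = (m * ((y \<bullet> y) * (y \<bullet> y - m\<^sup>2)) powr (-1/2)) *\<^sub>R y"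
proof -
  have q: "y \<bullet> y = (norm y)\<^sup>2" by (simp add: power2_norm_eq_inner)
  have "m\<^sup>2 < (norm y)\<^sup>2" using assms by (intro power_strict_mono) auto
  hence "((y \<bullet> y) * (y \<bullet> y - m\<^sup>2)) powr (-1/2) = 1 / sqrt ((y \<bullet> y) * (y \<bullet> y - m\<^sup>2))"
    using assms by (simp add: powr_minus_divide powr_half_sqrt q)
  thus ?thesis using assms by (simp add: cat_grad_def q real_sqrt_mult)
qed

lemma open_norm_greater: "open {y :: 'a::real_normed_vector. norm y > R}"
  by (intro open_Collect_less continuous_intros)

text \<open>One order is gained through the gradient: its explicit formula is of class
  \<open>k\<close>, so the height is of class \<open>Suc k\<close>.\<close>

lemma smooth_cat_height:
  assumes m: "m > 0" and R: "R \<ge> m"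
  shows "smooth_on (cat_height m) {y. norm y > R}"
proof (rule smooth_onI[OF open_norm_greater], rule Ck_on_Suc_imp)
  fix k
  let ?U = "{y :: real^2. norm y > R}"
  have U: "open ?U" by (rule open_norm_greater)
  have id: "Ck_on k (\<lambda>y. y) ?U" by (rule Ck_on_linear[OF U bounded_linear_ident])
  have q: "Ck_on k (\<lambda>y. y \<bullet> y) ?U" by (rule Ck_on_bilinear[OF U bounded_bilinear_inner id id])
  have "Ck_on k (\<lambda>y. y \<bullet> y + (- m\<^sup>2)) ?U" by (rule Ck_on_add[OF U q Ck_on_const[OF U]])
  hence "Ck_on k (\<lambda>y. (y \<bullet> y) * (y \<bullet> y + (- m\<^sup>2))) ?U"
    by (rule Ck_on_bilinear[OF U bounded_bilinear_mult q])
  moreover have "(y \<bullet> y) * (y \<bullet> y + (- m\<^sup>2)) > 0" if "y \<in> ?U" for y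
  proof -
    have "m\<^sup>2 < (norm y)\<^sup>2" using m R that by (intro power_strict_mono) auto
    moreover have "m\<^sup>2 > 0" using m by simp
    ultimately show ?thesis by (intro mult_pos_pos) (auto simp: power2_norm_eq_inner)
  qed
  ultimately have "Ck_on k (\<lambda>y. ((y \<bullet> y) * (y \<bullet> y + (- m\<^sup>2))) powr (-1/2)) ?U"
    by (intro Ck_on_powr[OF U]) auto
  from Ck_on_bilinear[OF U bounded_bilinear_mult Ck_on_const[OF U] this, of m]
  have "Ck_on k (\<lambda>y. (m * ((y \<bullet> y) * (y \<bullet> y + (- m\<^sup>2))) powr (-1/2)) *\<^sub>R y) ?U"
    by (rule Ck_on_bilinear[OF U bounded_bilinear_scaleR _ id])
  hence grad: "Ck_on k (cat_grad m) ?U"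
    by (rule Ck_on_cong[OF U, rotated]) (use m R in \<open>simp add: cat_grad_powr\<close>)
  show "Ck_on (Suc k) (cat_height m) ?U"
  proof (rule Ck_on_derivI[OF U, where f' = "\<lambda>y v. cat_grad m y \<bullet> v"])
    show "Ck_on k (\<lambda>y. cat_grad m y \<bullet> v) ?U" for v
      by (rule Ck_on_bilinear[OF U bounded_bilinear_inner grad Ck_on_const[OF U]])
  qed (use m R has_derivative_cat_height in auto)
qed

lemma gradient_cat_height:
  "m > 0 \<Longrightarrow> norm y > m \<Longrightarrow> gradient (cat_height m) y = cat_grad m y"
  by (rule gradient_eq[OF has_derivative_cat_height])

text \<open>For \<open>norm y >= 2 * m\<close> the term \<open>m^2\<close> is at most
  \<open>q / 4\<close>, so \<open>p >= (q / 2)^2\<close> and negative powers of \<open>p\<close> are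
  bounded by powers of \<open>q\<close>. The constants 10 and 20 are generous; the estimates yield 2
  and 18.\<close>

lemma cat_height_decay:
  assumes m: "m > 0" and y: "norm y \<ge> 2 * m"
  shows "norm (gradient (cat_height m) y) \<le> 10 * m / norm y"
    "\<bar>norm y * onorm (frechet_derivative (gradient (cat_height m)) (at y))\<bar> \<le> 20 * m / norm y"
proof -
  define q where "q = y \<bullet> y"
  define p where "p = q * (q - m\<^sup>2)"
  have n: "norm y > m" "norm y > 0" using m y by linarith+
  have q: "q = (norm y)\<^sup>2" by (simp add: q_def power2_norm_eq_inner)
  have "(2 * m)\<^sup>2 \<le> (norm y)\<^sup>2" using m y by (intro power_mono) auto
  hence q4: "4 * m\<^sup>2 \<le> q" by (simp add: q power_mult_distrib)
  have q0: "q > 0" using n by (simp add: q)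
  have "q * (q / 4) \<le> p" unfolding p_def using q4 q0 by (intro mult_left_mono) auto
  hence p: "(q / 2)\<^sup>2 \<le> p" by (simp add: power2_eq_square)
  hence p0: "p > 0" using q0 by (meson less_le_trans zero_less_power half_gt_zero)
  have pw: "p powr (-1/2) \<le> 2 / q"
  proof -
    have "p powr (-1/2) = 1 / sqrt p" using p0 by (simp add: powr_minus_divide powr_half_sqrt)
    also have "\<dots> \<le> 1 / (q / 2)"
      using p0 q0 real_le_rsqrt[OF p] by (intro divide_left_mono mult_pos_pos) auto
    finally show ?thesis by simp
  qed
  have pw3: "p powr (-3/2) \<le> 8 / q ^ 3"
  proof -
    have "p powr (-3/2) = (p powr (-1/2)) ^ 3"
      using p0 by (simp add: powr_powr flip: powr_realpow)
    also have "\<dots> \<le> (2 / q) ^ 3" using pw by (intro power_mono) auto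
    finally show ?thesis by (simp add: power_divide)
  qed
  have grad: "gradient (cat_height m) y = (m * p powr (-1/2)) *\<^sub>R y"
    using gradient_cat_height[OF m n(1)] cat_grad_powr[OF m n(1)] by (simp add: p_def q_def)
  have "norm (gradient (cat_height m) y) = m * p powr (-1/2) * norm y"
    using m by (simp add: grad)
  also have "\<dots> \<le> m * (2 / q) * norm y" using m pw by (intro mult_right_mono mult_left_mono) auto
  also have "\<dots> = 2 * m / norm y" using n by (simp add: q power2_eq_square)
  also have "\<dots> \<le> 10 * m / norm y" using m n by (intro divide_right_mono) auto
  finally show "norm (gradient (cat_height m) y) \<le> 10 * m / norm y" .
  \<comment> \<open>The product rule applied to the formula of \<open>cat_grad_powr\<close>. The
    factor 2 at \<open>y \<bullet> v\<close> comes from differentiating \<open>y \<bullet> y\<close>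
    and cancels against the exponent in the norm estimate.\<close>
  define D where "D v = (m * p powr (-1/2)) *\<^sub>R v
      + (m * ((-1/2) * p powr (-3/2) * ((2 * q - m\<^sup>2) * (2 * (y \<bullet> v))))) *\<^sub>R y" for v
  have "((\<lambda>y. (m * ((y \<bullet> y) * (y \<bullet> y - m\<^sup>2)) powr (-1/2)) *\<^sub>R y) has_derivative D) (at y)"
  proof -
    have "((\<lambda>y::real^2. (y \<bullet> y) * (y \<bullet> y - m\<^sup>2)) has_derivative (\<lambda>v. (2 * q - m\<^sup>2) * (2 * (y \<bullet> v)))) (at y)"
      by (auto intro!: derivative_eq_intros simp: q_def inner_commute algebra_simps)
    note q_deriv = this
    have "((\<lambda>t. t powr (-1/2)) has_real_derivative (-1/2) * p powr (-3/2)) (at p)"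
      using has_real_derivative_powr[OF p0, of "-1/2"] by simp
    hence "((\<lambda>t. t powr (-1/2)) has_derivative (\<lambda>t. (-1/2) * p powr (-3/2) * t))
        (at ((y \<bullet> y) * (y \<bullet> y - m\<^sup>2)))"
      by (simp only: has_field_derivative_def p_def q_def)
    from has_derivative_compose[OF q_deriv this] have "((\<lambda>y. ((y \<bullet> y) * (y \<bullet> y - m\<^sup>2)) powr (-1/2)) has_derivative
        (\<lambda>v. (-1/2) * p powr (-3/2) * ((2 * q - m\<^sup>2) * (2 * (y \<bullet> v))))) (at y)" .
    from has_derivative_scaleR[OF has_derivative_mult_right[OF this, of m] has_derivative_ident]
    show ?thesis by (simp add: D_def[abs_def] p_def q_def)
  qed
  hence "(gradient (cat_height m) has_derivative D) (at y)"
    by (rule has_derivative_transform_within_open[OF _ open_norm_greater[of m]])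
       (use m n in \<open>auto simp: gradient_cat_height cat_grad_powr\<close>)
  hence "frechet_derivative (gradient (cat_height m)) (at y) = D" "onorm D \<ge> 0"
    by (rule frechet_derivative_at[symmetric], blast intro: onorm_pos_le has_derivative_bounded_linear)
  moreover have "onorm D \<le> 20 * m / q"
  proof (rule onorm_bound)
    fix v
    have "norm (D v) \<le> m * p powr (-1/2) * norm v + m * (p powr (-3/2) * ((2 * q - m\<^sup>2) * \<bar>y \<bullet> v\<bar>)) * norm y"
    proof -
      have "norm (D v) \<le> norm ((m * p powr (-1/2)) *\<^sub>R v) +
          norm ((m * ((-1/2) * p powr (-3/2) * ((2 * q - m\<^sup>2) * (2 * (y \<bullet> v))))) *\<^sub>R y)"
        unfolding D_def by (rule norm_triangle_ineq)
      moreover have "2 * q - m\<^sup>2 > 0" using q4 q0 zero_le_power2[of m] by linarith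
      ultimately show ?thesis using m by (simp add: abs_mult)
    qed
    also have "\<dots> \<le> m * (2 / q) * norm v + m * (8 / q ^ 3 * ((2 * q - 0) * (norm y * norm v))) * norm y"
      using m pw pw3 q0 q4 zero_le_power2[of m]
      by (intro add_mono mult_right_mono mult_left_mono mult_mono Cauchy_Schwarz_ineq2 diff_mono) auto
    also have "\<dots> = 18 * m / q * norm v"
      using n by (simp add: q power2_eq_square power3_eq_cube field_simps)
    also have "\<dots> \<le> 20 * m / q * norm v"
      using m q0 by (intro mult_right_mono divide_right_mono) auto
    finally show "norm (D v) \<le> 20 * m / q * norm v" .
  qed (use m q0 in auto)
  ultimately have "\<bar>norm y * onorm (frechet_derivative (gradient (cat_height m)) (at y))\<bar> \<le> norm y * (20 * m / q)"
    by (simp only: abs_mult abs_norm_cancel abs_of_nonneg) (intro mult_left_mono; simp)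
  also have "\<dots> = 20 * m / norm y" using n by (simp add: q power2_eq_square)
  finally show "\<bar>norm y * onorm (frechet_derivative (gradient (cat_height m)) (at y))\<bar> \<le> 20 * m / norm y" .
qed

section \<open>The extrinsic mass of the catenoid\<close>

text \<open>A rigid motion may move the axis, so the flux is taken around a shifted centre
  \<open>c\<close>. With \<open>y = (y - c) + c\<close> and \<open>r = norm (y - c)\<close>, the
  first part contributes \<open>m * r / sqrt (r^2 - m^2)\<close>, and the second is smaller by a
  factor of order \<open>1 / r\<close>.\<close>

lemma flux_tendsto:
  assumes m: "m > 0"
  shows "((\<lambda>y. y \<bullet> cat_grad m (y - c)) \<longlongrightarrow> m) at_infinity"
proof -
  let ?h = "\<lambda>r. r / sqrt (r\<^sup>2 - m\<^sup>2)"
  have shift: "filterlim (\<lambda>y. norm (y - c)) at_top at_infinity"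
    unfolding filterlim_at_top
  proof
    fix B
    have "norm (y - c) \<ge> B" if "norm y \<ge> B + norm c" for y
      using norm_triangle_ineq2[of y c] that by linarith
    thus "eventually (\<lambda>y. B \<le> norm (y - c)) at_infinity"
      unfolding eventually_at_infinity by blast
  qed
  have "(?h \<longlongrightarrow> 1) at_top" using m by real_asymp
  hence h: "((\<lambda>y. ?h (norm (y - c))) \<longlongrightarrow> 1) at_infinity" by (rule filterlim_compose[OF _ shift])
  have "((\<lambda>r. norm c / r) \<longlongrightarrow> 0) at_top" by real_asymp
  hence "((\<lambda>y. norm c / norm (y - c)) \<longlongrightarrow> 0) at_infinity" by (rule filterlim_compose[OF _ shift])
  hence c0: "((\<lambda>y. (c \<bullet> (y - c)) / (norm (y - c))\<^sup>2) \<longlongrightarrow> 0) at_infinity"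
  proof (rule Lim_null_comparison[rotated], intro always_eventually allI)
    fix y
    have "\<bar>c \<bullet> (y - c)\<bar> \<le> norm c * norm (y - c)" by (rule Cauchy_Schwarz_ineq2)
    hence "\<bar>c \<bullet> (y - c)\<bar> / (norm (y - c))\<^sup>2 \<le> norm c * norm (y - c) / (norm (y - c))\<^sup>2"
      by (rule divide_right_mono) simp
    thus "norm ((c \<bullet> (y - c)) / (norm (y - c))\<^sup>2) \<le> norm c / norm (y - c)"
      by (cases "y = c") (simp_all add: power2_eq_square)
  qed
  have "((\<lambda>y. m * ((1 + (c \<bullet> (y - c)) / (norm (y - c))\<^sup>2) * ?h (norm (y - c)))) \<longlongrightarrow> m * ((1 + 0) * 1)) at_infinity"
    by (intro tendsto_intros h c0)
  moreover have "eventually (\<lambda>y. m * ((1 + (c \<bullet> (y - c)) / (norm (y - c))\<^sup>2) * ?h (norm (y - c)))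
      = y \<bullet> cat_grad m (y - c)) at_infinity"
    using shift[unfolded filterlim_at_top_dense, rule_format, of 0]
  proof (rule eventually_mono)
    fix y assume y: "0 < norm (y - c)"
    have "y \<bullet> (y - c) = (norm (y - c))\<^sup>2 + c \<bullet> (y - c)"
      by (simp add: power2_norm_eq_inner algebra_simps inner_diff_left inner_diff_right)
    hence "y \<bullet> cat_grad m (y - c) =
        m / (norm (y - c) * sqrt ((norm (y - c))\<^sup>2 - m\<^sup>2)) * ((norm (y - c))\<^sup>2 + c \<bullet> (y - c))"
      by (simp add: cat_grad_def)
    \<comment> \<open>For \<open>w = 0\<close> both sides are 0 because division by 0 gives
      0.\<close>
    moreover have "m * ((1 + a / n\<^sup>2) * (n / w)) = m / (n * w) * (n\<^sup>2 + a)" if "n > 0" for a n w :: real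
      using that by (cases "w = 0") (simp_all add: field_simps power2_eq_square)
    ultimately show "m * ((1 + (c \<bullet> (y - c)) / (norm (y - c))\<^sup>2) * ?h (norm (y - c))) = y \<bullet> cat_grad m (y - c)"
      using y by simp
  qed
  ultimately show ?thesis by (auto intro: Lim_transform_eventually)
qed

text \<open>On large circles \<open>F\<close> is within \<open>e / 2\<close> of \<open>l\<close>,
  and the length \<open>2 * pi * r\<close> exactly cancels the normalization, so the mean is within
  \<open>e / 2\<close> of \<open>l\<close> as well.\<close>

lemma mean_flux_tendsto:
  fixes F :: "real^2 \<Rightarrow> real"
  assumes F: "(F \<longlongrightarrow> l) at_infinity" and [measurable]: "F \<in> borel_measurable borel"
  shows "((\<lambda>r. 1 / (2 * pi * r) * (LINT y:sphere 0 r|hausdorff_measure 1. F y)) \<longlongrightarrow> l) at_top"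
proof (rule tendstoI)
  fix e :: real assume e: "e > 0"
  have "eventually (\<lambda>y. dist (F y) l < e / 2) at_infinity" using tendstoD[OF F, of "e / 2"] e by simp
  then obtain B where B: "\<And>y. norm y \<ge> B \<Longrightarrow> dist (F y) l < e / 2"
    unfolding eventually_at_infinity by blast
  show "eventually (\<lambda>r. dist (1 / (2 * pi * r) * (LINT y:sphere 0 r|hausdorff_measure 1. F y)) l < e) at_top"
  proof (rule eventually_mono[OF eventually_ge_at_top[of "max B 1"]])
    fix r :: real assume r: "max B 1 \<le> r"
    hence r0: "r > 0" by simp
    let ?M = "hausdorff_measure 1 :: (real^2) measure" and ?S = "sphere (0::real^2) r"
    have S: "?S \<in> sets ?M" by simp
    have eS: "emeasure ?M ?S = ennreal (2 * pi * r)" by (rule emeasure_hausdorff_circle[OF r0])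
    hence mS: "measure ?M ?S = 2 * pi * r" using r0 by (simp add: measure_def)
    have near: "\<bar>F y - l\<bar> < e / 2" if "y \<in> ?S" for y using B[of y] r that by (simp add: dist_real_def)
    have F': "F \<in> borel_measurable ?M"
      using assms(2) by (simp cong: measurable_cong_sets)
    have int: "set_integrable ?M ?S F"
      unfolding set_integrable_def
    proof (rule integrableI_bounded_set_indicator[OF S F', of "\<bar>l\<bar> + e / 2"])
      show "emeasure ?M ?S < \<infinity>" unfolding eS by simp
      show "AE x in ?M. x \<in> ?S \<longrightarrow> norm (F x) \<le> \<bar>l\<bar> + e / 2"
      proof (intro AE_I2 impI)
        fix x assume "x \<in> ?S"
        from near[OF this] show "norm (F x) \<le> \<bar>l\<bar> + e / 2"
          using abs_triangle_ineq2[of "F x" l] by (simp only: real_norm_def)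
      qed
    qed
    have intc: "set_integrable ?M ?S (\<lambda>y. a)" for a :: real
      unfolding set_integrable_def using S eS by (simp add: integrable_indicator_iff)
    have const: "(LINT y:?S|?M. a) = a * (2 * pi * r)" for a :: real
      unfolding set_lebesgue_integral_def using S eS mS by (simp add: mult.commute)
    have "(LINT y:?S|?M. F y) \<le> (LINT y:?S|?M. l + e / 2)"
      by (rule set_integral_mono[OF int intc]) (drule near, linarith)
    moreover have "(LINT y:?S|?M. l - e / 2) \<le> (LINT y:?S|?M. F y)"
      by (rule set_integral_mono[OF intc int]) (drule near, linarith)
    ultimately have "\<bar>1 / (2 * pi * r) * (LINT y:?S|?M. F y) - l\<bar> \<le> e / 2"
      unfolding const using r0 by (simp add: abs_le_iff field_simps)
    thus "dist (1 / (2 * pi * r) * (LINT y:?S|?M. F y)) l < e" using e by (simp add: dist_real_def)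
  qed
qed

lemma catenoid_mass_limit:
  assumes m: "m > 0" and grad: "\<And>y. norm y > R \<Longrightarrow> gradient \<psi> y = cat_grad m (y - c)"
  shows "((\<lambda>r. 1 / (2 * pi * r) * (LINT y:sphere 0 r|hausdorff_measure 1. y \<bullet> gradient \<psi> y)) \<longlongrightarrow> m) at_top"
proof (rule Lim_transform_eventually)
  show "((\<lambda>r. 1 / (2 * pi * r) * (LINT y:sphere 0 r|hausdorff_measure 1. y \<bullet> cat_grad m (y - c))) \<longlongrightarrow> m) at_top"
    by (rule mean_flux_tendsto[OF flux_tendsto[OF m]]) (simp add: cat_grad_def)
  show "eventually (\<lambda>r. 1 / (2 * pi * r) * (LINT y:sphere 0 r|hausdorff_measure 1. y \<bullet> cat_grad m (y - c)) =
      1 / (2 * pi * r) * (LINT y:sphere 0 r|hausdorff_measure 1. y \<bullet> gradient \<psi> y)) at_top"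
  proof (rule eventually_mono[OF eventually_gt_at_top[of R]])
    fix r :: real assume "R < r"
    hence "(LINT y:sphere 0 r|hausdorff_measure 1. y \<bullet> cat_grad m (y - c)) =
        (LINT y:sphere 0 r|hausdorff_measure 1. y \<bullet> gradient \<psi> y)"
      using grad by (intro set_lebesgue_integral_cong) auto
    thus "1 / (2 * pi * r) * (LINT y:sphere 0 r|hausdorff_measure 1. y \<bullet> cat_grad m (y - c)) =
      1 / (2 * pi * r) * (LINT y:sphere 0 r|hausdorff_measure 1. y \<bullet> gradient \<psi> y)" by simp
  qed
qed

section \<open>The catenoid end as a graph\<close>

lemma cosh_sign: "s \<in> {1, -1} \<Longrightarrow> cosh (s * t / m) = cosh (t / m :: real)"
  by auto

text \<open>For \<open>s = -1\<close> the motion is the reflection in the plane of height 0, which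
  maps the region onto itself and the lower end to the upper one.\<close>

lemma graph_end_catenoid:
  assumes m: "m > 0" and E: "end_side m E s"
  shows "graph_end (catenoid m) (catenoid_region m) E (\<lambda>x. (fst x, s * snd x)) (m * cosh 1) (cat_height m)"
proof -
  let ?T = "\<lambda>x :: space3. (fst x, s * snd x)"
  \<comment> \<open>The catenoid has this radius at height \<open>m\<close>, so the graph over the
    exterior is precisely the half beyond height \<open>m\<close>.\<close>
  let ?R = "m * cosh 1"
  have s: "s \<in> {1, -1}" by (rule end_sideD(2)[OF E])
  hence ss: "s * (s * t) = t" for t by auto
  have TT: "?T (?T z) = z" for z by (simp only: fst_conv snd_conv ss prod.collapse)
  have R: "?R > m" using m cosh_real_nonneg_less_iff[of 0 1] by simp
  have "orthogonal_transformation ?T"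
    unfolding orthogonal_transformation_def
    using s by (auto simp: inner_prod_def intro!: linearI simp: algebra_simps)
  hence "rigid_motion ?T" unfolding rigid_motion_def by (intro exI[of _ ?T] exI[of _ 0]) auto
  moreover have "?R > 0" using m by simp
  moreover have "smooth_on (cat_height m) {y. norm y > ?R}" using m R by (intro smooth_cat_height) auto
  moreover have "\<exists>\<tau>>1/2. (\<lambda>y. norm (gradient (cat_height m) y)
        + norm y * onorm (frechet_derivative (gradient (cat_height m)) (at y)))
      \<in> O[at_infinity](\<lambda>y. norm y powr (- \<tau>))"
  proof (intro exI[of _ 1] conjI)
    have "eventually (\<lambda>y::real^2. norm y \<ge> 2 * m) at_infinity"
      unfolding eventually_at_infinity by blast
    thus "(\<lambda>y. norm (gradient (cat_height m) y)
        + norm y * onorm (frechet_derivative (gradient (cat_height m)) (at y)))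
      \<in> O[at_infinity](\<lambda>y. norm y powr (- 1))"
    proof (intro bigoI[of _ "30 * m"], elim eventually_mono)
      fix y :: "real^2" assume y: "norm y \<ge> 2 * m"
      hence y0: "norm y > 0" using m by linarith
      have "norm (D + E) \<le> 30 * m * norm (norm y powr (- 1))"
        if "\<bar>D\<bar> \<le> 10 * m / norm y" "\<bar>E\<bar> \<le> 20 * m / norm y" for D E
      proof -
        have "norm (D + E) \<le> 10 * m / norm y + 20 * m / norm y" using that by (simp add: abs_le_iff)
        also have "\<dots> = 30 * m * norm (norm y powr (- 1))"
          using y0 by (simp add: powr_minus_divide add_divide_distrib[symmetric])
        finally show ?thesis .
      qed
      thus "norm (norm (gradient (cat_height m) y)
          + norm y * onorm (frechet_derivative (gradient (cat_height m)) (at y)))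
        \<le> 30 * m * norm (norm y powr (- 1))"
        using cat_height_decay[OF m y] by simp
    qed
  qed simp
  moreover have "\<exists>A. full_tail (catenoid m) E A \<and> ?T ` A = {(y, cat_height m y) | y. norm y > ?R}"
  proof (intro exI conjI)
    show "full_tail (catenoid m) E (cat_half m s m)" using m by (intro full_tail_cat_half[OF E]) auto
    have half: "x \<in> cat_half m s m \<longleftrightarrow> norm (fst x) > ?R \<and> s * snd x = cat_height m (fst x)" for x
    proof (cases "s * snd x > 0")
      case True
      define t where "t = s * snd x"
      have t: "t > 0" using True by (simp add: t_def)
      have c: "cosh (snd x / m) = cosh (t / m)" unfolding t_def by (rule cosh_sign[OF s, symmetric])
      have "x \<in> cat_half m s m \<longleftrightarrow> norm (fst x) = m * cosh (t / m) \<and> t > m"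
        by (simp add: cat_half_def mem_catenoid c t_def)
      also have "\<dots> \<longleftrightarrow> norm (fst x) = m * cosh (t / m) \<and> norm (fst x) > ?R"
        using m t cosh_real_nonneg_less_iff[of 1 "t / m"] by (auto simp: field_simps)
      also have "\<dots> \<longleftrightarrow> t = cat_height m (fst x) \<and> norm (fst x) > ?R"
        using norm_eq_cosh_iff(1)[OF m, of "fst x" t] t R by fastforce
      finally show ?thesis by (auto simp: t_def)
    next
      case False
      thus ?thesis using cat_height_pos[OF m, of "fst x"] R m by (fastforce simp: cat_half_def)
    qed
    show "?T ` cat_half m s m = {(y, cat_height m y) | y. norm y > ?R}"
    proof (intro equalityI subsetI)
      fix z assume "z \<in> {(y, cat_height m y) | y. norm y > ?R}"
      then obtain y where y: "norm y > ?R" "z = (y, cat_height m y)" by blast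
      thus "z \<in> ?T ` cat_half m s m"
        using half[of "(y, s * cat_height m y)"]
        by (intro image_eqI[of _ _ "(y, s * cat_height m y)"]) (auto simp: ss)
    qed (auto simp: half)
  qed
  moreover have "\<exists>\<epsilon>>0. \<forall>x\<in>ball (y, cat_height m y) \<epsilon>.
      x \<in> ?T ` catenoid_region m \<longleftrightarrow> snd x > cat_height m (fst x)" if y: "norm y > ?R" for y
  \<comment> \<open>On a ball of this radius \<open>snd x > 0\<close> and
    \<open>norm (fst x) > m\<close> hold, so the condition defining the region can be solved for the
    height.\<close>
  proof (intro exI[of _ "min (cat_height m y) (norm y - m)"] conjI ballI)
    have ym: "norm y > m" using y R by linarith
    show "min (cat_height m y) (norm y - m) > 0" using cat_height_pos[OF m ym] ym by simp
    fix x assume "x \<in> ball (y, cat_height m y) (min (cat_height m y) (norm y - m))"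
    hence d: "dist (y, cat_height m y) x < cat_height m y" "dist (y, cat_height m y) x < norm y - m" by auto
    have "dist y (fst x) < norm y - m" "dist (cat_height m y) (snd x) < cat_height m y"
      using d dist_fst_le[of "(y, cat_height m y)" x] dist_snd_le[of "(y, cat_height m y)" x] by auto
    hence x: "norm (fst x) > m" "snd x > 0"
      using norm_triangle_ineq2[of y "fst x"] by (auto simp: dist_norm)
    have "x \<in> ?T ` catenoid_region m \<longleftrightarrow> ?T x \<in> catenoid_region m"
    proof
      assume "x \<in> ?T ` catenoid_region m"
      then obtain z where "z \<in> catenoid_region m" "x = ?T z" by blast
      thus "?T x \<in> catenoid_region m" by (simp only: TT)
    next
      assume "?T x \<in> catenoid_region m"
      hence "?T (?T x) \<in> ?T ` catenoid_region m" by (rule imageI)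
      thus "x \<in> ?T ` catenoid_region m" by (simp only: TT)
    qed
    also have "\<dots> \<longleftrightarrow> norm (fst x) < m * cosh (snd x / m)"
      by (simp only: catenoid_region_def mem_Collect_eq fst_conv snd_conv cosh_sign[OF s])
    also have "\<dots> \<longleftrightarrow> snd x > cat_height m (fst x)"
      using norm_eq_cosh_iff(2)[OF m, of "fst x" "snd x"] x by simp
    finally show "x \<in> ?T ` catenoid_region m \<longleftrightarrow> snd x > cat_height m (fst x)" .
  qed
  ultimately show ?thesis unfolding graph_end_def by blast
qed

lemma has_mass_catenoid:
  assumes m: "m > 0" and E: "end_side m E s"
  shows "has_extrinsic_mass (catenoid m) (catenoid_region m) E m"
  unfolding has_extrinsic_mass_def
proof (intro exI conjI)
  show "graph_end (catenoid m) (catenoid_region m) E (\<lambda>x. (fst x, s * snd x)) (m * cosh 1) (cat_height m)"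
    by (rule graph_end_catenoid[OF m E])
  show "((\<lambda>r. 1 / (2 * pi * r) * (LINT y:sphere 0 r|hausdorff_measure 1. y \<bullet> gradient (cat_height m) y)) \<longlongrightarrow> m) at_top"
    by (rule catenoid_mass_limit[OF m, of m _ 0]) (simp add: gradient_cat_height[OF m])
qed

section \<open>Rigidity of the graph representation\<close>

lemma le_sinh_real: "t \<le> sinh t" if "t \<ge> 0" for t :: real
proof -
  have "sinh 0 - 0 \<le> sinh t - t"
  proof (rule DERIV_nonneg_imp_nondecreasing[OF that])
    fix x :: real
    have "((\<lambda>x. sinh x - x) has_real_derivative cosh x - 1) (at x)"
      by (auto intro!: derivative_eq_intros)
    thus "\<exists>d. ((\<lambda>x. sinh x - x) has_real_derivative d) (at x) \<and> 0 \<le> d"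
      using cosh_real_ge_1[of x] by (intro exI[of _ "cosh x - 1"]) auto
  qed
  thus ?thesis by simp
qed

lemma cosh_add_ge: "t \<ge> 0 \<Longrightarrow> cosh a + t * sinh a \<le> cosh (a + t)" if "a \<ge> 0" for a t :: real
proof -
  assume t: "t \<ge> 0"
  have "sinh a \<ge> 0" using that by simp
  moreover have "t \<le> sinh t" using t by (rule le_sinh_real)
  moreover have "cosh a * 1 \<le> cosh a * cosh t" by (intro mult_left_mono) (auto simp: cosh_real_ge_1)
  moreover have "sinh a * t \<le> sinh a * sinh t" by (intro mult_left_mono calculation)
  ultimately show ?thesis unfolding cosh_add mult.commute[of t] by linarith
qed

text \<open>Far out on the half with sign \<open>\<sigma>\<close> the direction \<open>(u, \<sigma>)\<close> points into the region,
  whatever \<open>u\<close> is, because the slope of the catenoid tends to \<open>0\<close>.\<close>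

lemma catenoid_inward_direction:
  assumes m: "m > 0" and p: "p \<in> catenoid m" and \<sigma>: "\<sigma> \<in> {1, -1}"
    and steep: "\<sigma> * snd p \<ge> 0" "sinh (\<sigma> * snd p / m) > norm u" and t: "t > 0"
  shows "p + t *\<^sub>R (u, \<sigma>) \<in> catenoid_region m"
proof -
  let ?a = "\<sigma> * snd p / m"
  have ss: "\<sigma> * \<sigma> = 1" using \<sigma> by auto
  have "norm (fst p + t *\<^sub>R u) \<le> norm (fst p) + t * norm u"
    using norm_triangle_ineq[of "fst p" "t *\<^sub>R u"] t by simp
  also have "norm (fst p) = m * cosh ?a" using p by (simp only: mem_catenoid cosh_sign[OF \<sigma>])
  also have "m * cosh ?a + t * norm u < m * cosh ?a + t * sinh ?a"
    using steep t by simp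
  also have "\<dots> = m * (cosh ?a + t / m * sinh ?a)" using m by (simp add: field_simps)
  also have "\<dots> \<le> m * cosh (?a + t / m)"
    using m t steep by (intro mult_left_mono cosh_add_ge) auto
  also have "?a + t / m = \<sigma> * (snd p + t * \<sigma>) / m"
    using ss by (simp add: algebra_simps add_divide_distrib)
  also have "cosh \<dots> = cosh ((snd p + t * \<sigma>) / m)" by (rule cosh_sign[OF \<sigma>])
  finally show ?thesis by (simp add: catenoid_region_def)
qed

text \<open>A ray that stays above the graph for small times rises at least as fast as the graph
  does; difference quotients from the right show it.\<close>

lemma graph_locally_below_imp_slope:
  fixes \<psi> :: "real^2 \<Rightarrow> real"
  assumes d: "\<psi> differentiable (at y)" and "\<epsilon> > 0"
    and above: "\<And>t. t > 0 \<Longrightarrow> (y, \<psi> y) + t *\<^sub>R w \<in> ball (y, \<psi> y) \<epsilon> \<Longrightarrow>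
      \<psi> (fst ((y, \<psi> y) + t *\<^sub>R w)) < snd ((y, \<psi> y) + t *\<^sub>R w)"
  shows "gradient \<psi> y \<bullet> fst w \<le> snd w"
proof -
  let ?D = "frechet_derivative \<psi> (at y)"
  have D: "(\<psi> has_derivative ?D) (at y)" using d by (simp add: frechet_derivative_works)
  have lin: "linear ?D" using D by (rule has_derivative_linear)
  have grad: "gradient \<psi> y \<bullet> v = ?D v" for v
  proof -
    have "?D v = ?D (\<Sum>b\<in>Basis. (v \<bullet> b) *\<^sub>R b)" by (simp add: euclidean_representation)
    also have "\<dots> = (\<Sum>b\<in>Basis. (v \<bullet> b) * ?D b)" by (simp add: linear_sum[OF lin] linear_scale[OF lin])
    finally show ?thesis
      by (simp add: gradient_def inner_sum_left inner_commute[of v] mult.commute)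
  qed
  have "((\<lambda>t. \<psi> (y + t *\<^sub>R fst w)) has_derivative (\<lambda>t. ?D (t *\<^sub>R fst w))) (at 0)"
    by (rule has_derivative_compose[where g = \<psi>]) (auto intro!: derivative_eq_intros D)
  hence "((\<lambda>t. \<psi> (y + t *\<^sub>R fst w)) has_real_derivative ?D (fst w)) (at 0)"
  proof -
    have "(\<lambda>t. ?D (t *\<^sub>R fst w)) = (*) (?D (fst w))"
      by (auto simp: fun_eq_iff linear_scale[OF lin])
    with \<open>((\<lambda>t. \<psi> (y + t *\<^sub>R fst w)) has_derivative (\<lambda>t. ?D (t *\<^sub>R fst w))) (at 0)\<close>
    show ?thesis by (simp only: has_field_derivative_def)
  qed
  hence "((\<lambda>t. (\<psi> (y + t *\<^sub>R fst w) - \<psi> y) / t) \<longlongrightarrow> ?D (fst w)) (at 0)"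
    by (simp add: DERIV_def)
  hence lim: "((\<lambda>t. (\<psi> (y + t *\<^sub>R fst w) - \<psi> y) / t) \<longlongrightarrow> ?D (fst w)) (at_right 0)"
    by (rule tendsto_within_subset) simp
  have "((\<lambda>t. (y, \<psi> y) + t *\<^sub>R w) \<longlongrightarrow> (y, \<psi> y) + 0 *\<^sub>R w) (at_right 0)"
    by (intro tendsto_intros)
  hence "eventually (\<lambda>t. dist ((y, \<psi> y) + t *\<^sub>R w) (y, \<psi> y) < \<epsilon>) (at_right 0)"
    using \<open>\<epsilon> > 0\<close> by (auto dest: tendstoD)
  hence "eventually (\<lambda>t. (\<psi> (y + t *\<^sub>R fst w) - \<psi> y) / t \<le> snd w) (at_right 0)"
    using eventually_at_right_less[of "0::real"]
  proof eventually_elim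
    case (elim t)
    have "\<psi> (y + t *\<^sub>R fst w) < \<psi> y + t * snd w"
      using above[of t] elim by (simp add: dist_commute)
    thus ?case using elim by (simp add: field_simps)
  qed
  hence "?D (fst w) \<le> snd w" by (rule tendsto_upperbound[OF lim]) simp
  thus ?thesis by (simp add: grad)
qed

text \<open>As a function of \<open>u\<close>, \<open>snd (Q (u, \<sigma>))\<close> is affine and
  bounded below, hence constant, so \<open>Q\<close> maps the horizontal plane into itself.
  Orthogonality then fixes the vertical axis up to sign, and the case \<open>u = 0\<close>
  determines the sign.\<close>

lemma orthogonal_preserving_horizontal:
  fixes Q :: "space3 \<Rightarrow> space3"
  assumes Q: "orthogonal_transformation Q" and \<sigma>: "\<sigma> \<in> {1, -1}"
    and pos: "\<And>u. snd (Q (u, \<sigma>)) \<ge> 0"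
  obtains P where "\<And>u t. Q (u, t) = (P u, \<sigma> * t)" "\<And>u. norm (P u) = norm u"
proof -
  have lin: "linear Q" using Q by (rule orthogonal_transformation_linear)
  have split: "Q (u, t) = Q (u, 0) + t *\<^sub>R Q (0, 1)" for u t
    using linear_add[OF lin, of "(u, 0)" "(0, t)"] linear_scale[OF lin, of t "(0, 1)"] by simp
  have hor: "snd (Q (u, 0)) = 0" for u
  proof (rule ccontr)
    assume ne: "snd (Q (u, 0)) \<noteq> 0"
    define b where "b = \<sigma> * snd (Q (0, 1))"
    have *: "c * snd (Q (u, 0)) + b \<ge> 0" for c
      using pos[of "c *\<^sub>R u"] split[of "c *\<^sub>R u" \<sigma>] linear_scale[OF lin, of c "(u, 0)"]
      by (simp add: b_def)
    \<comment> \<open>With this multiple of \<open>u\<close> the quantity that should be nonnegative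
      equals -1.\<close>
    have "(- (b + 1) / snd (Q (u, 0))) * snd (Q (u, 0)) = - (b + 1)" using ne by simp
    thus False using *[of "- (b + 1) / snd (Q (u, 0))"] by linarith
  qed
  obtain z where z: "Q z = (0, 1)"
    using orthogonal_transformation_surj[OF Q] by (metis surjD)
  have "fst z \<bullet> u = 0" for u
  proof -
    have "z \<bullet> (u, 0) = Q z \<bullet> Q (u, 0)" using Q unfolding orthogonal_transformation_def by metis
    also have "\<dots> = 0" by (simp add: z inner_prod_def hor)
    finally show ?thesis by (simp add: inner_prod_def)
  qed
  hence z1: "fst z = 0" by (metis inner_eq_zero_iff)
  have "norm z = 1" using orthogonal_transformation_norm[OF Q, of z] z by (simp add: norm_Pair)
  hence k: "snd z = 1 \<or> snd z = -1" using z1 by (cases z) (auto simp: norm_Pair power2_eq_1_iff)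
  have "(0, 1) = snd z *\<^sub>R Q (0, 1)"
    using z z1 linear_scale[OF lin, of "snd z" "(0, 1)"] by (cases z) auto
  hence e3: "Q (0, 1) = (0, snd z)" using k by (auto simp: prod_eq_iff)
  have "\<sigma> * snd z \<ge> 0" using pos[of 0] split[of 0 \<sigma>] linear_0[OF lin] e3 by (simp add: zero_prod_def)
  hence "snd z = \<sigma>" using k \<sigma> by auto
  show ?thesis
  proof (rule that[of "\<lambda>u. fst (Q (u, 0))"])
    show "Q (u, t) = (fst (Q (u, 0)), \<sigma> * t)" for u t
      using split[of u t] e3 hor[of u] \<open>snd z = \<sigma>\<close> by (simp add: prod_eq_iff)
    show "norm (fst (Q (u, 0))) = norm u" for u
    proof -
      have "norm (Q (u, 0)) = norm (u, 0::real)" by (rule orthogonal_transformation_norm[OF Q])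
      thus ?thesis using hor[of u] by (cases "Q (u, 0)") (simp add: norm_Pair)
    qed
  qed
qed

text \<open>Far out every direction \<open>(u, \<sigma>)\<close> points into the region, while
  \<open>\<psi>\<close> is almost flat there, so its image under \<open>Q\<close> cannot point
  downwards. Hence \<open>Q\<close> preserves the horizontal plane, the image of the catenoid again
  has a vertical axis, and \<open>\<psi>\<close> is far out a translate of
  \<open>cat_height\<close>.\<close>

lemma catenoid_graph_end_unique:
  assumes m: "m > 0" and E: "end_side m E s"
    and G: "graph_end (catenoid m) (catenoid_region m) E T R\<^sub>0 \<psi>"
  shows "\<exists>R c. \<forall>y. norm y > R \<longrightarrow> gradient \<psi> y = cat_grad m (y - c)"
proof -
  obtain Q c where Q: "orthogonal_transformation Q" and T: "T = (\<lambda>x. Q x + c)"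
    using G by (auto simp: graph_end_def rigid_motion_def)
  obtain \<tau> where \<tau>: "\<tau> > 1/2" and O: "(\<lambda>y. norm (gradient \<psi> y)
                  + norm y * onorm (frechet_derivative (gradient \<psi>) (at y)))
               \<in> O[at_infinity](\<lambda>y. norm y powr (- \<tau>))"
    using G unfolding graph_end_def by blast
  obtain A where A: "full_tail (catenoid m) E A" "T ` A = {(y, \<psi> y) | y. norm y > R\<^sub>0}"
    using G unfolding graph_end_def by blast
  have loc: "\<exists>\<epsilon>>0. \<forall>x\<in>ball (y, \<psi> y) \<epsilon>. x \<in> T ` catenoid_region m \<longleftrightarrow> snd x > \<psi> (fst x)"
    if "norm y > R\<^sub>0" for y
    using G that unfolding graph_end_def by blast
  have R0: "R\<^sub>0 > 0" using G by (simp add: graph_end_def)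
  have diff: "\<psi> differentiable (at y)" if "norm y > R\<^sub>0" for y
  proof -
    have "Ck_on (Suc 0) \<psi> {y. norm y > R\<^sub>0}" using G by (simp add: graph_end_def smooth_on_def del: Ck_on.simps)
    thus ?thesis using that by simp
  qed
  obtain a where a: "a > 0" "cat_half m s a \<subseteq> A" "A \<subseteq> catenoid m"
    "cat_half m (- s) a \<subseteq> A \<or> cat_half m (- s) a \<inter> A = {}"
    using full_tailE[OF A(1) E m] by blast
  have s: "s \<in> {1, -1}" by (rule end_sideD(2)[OF E])
  have lin: "linear Q" using Q by (rule orthogonal_transformation_linear)
  have T_add: "T (p + v) = T p + Q v" for p v using linear_add[OF lin] by (simp add: T)
  have inA: "\<exists>p\<in>A. T p = (y, \<psi> y)" if "norm y > R\<^sub>0" for y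
  proof -
    have "(y, \<psi> y) \<in> T ` A" unfolding A(2) using that by blast
    thus ?thesis by force
  qed
  have in_graph: "norm (fst (T p)) > R\<^sub>0" "snd (T p) = \<psi> (fst (T p))" if "p \<in> A" for p
  proof -
    have "T p \<in> {(y, \<psi> y) | y. norm y > R\<^sub>0}" using A(2) that by blast
    thus "norm (fst (T p)) > R\<^sub>0" "snd (T p) = \<psi> (fst (T p))" by auto
  qed
  \<comment> \<open>There is a graph point whose base point and whose original height on side
    \<open>\<sigma>\<close> both exceed \<open>B\<close>. If this failed for both signs at some
    bounds, the points over far base points would come from one compact slab, whose image under
    \<open>T\<close> is bounded.\<close>
  define X where "X \<sigma> B \<longleftrightarrow> (\<exists>y p. norm y > B \<and> norm y > R\<^sub>0 \<and> p \<in> A \<and> T p = (y, \<psi> y) \<and> \<sigma> * snd p > B)"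
    for \<sigma> B :: real
  have "\<exists>\<sigma>\<in>{1, -1}. \<forall>B. X \<sigma> B"
  proof (rule ccontr)
    assume "\<not> ?thesis"
    then obtain B1 B2 where X: "\<not> X 1 B1" "\<not> X (-1) B2" by blast
    have B: "snd p \<le> B1" if "norm y > B1" "norm y > R\<^sub>0" "p \<in> A" "T p = (y, \<psi> y)" for y p
    proof (rule ccontr)
      assume "\<not> ?thesis"
      with that have "X 1 B1" unfolding X_def by (intro exI[of _ y] exI[of _ p]) simp
      thus False using X(1) by blast
    qed
    have B': "- snd p \<le> B2" if "norm y > B2" "norm y > R\<^sub>0" "p \<in> A" "T p = (y, \<psi> y)" for y p
    proof (rule ccontr)
      assume "\<not> ?thesis"
      with that have "X (-1) B2" unfolding X_def by (intro exI[of _ y] exI[of _ p]) simp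
      thus False using X(2) by blast
    qed
    define B where "B = max B1 B2"
    obtain C where C: "\<And>p. p \<in> cat_slab m B \<Longrightarrow> norm p \<le> C"
      using compact_imp_bounded[OF compact_cat_slab[OF m]] unfolding bounded_iff by blast
    define y :: "real^2" where "y = (max (max B R\<^sub>0) (C + norm c) + 1) *\<^sub>R axis 1 1"
    have "norm y = max (max B R\<^sub>0) (C + norm c) + 1" using R0 by (simp add: y_def)
    hence y: "norm y > B1" "norm y > B2" "norm y > R\<^sub>0" "norm y > C + norm c" by (auto simp: B_def)
    obtain p where p: "p \<in> A" "T p = (y, \<psi> y)" using inA[OF y(3)] by blast
    have "p \<in> cat_slab m B"
      using B[OF y(1,3) p] B'[OF y(2,3) p] p(1) a(3) by (auto simp: cat_slab_def B_def)
    hence "norm (T p) \<le> C + norm c"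
      using C[of p] norm_triangle_ineq[of "Q p" c] orthogonal_transformation_norm[OF Q, of p] by (simp add: T)
    moreover have "norm y \<le> norm (T p)" using norm_fst_le[of y "\<psi> y"] p(2) by simp
    ultimately show False using y(4) by linarith
  qed
  then obtain \<sigma> where \<sigma>: "\<sigma> \<in> {1, -1}"
    "\<And>B. \<exists>y p. norm y > B \<and> norm y > R\<^sub>0 \<and> p \<in> A \<and> T p = (y, \<psi> y) \<and> \<sigma> * snd p > B"
    unfolding X_def by blast
  have decay: "\<exists>B. \<forall>y. norm y > B \<longrightarrow> norm y > R\<^sub>0 \<longrightarrow> norm (gradient \<psi> y) \<le> \<delta>" if "\<delta> > 0" for \<delta>
  proof -
    obtain C where C: "C > 0" "eventually (\<lambda>y. norm (norm (gradient \<psi> y)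
        + norm y * onorm (frechet_derivative (gradient \<psi>) (at y))) \<le> C * norm (norm y powr (- \<tau>))) at_infinity"
      using landau_o.bigE[OF O] by blast
    have "filterlim (\<lambda>y::real^2. norm y) at_top at_infinity" by (rule filterlim_norm_at_top)
    hence "((\<lambda>y::real^2. C * norm (norm y powr (- \<tau>))) \<longlongrightarrow> C * norm (0::real)) at_infinity"
      using \<tau> by (intro tendsto_intros tendsto_neg_powr) auto
    hence "eventually (\<lambda>y::real^2. C * norm (norm y powr (- \<tau>)) < \<delta>) at_infinity"
      using that by (auto dest!: order_tendstoD(2))
    with C(2) have "eventually (\<lambda>y. norm (norm (gradient \<psi> y)
        + norm y * onorm (frechet_derivative (gradient \<psi>) (at y))) \<le> \<delta>) at_infinity"
      by eventually_elim linarith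
    then obtain B where B: "\<And>y. norm y \<ge> B \<Longrightarrow> norm (norm (gradient \<psi> y)
        + norm y * onorm (frechet_derivative (gradient \<psi>) (at y))) \<le> \<delta>"
      unfolding eventually_at_infinity by blast
    have "norm (gradient \<psi> y) \<le> \<delta>" if y: "norm y > B" "norm y > R\<^sub>0" for y
    proof -
      \<comment> \<open>Second derivatives enter only to show that the \<open>onorm\<close> term is
        nonnegative, so that decay of the sum bounds the gradient alone.\<close>
      have "Ck_on (Suc (Suc 0)) \<psi> {y. norm y > R\<^sub>0}"
        using G by (simp add: graph_end_def smooth_on_def del: Ck_on.simps)
      hence "(\<lambda>x. frechet_derivative \<psi> (at x) b) differentiable (at y)" for b using y(2) by simp
      hence "gradient \<psi> differentiable (at y)"
        unfolding gradient_def[abs_def]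
        by (intro differentiable_sum ballI differentiable_scaleR differentiable_const) auto
      hence "bounded_linear (frechet_derivative (gradient \<psi>) (at y))"
        using frechet_derivative_works has_derivative_bounded_linear by blast
      hence "0 \<le> norm y * onorm (frechet_derivative (gradient \<psi>) (at y))" by (simp add: onorm_pos_le)
      thus ?thesis using B[of y] y(1) by simp
    qed
    thus ?thesis by blast
  qed
  have pos: "snd (Q (u, \<sigma>)) \<ge> 0" for u
  proof (rule ccontr)
    assume neg: "\<not> ?thesis"
    define w where "w = Q (u, \<sigma>)"
    have w: "snd w < 0" using neg by (simp add: w_def)
    \<comment> \<open>If the gradient is at most \<open>\<delta>\<close>, the directional derivative
      along \<open>fst w\<close> is at least \<open>snd w / 2\<close>, which exceeds the negative
      number \<open>snd w\<close>. The added 1 keeps the denominator positive.\<close>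
    define \<delta> where "\<delta> = - snd w / (2 * (norm (fst w) + 1))"
    have n1: "norm (fst w) + 1 > 0" using norm_ge_zero[of "fst w"] by linarith
    have "\<delta> > 0" using w n1 unfolding \<delta>_def by (intro divide_pos_pos) auto
    then obtain B where B: "\<And>y. norm y > B \<Longrightarrow> norm y > R\<^sub>0 \<Longrightarrow> norm (gradient \<psi> y) \<le> \<delta>"
      using decay by blast
    obtain y p where yp: "norm y > max B (m * norm u)" "norm y > R\<^sub>0" "p \<in> A" "T p = (y, \<psi> y)"
      "\<sigma> * snd p > max B (m * norm u)" using \<sigma>(2) by blast
    have up: "\<sigma> * snd p > m * norm u" using yp(5) by simp
    moreover have nu: "m * norm u \<ge> 0" using m by simp
    ultimately have steep: "\<sigma> * snd p \<ge> 0" by linarith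
    have "norm u < \<sigma> * snd p / m" using up m by (simp add: field_simps)
    also have "\<dots> \<le> sinh (\<sigma> * snd p / m)" by (rule le_sinh_real) (use steep m in simp)
    finally have "sinh (\<sigma> * snd p / m) > norm u" .
    hence inward: "p + t *\<^sub>R (u, \<sigma>) \<in> catenoid_region m" if "t > 0" for t
      using catenoid_inward_direction[OF m _ \<sigma>(1) steep _ that] yp(3) a(3) by blast
    obtain \<epsilon> where \<epsilon>: "\<epsilon> > 0"
      "\<And>x. x \<in> ball (y, \<psi> y) \<epsilon> \<Longrightarrow> x \<in> T ` catenoid_region m \<longleftrightarrow> snd x > \<psi> (fst x)"
      using loc[OF yp(2)] by blast
    have "gradient \<psi> y \<bullet> fst w \<le> snd w"
    proof (rule graph_locally_below_imp_slope[OF diff[OF yp(2)] \<epsilon>(1)])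
      fix t :: real assume t: "t > 0" "(y, \<psi> y) + t *\<^sub>R w \<in> ball (y, \<psi> y) \<epsilon>"
      have "(y, \<psi> y) + t *\<^sub>R w = T (p + t *\<^sub>R (u, \<sigma>))"
        using T_add[of p "t *\<^sub>R (u, \<sigma>)"] linear_scale[OF lin, of t "(u, \<sigma>)"] yp(4) by (simp add: w_def)
      hence "(y, \<psi> y) + t *\<^sub>R w \<in> T ` catenoid_region m" using inward[OF t(1)] by simp
      thus "\<psi> (fst ((y, \<psi> y) + t *\<^sub>R w)) < snd ((y, \<psi> y) + t *\<^sub>R w)" using \<epsilon>(2)[OF t(2)] by simp
    qed
    moreover have "- (\<delta> * norm (fst w)) \<le> gradient \<psi> y \<bullet> fst w"
    proof -
      have "\<bar>gradient \<psi> y \<bullet> fst w\<bar> \<le> norm (gradient \<psi> y) * norm (fst w)" by (rule Cauchy_Schwarz_ineq2)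
      also have "\<dots> \<le> \<delta> * norm (fst w)" using B[of y] yp by (intro mult_right_mono) auto
      finally show ?thesis by linarith
    qed
    moreover have "\<delta> * norm (fst w) \<le> \<delta> * (norm (fst w) + 1)" using \<open>\<delta> > 0\<close> by simp
    moreover have "\<delta> * (norm (fst w) + 1) = - snd w / 2"
    proof -
      have "- a / (2 * b) * b = - a / 2" if "b > 0" for a b :: real using that by simp
      from this[OF n1] show ?thesis unfolding \<delta>_def .
    qed
    ultimately show False using w by linarith
  qed
  obtain P where P: "\<And>u t. Q (u, t) = (P u, \<sigma> * t)" "\<And>u. norm (P u) = norm u"
    using orthogonal_preserving_horizontal[OF Q \<sigma>(1) pos] by metis
  have TP: "T p = (P (fst p) + fst c, \<sigma> * snd p + snd c)" for p
    using P(1)[of "fst p" "snd p"] by (simp add: T prod_eq_iff)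
  \<comment> \<open>If the tail contained far parts of both halves, some mirror pair
    \<open>(fst x, snd x)\<close> and \<open>(fst x, - snd x)\<close> would be mapped to different
    heights over the same base point, which a graph forbids.\<close>
  have away: "cat_half m (- s) a \<inter> A = {}"
  proof (rule ccontr)
    assume "\<not> ?thesis"
    hence sub: "cat_half m (- s) a \<subseteq> A" using a(4) by blast
    obtain x where x: "x \<in> cat_half m s a" using cat_half_nonempty[OF m s] by blast
    hence "(fst x, - snd x) \<in> cat_half m (- s) a" by (simp add: cat_half_def mem_catenoid)
    hence x': "(fst x, - snd x) \<in> A" and xA: "x \<in> A" using sub x a(2) by auto
    have "\<sigma> * snd x = 0"
      using in_graph(2)[OF x'] in_graph(2)[OF xA] by (simp only: TP fst_conv snd_conv)
    hence "snd x = 0" using \<sigma>(1) by auto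
    thus False using x a(1) by (simp add: cat_half_def)
  qed
  have "\<sigma> = s"
  proof (rule ccontr)
    assume "\<sigma> \<noteq> s"
    hence "\<sigma> = - s" using s \<sigma>(1) by auto
    moreover obtain p where "p \<in> A" "\<sigma> * snd p > a" using \<sigma>(2)[of a] by blast
    ultimately have "p \<in> cat_half m (- s) a \<inter> A" using a(3) by (auto simp: cat_half_def)
    thus False using away by blast
  qed
  \<comment> \<open>Beyond this radius the preimage on the catenoid has height above
    \<open>a\<close> in absolute value, and \<open>away\<close> then decides on which half it
    lies.\<close>
  define R where "R = max R\<^sub>0 (norm (fst c) + m * cosh (a / m))"
  have far: "norm (y - fst c) > m * cosh (a / m)" if "norm y > R" for y
    using that norm_triangle_ineq2[of y "fst c"] by (simp add: R_def)
  have m_le: "m \<le> m * cosh (a / m)" using m cosh_real_ge_1[of "a / m"] by simp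
  have \<psi>_eq: "\<psi> y = cat_height m (y - fst c) + snd c" if y: "norm y > R" for y
  proof -
    obtain p where p: "p \<in> A" "T p = (y, \<psi> y)" using inA[of y] y by (auto simp: R_def)
    have n: "norm (y - fst c) = norm (fst p)" using p(2) P(2)[of "fst p"] by (auto simp: TP)
    have cp: "norm (fst p) = m * cosh (s * snd p / m)"
      using p(1) a(3) by (auto simp only: cosh_sign[OF s] mem_catenoid[symmetric])
    have "\<bar>s * snd p\<bar> > a"
    proof (rule ccontr)
      assume "\<not> ?thesis"
      hence "cosh (\<bar>s * snd p\<bar> / m) \<le> cosh (a / m)"
        using m a(1) by (subst cosh_real_nonneg_le_iff) (auto simp: divide_right_mono)
      moreover have "cosh (\<bar>s * snd p\<bar> / m) = cosh (s * snd p / m)" by (cases "s * snd p \<ge> 0") auto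
      ultimately have "norm (fst p) \<le> m * cosh (a / m)" using cp m by simp
      thus False using far[OF y] n by simp
    qed
    moreover have "\<not> - s * snd p > a" using away p(1) a(3) by (auto simp: cat_half_def)
    ultimately have sp: "s * snd p > 0" using a(1) by (simp add: abs_if split: if_splits)
    have "s * snd p = cat_height m (y - fst c)"
      using norm_eq_cosh_iff(1)[OF m, of "y - fst c" "s * snd p"] sp far[OF y] m_le cp n by linarith
    thus ?thesis using p(2) \<open>\<sigma> = s\<close> by (simp add: TP)
  qed
  have "gradient \<psi> y = cat_grad m (y - fst c)" if y: "norm y > R" for y
  proof (rule gradient_eq)
    have "((\<lambda>y. cat_height m (y - fst c)) has_derivative (\<lambda>v. cat_grad m (y - fst c) \<bullet> v)) (at y)"
    proof (rule has_derivative_compose[where f' = "\<lambda>v. v" and g = "cat_height m"])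
      show "((\<lambda>y. y - fst c) has_derivative (\<lambda>v. v)) (at y)"
        using has_derivative_diff[OF has_derivative_ident has_derivative_const] by simp
      show "(cat_height m has_derivative (\<bullet>) (cat_grad m (y - fst c))) (at (y - fst c))"
        using has_derivative_cat_height[OF m] far[OF y] m_le by simp
    qed
    hence "((\<lambda>y. cat_height m (y - fst c) + snd c) has_derivative (\<lambda>v. cat_grad m (y - fst c) \<bullet> v)) (at y)"
      by (auto intro!: derivative_eq_intros)
    thus "(\<psi> has_derivative (\<lambda>v. cat_grad m (y - fst c) \<bullet> v)) (at y)"
      by (rule has_derivative_transform_within_open[OF _ open_norm_greater[of R]]) (use y \<psi>_eq in auto)
  qed
  thus ?thesis by blast
qed

lemma mass_catenoid_unique:
  assumes m: "m > 0" and E: "end_side m E s"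
    and "has_extrinsic_mass (catenoid m) (catenoid_region m) E \<mu>"
  shows "\<mu> = m"
proof -
  obtain T R\<^sub>0 \<psi> where G: "graph_end (catenoid m) (catenoid_region m) E T R\<^sub>0 \<psi>"
    and lim: "((\<lambda>r. 1 / (2 * pi * r) * (LINT y:sphere 0 r|hausdorff_measure 1. y \<bullet> gradient \<psi> y)) \<longlongrightarrow> \<mu>) at_top"
    using assms(3) unfolding has_extrinsic_mass_def by blast
  obtain R c where "\<And>y. norm y > R \<Longrightarrow> gradient \<psi> y = cat_grad m (y - c)"
    using catenoid_graph_end_unique[OF m E G] by blast
  from catenoid_mass_limit[OF m this] lim show ?thesis
    by (intro tendsto_unique[OF _ lim]) auto
qed

lemma extrinsic_mass_catenoid:
  assumes "m > 0" "end_side m E s"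
  shows "extrinsic_mass (catenoid m) (catenoid_region m) E = m"
  unfolding extrinsic_mass_def
  using has_mass_catenoid[OF assms] mass_catenoid_unique[OF assms] by (rule the_equality)

section \<open>The separating area of the catenoid\<close>

lemma hausdorff_outer_disc_le:
  assumes m: "m > 0"
  shows "hausdorff_outer 2 (cball 0 m \<times> {0} :: space3 set) \<le> ennreal (pi * m\<^sup>2)"
proof -
  let ?f = "\<lambda>p :: real \<times> real. (vector [fst p, snd p], 0) :: space3"
  have sub: "cball 0 m \<times> {0} \<subseteq> ?f ` cball 0 m"
  proof
    fix x :: space3 assume x: "x \<in> cball 0 m \<times> {0}"
    hence "(fst x $ 1, fst x $ 2) \<in> cball 0 m" by (auto simp: norm_real2 norm_Pair)
    moreover have "x = ?f (fst x $ 1, fst x $ 2)" using x by (auto simp: prod_eq_iff vec_eq_iff forall_2)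
    ultimately show "x \<in> ?f ` cball 0 m" by blast
  qed
  have "dist (?f p) (?f q) \<le> dist p q" for p q
    by (simp add: dist_norm norm_real2 norm_Pair) (simp add: norm_prod_def)
  from hausdorff_outer_image_le[of ?f, OF this]
  have "hausdorff_outer 2 (?f ` cball 0 m) \<le> hausdorff_outer 2 (cball (0 :: real \<times> real) m)" .
  also have "\<dots> \<le> ennreal (measure lebesgue (cball (0 :: real \<times> real) m))"
    using hausdorff_outer_le_lebesgue[of "cball (0 :: real \<times> real) m"] by (simp add: numeral_2_eq_2)
  also have "measure lebesgue (cball (0 :: real \<times> real) m) = pi * m\<^sup>2"
    using m by (simp add: measure_def emeasure_cball eval_unit_ball_vol power2_eq_square)
  finally show ?thesis using hausdorff_outer_mono[OF sub] by (meson order_trans)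
qed

text \<open>Vertical projection covers the open disc. Its target is
  \<open>real \<times> real\<close>, the type in which slicing yields the isodiametric
  inequality.\<close>

lemma hausdorff_outer_ge_projection:
  assumes m: "m > 0" and proj: "\<And>y. norm y < m \<Longrightarrow> \<exists>t. (y, t) \<in> \<Sigma>"
  shows "ennreal (pi * m\<^sup>2) \<le> hausdorff_outer 2 (\<Sigma> :: space3 set)"
proof -
  let ?g = "\<lambda>x :: space3. (fst x $ 1, fst x $ 2)"
  have "ennreal (pi * m\<^sup>2) = emeasure lborel (ball (0 :: real \<times> real) m)"
    using m by (simp add: emeasure_ball eval_unit_ball_vol power2_eq_square)
  also have "\<dots> \<le> hausdorff_outer 2 (ball (0 :: real \<times> real) m)"
    by (rule lebesgue_le_hausdorff_outer_2) simp
  also have "\<dots> \<le> hausdorff_outer 2 (?g ` \<Sigma>)"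
  proof (rule hausdorff_outer_mono, rule subsetI)
    fix p :: "real \<times> real" assume "p \<in> ball 0 m"
    hence "norm (vector [fst p, snd p] :: real^2) < m" by (cases p) (simp add: norm_real2 norm_Pair)
    then obtain t where "(vector [fst p, snd p], t) \<in> \<Sigma>" using proj by blast
    thus "p \<in> ?g ` \<Sigma>" by (intro image_eqI[of _ _ "(vector [fst p, snd p], t)"]) auto
  qed
  also have "\<dots> \<le> hausdorff_outer 2 \<Sigma>"
  proof (rule hausdorff_outer_image_le)
    fix x y :: space3
    have "dist (?g x) (?g y) = dist (fst x) (fst y)"
      by (simp add: dist_norm norm_real2 norm_Pair)
    also have "\<dots> \<le> dist x y" by (rule dist_fst_le)
    finally show "dist (?g x) (?g y) \<le> dist x y" .
  qed
  finally show ?thesis .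
qed

text \<open>The set is the image of a solid half-cylinder under horizontal scaling by
  \<open>m * cosh (snd p / m)\<close>.\<close>

lemma connected_region_half:
  assumes m: "m > 0" and s: "s \<in> {1, -1}"
  shows "connected {x :: space3. norm (fst x) \<le> m * cosh (snd x / m) \<and> s * snd x > b}"
proof -
  let ?F = "\<lambda>p :: space3. ((m * cosh (snd p / m)) *\<^sub>R fst p, snd p)"
  let ?D = "cball (0 :: real^2) 1 \<times> {t. b < s * t}"
  have "{x :: space3. norm (fst x) \<le> m * cosh (snd x / m) \<and> s * snd x > b} = ?F ` ?D"
  proof (intro equalityI subsetI)
    fix x :: space3 assume x: "x \<in> {x. norm (fst x) \<le> m * cosh (snd x / m) \<and> s * snd x > b}"
    have "m * cosh (snd x / m) > 0" using m by simp
    thus "x \<in> ?F ` ?D"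
      using x by (intro image_eqI[of _ _ "((1 / (m * cosh (snd x / m))) *\<^sub>R fst x, snd x)"])
        (auto simp: prod_eq_iff field_simps)
  next
    fix x assume "x \<in> ?F ` ?D"
    thus "x \<in> {x. norm (fst x) \<le> m * cosh (snd x / m) \<and> s * snd x > b}"
      using m by (auto simp: mult_left_le)
  qed
  also have "connected \<dots>"
  proof (rule connected_continuous_image)
    show "continuous_on ?D ?F" using m by (intro continuous_intros) auto
    have "{t. b < s * t} = (if s = 1 then {b<..} else {..< - b})" using s by auto
    thus "connected ?D" by (simp add: connected_Times)
  qed
  finally show ?thesis .
qed

text \<open>Outside a compact set the closed region splits into two connected pieces, so a separator,
  being the relative frontier of \<open>\<Omega>\<close>, has to cross every vertical line through the open disc.\<close>

lemma separator_meets_vertical_line: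
  assumes m: "m > 0" and Ep: "end_side m Ep s" and E1: "end_side m E1 (- s)"
    and adm: "admissible_separator (catenoid m) (catenoid_region m) Ep E1 \<Sigma>" and y: "norm y < m"
  shows "\<exists>t. (y, t) \<in> \<Sigma>"
proof -
  let ?X = "top_of_set (closure (catenoid_region m))"
  obtain \<Omega> A1 A2 where \<Omega>: "openin ?X \<Omega>" "?X frontier_of \<Omega> = \<Sigma>"
    and A1: "full_tail (catenoid m) E1 A1" "A1 \<subseteq> \<Omega>" and A2: "full_tail (catenoid m) Ep A2" "A2 \<inter> \<Omega> = {}"
    using adm unfolding admissible_separator_def by blast
  obtain a1 where a1: "cat_half m (- s) a1 \<subseteq> A1" by (rule full_tailE[OF A1(1) E1 m]) (rule that)
  obtain a2 where a2: "cat_half m s a2 \<subseteq> A2" by (rule full_tailE[OF A2(1) Ep m]) (rule that)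
  have s: "s \<in> {1, -1}" "- s \<in> {1, -1}" using end_sideD(2) Ep E1 by blast+
  have "compact \<Sigma>" using adm by (simp add: admissible_separator_def)
  then obtain b where b: "\<And>x. x \<in> \<Sigma> \<Longrightarrow> norm x \<le> b" unfolding bounded_iff
    using compact_imp_bounded bounded_iff by metis
  have snd_b: "\<bar>snd x\<bar> \<le> b" if "x \<in> \<Sigma>" for x
    using b[OF that] norm_snd_le[of "snd x" "fst x"] by simp
  let ?U = "\<lambda>\<sigma>. {x :: space3. norm (fst x) \<le> m * cosh (snd x / m) \<and> \<sigma> * snd x > b}"
  let ?L = "{y} \<times> (UNIV :: real set)"
  have yL: "norm y \<le> m * cosh (t / m)" for t
    using y mult_left_mono[OF cosh_real_ge_1[of "t / m"], of m] m by linarith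
  have con: "connected (?L \<union> ?U \<sigma>)" if "\<sigma> \<in> {1, -1}" for \<sigma>
  proof (rule connected_Un)
    have "(y, \<sigma> * (b + 1)) \<in> ?L \<inter> ?U \<sigma>" using that yL by auto
    thus "?L \<inter> ?U \<sigma> \<noteq> {}" by blast
  qed (use connected_region_half[OF m that] in \<open>auto simp: connected_Times\<close>)
  \<comment> \<open>The vertical line stays in the closed region and joins its two far pieces. These
    lie beyond the height bound \<open>b\<close> of the separator, so a point of
    \<open>\<Sigma>\<close> in \<open>?C\<close> can only lie on the line.\<close>
  let ?C = "(?L \<union> ?U (- s)) \<union> (?L \<union> ?U s)"
  have "connected ?C" by (rule connected_Un[OF con[OF s(2)] con[OF s(1)]]) blast
  moreover have "?C \<subseteq> closure (catenoid_region m)" using yL by (auto simp: closure_catenoid_region[OF m])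
  ultimately have "connectedin ?X ?C" by (simp add: connectedin_subtopology)
  moreover have "?C \<inter> \<Omega> \<noteq> {}"
  proof -
    obtain x where x: "x \<in> cat_half m (- s) a1" "x \<in> cat_half m (- s) b" using cat_half_nonempty[OF m s(2)] by blast
    hence "x \<in> ?U (- s)" by (auto simp: cat_half_def mem_catenoid)
    thus ?thesis using x a1 A1(2) by blast
  qed
  moreover have "?C - \<Omega> \<noteq> {}"
  proof -
    obtain x where x: "x \<in> cat_half m s a2" "x \<in> cat_half m s b" using cat_half_nonempty[OF m s(1)] by blast
    hence "x \<in> ?U s" by (auto simp: cat_half_def mem_catenoid)
    thus ?thesis using x a2 A2(2) by blast
  qed
  ultimately have "?C \<inter> \<Sigma> \<noteq> {}" using connectedin_Int_frontier_of[of ?X ?C \<Omega>] \<Omega>(2) by simp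
  then obtain x where x: "x \<in> ?C" "x \<in> \<Sigma>" by blast
  have "x \<notin> ?U \<sigma>" if "\<sigma> \<in> {1, -1}" for \<sigma>
    using snd_b[OF x(2)] that by auto
  hence "x \<in> ?L" using x(1) s by blast
  thus ?thesis using x(2) by auto
qed

lemma separator_area_ge:
  assumes m: "m > 0" and Ep: "end_side m Ep s" and E1: "end_side m E1 (- s)"
    and adm: "admissible_separator (catenoid m) (catenoid_region m) Ep E1 \<Sigma>"
  shows "ennreal (pi * m\<^sup>2) \<le> emeasure (hausdorff_measure 2) \<Sigma>"
proof -
  have "compact \<Sigma>" using adm by (simp add: admissible_separator_def)
  hence "emeasure (hausdorff_measure 2) \<Sigma> = hausdorff_outer 2 \<Sigma>"
    by (intro emeasure_hausdorff_measure borel_compact)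
  thus ?thesis
    using hausdorff_outer_ge_projection[OF m separator_meets_vertical_line[OF m Ep E1 adm]] by simp
qed

section \<open>The waist disc as a smooth surface with boundary\<close>

definition rot :: "real^2 \<Rightarrow> real^2" where
  "rot e = vector [- (e $ 2), e $ 1]"

lemma rot_nth [simp]: "rot e $ 1 = - (e $ 2)" "rot e $ 2 = e $ 1"
  by (simp_all add: rot_def)

lemma rot_inner [simp]: "e \<bullet> rot e = 0" "rot e \<bullet> e = 0" "rot e \<bullet> rot e = e \<bullet> e"
  by (simp_all add: inner_real2)

lemma rot_expand: "(e \<bullet> e) *\<^sub>R v = (v \<bullet> e) *\<^sub>R e + (v \<bullet> rot e) *\<^sub>R rot e"
  by (simp add: vec_eq_iff forall_2 inner_real2 algebra_simps)

lemma rot_expand_unit: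
  assumes "norm e = 1"
  shows "v = (v \<bullet> e) *\<^sub>R e + (v \<bullet> rot e) *\<^sub>R rot e"
    "v \<bullet> v = (v \<bullet> e)\<^sup>2 + (v \<bullet> rot e)\<^sup>2"
proof -
  have e: "e \<bullet> e = 1" using assms by (simp add: norm_eq_1)
  show 1: "v = (v \<bullet> e) *\<^sub>R e + (v \<bullet> rot e) *\<^sub>R rot e" using rot_expand[of e v] e by simp
  have "v \<bullet> v = v \<bullet> ((v \<bullet> e) *\<^sub>R e + (v \<bullet> rot e) *\<^sub>R rot e)" using 1 by simp
  thus "v \<bullet> v = (v \<bullet> e)\<^sup>2 + (v \<bullet> rot e)\<^sup>2"
    by (simp only: inner_add_right inner_scaleR_right power2_eq_square)
qed

lemma disc_interior_point:
  assumes "norm (fst p) < m" "snd p = 0"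
  shows "p \<in> surface_interior (cball 0 m \<times> {0} :: space3 set)"
proof -
  let ?U = "ball (0 :: real^2) m \<times> (UNIV :: real set)"
  have U: "open ?U" by (intro open_Times) auto
  have "smooth_on (\<lambda>x. x) ?U"
    by (rule smooth_onI[OF U Ck_on_linear[OF U bounded_linear_ident]])
  hence "diffeomorphism_on ?U ?U (\<lambda>x. x) (\<lambda>x. x)"
    unfolding diffeomorphism_on_def using homeomorphism_ident by blast
  moreover have "p \<in> ?U" using assms by (cases p) auto
  moreover have "(\<lambda>x. x) ` (cball 0 m \<times> {0} \<inter> ?U) = ?U \<inter> {z. snd z = 0}" by auto
  moreover have "p \<in> cball 0 m \<times> {0}" using assms by (cases p) auto
  ultimately show ?thesis unfolding surface_interior_def by blast
qed

text \<open>The first chart coordinate is \<open>m^2 - fst x \<bullet> fst x\<close>, which is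
  nonnegative exactly over the disc; the second is the component of \<open>fst x\<close> along
  \<open>rot e\<close>. On the half-space \<open>fst x \<bullet> e > 0\<close> they determine
  \<open>fst x\<close>, because \<open>r\<close> recovers \<open>(fst x \<bullet> e)^2\<close> and
  the positive root is the missing component.\<close>

lemma disc_boundary_point:
  assumes m: "m > 0" and p: "norm (fst p) = m" "snd p = 0"
  shows "p \<in> surface_boundary (cball 0 m \<times> {0} :: space3 set)"
proof -
  define e where "e = (1 / m) *\<^sub>R fst p"
  have e: "norm e = 1" using m p by (simp add: e_def)
  note exp = rot_expand_unit[OF e]
  have ee: "e \<bullet> e = 1" using e by (simp add: norm_eq_1)
  define U where "U = {x :: space3. fst x \<bullet> e > 0}"
  define r where "r z = m\<^sup>2 - fst z $ 1 - (fst z $ 2)\<^sup>2" for z :: space3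
  define V where "V = {z :: space3. r z > 0}"
  define \<Phi> :: "space3 \<Rightarrow> space3" where "\<Phi> x = (vector [m\<^sup>2 - fst x \<bullet> fst x, fst x \<bullet> rot e], snd x)" for x
  define \<Psi> :: "space3 \<Rightarrow> space3" where "\<Psi> z = (sqrt (r z) *\<^sub>R e + (fst z $ 2) *\<^sub>R rot e, snd z)" for z
  have U: "open U" unfolding U_def by (intro open_Collect_less continuous_intros)
  have V: "open V" unfolding V_def r_def by (intro open_Collect_less continuous_intros)
  have r\<Phi>: "r (\<Phi> x) = (fst x \<bullet> e)\<^sup>2" for x using exp(2)[of "fst x"] by (simp add: r_def \<Phi>_def)
  have \<Phi>U: "\<Phi> x \<in> V" if "x \<in> U" for x using that by (simp add: V_def r\<Phi> U_def)
  have \<Psi>V: "\<Psi> z \<in> U" if "z \<in> V" for z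
    using that by (simp add: V_def U_def \<Psi>_def inner_add_left ee)
  have \<Psi>\<Phi>: "\<Psi> (\<Phi> x) = x" if "x \<in> U" for x
    using that exp(1)[of "fst x"] by (simp add: \<Psi>_def r\<Phi> U_def prod_eq_iff) (simp add: \<Phi>_def)
  have \<Phi>\<Psi>: "\<Phi> (\<Psi> z) = z" if "z \<in> V" for z
  proof -
    have "r z > 0" using that by (simp add: V_def)
    have "fst (\<Psi> z) \<bullet> e = sqrt (r z)" "fst (\<Psi> z) \<bullet> rot e = fst z $ 2"
      by (simp_all add: \<Psi>_def inner_add_left ee)
    hence "fst (\<Psi> z) \<bullet> fst (\<Psi> z) = r z + (fst z $ 2)\<^sup>2"
      using exp(2)[of "fst (\<Psi> z)"] \<open>r z > 0\<close> by simp
    hence "m\<^sup>2 - fst (\<Psi> z) \<bullet> fst (\<Psi> z) = fst z $ 1" by (simp add: r_def)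
    thus ?thesis using \<open>fst (\<Psi> z) \<bullet> rot e = fst z $ 2\<close>
      by (simp add: \<Phi>_def prod_eq_iff vec_eq_iff forall_2) (simp add: \<Psi>_def)
  qed
  have ck1: "Ck_on k (\<lambda>x. fst x) W" if "open W" for k and W :: "space3 set"
    by (rule Ck_on_linear[OF that bounded_linear_fst])
  have ck2: "Ck_on k (\<lambda>x. snd x) W" if "open W" for k and W :: "space3 set"
    by (rule Ck_on_linear[OF that bounded_linear_snd])
  have ckn: "Ck_on k (\<lambda>x. fst x $ i) W" if "open W" for k i and W :: "space3 set"
    by (rule Ck_on_compose_linear[OF that bounded_linear_vec_nth ck1[OF that]])
  have sc: "Ck_on k (\<lambda>x. g x *\<^sub>R v) W" if "open W" "Ck_on k g W" for k g v and W :: "space3 set"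
    by (rule Ck_on_bilinear[OF that(1) bounded_bilinear_scaleR that(2) Ck_on_const[OF that(1)]])
  have sm\<Phi>: "smooth_on \<Phi> U"
  proof (rule smooth_onI[OF U])
    fix k
    have "Ck_on k (\<lambda>x. ((m\<^sup>2 + (-1) * (fst x \<bullet> fst x)) *\<^sub>R (axis 1 1, 0) + (fst x \<bullet> rot e) *\<^sub>R (axis 2 1, 0))
        + snd x *\<^sub>R (0, 1) :: space3) U"
      by (intro Ck_on_add[OF U] sc[OF U] ck2[OF U] Ck_on_const[OF U] ck1[OF U]
          Ck_on_bilinear[OF U bounded_bilinear_inner] Ck_on_bilinear[OF U bounded_bilinear_mult])
    thus "Ck_on k \<Phi> U"
      by (rule Ck_on_cong[OF U, rotated])
         (simp add: \<Phi>_def prod_eq_iff vec_eq_iff forall_2 axis_def)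
  qed
  have sm\<Psi>: "smooth_on \<Psi> V"
  proof (rule smooth_onI[OF V])
    fix k
    have "Ck_on k (\<lambda>z. m\<^sup>2 + ((-1) * fst z $ 1 + (-1) * (fst z $ 2 * fst z $ 2))) V"
      by (intro Ck_on_add[OF V] Ck_on_const[OF V] ckn[OF V] Ck_on_bilinear[OF V bounded_bilinear_mult])
    hence "Ck_on k r V" by (rule Ck_on_cong[OF V, rotated]) (simp add: r_def power2_eq_square)
    hence "Ck_on k (\<lambda>z. r z powr (1/2)) V" by (intro Ck_on_powr[OF V]) (auto simp: V_def)
    hence "Ck_on k (\<lambda>z. (r z powr (1/2)) *\<^sub>R (e, 0) + (fst z $ 2) *\<^sub>R (rot e, 0) + snd z *\<^sub>R (0, 1) :: space3) V"
      by (intro Ck_on_add[OF V] sc[OF V] ck2[OF V] ckn[OF V])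
    thus "Ck_on k \<Psi> V"
      by (rule Ck_on_cong[OF V, rotated]) (auto simp: \<Psi>_def V_def powr_half_sqrt)
  qed
  have "homeomorphism U V \<Phi> \<Psi>"
  proof (rule homeomorphismI)
    show "continuous_on U \<Phi>" using sm\<Phi> Ck_on_continuous by (auto simp: smooth_on_def)
    show "continuous_on V \<Psi>" using sm\<Psi> Ck_on_continuous by (auto simp: smooth_on_def)
  qed (use \<Phi>U \<Psi>V \<Phi>\<Psi> \<Psi>\<Phi> in auto)
  hence "diffeomorphism_on U V \<Phi> \<Psi>" using sm\<Phi> sm\<Psi> by (simp add: diffeomorphism_on_def)
  moreover have "p \<in> U" using m p by (simp add: U_def e_def power2_norm_eq_inner[symmetric])
  moreover have "fst (\<Phi> p) $ 1 = 0" using p by (simp add: \<Phi>_def power2_norm_eq_inner[symmetric])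
  moreover have "\<Phi> ` (cball 0 m \<times> {0} \<inter> U) = V \<inter> {z. snd z = 0 \<and> fst z $ 1 \<ge> 0}"
  proof -
    have disc: "x \<in> cball 0 m \<times> {0} \<longleftrightarrow> snd x = 0 \<and> m\<^sup>2 - fst x \<bullet> fst x \<ge> 0" for x :: space3
      using m by (cases x) (auto simp: power2_norm_eq_inner[symmetric] abs_le_square_iff[symmetric])
    have disc': "x \<in> cball 0 m \<times> {0} \<longleftrightarrow> snd (\<Phi> x) = 0 \<and> fst (\<Phi> x) $ 1 \<ge> 0" for x
      by (simp add: disc \<Phi>_def)
    show ?thesis
    proof (intro equalityI subsetI)
      fix z assume z: "z \<in> V \<inter> {z. snd z = 0 \<and> fst z $ 1 \<ge> 0}"
      thus "z \<in> \<Phi> ` (cball 0 m \<times> {0} \<inter> U)"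
        using \<Phi>\<Psi>[of z] \<Psi>V[of z] disc'[of "\<Psi> z"] by (intro image_eqI[of _ _ "\<Psi> z"]) auto
    next
      fix z assume "z \<in> \<Phi> ` (cball 0 m \<times> {0} \<inter> U)"
      then obtain x where "x \<in> cball 0 m \<times> {0}" "x \<in> U" "z = \<Phi> x" by blast
      thus "z \<in> V \<inter> {z. snd z = 0 \<and> fst z $ 1 \<ge> 0}" using \<Phi>U[of x] disc'[of x] by blast
    qed
  qed
  moreover have "p \<in> cball 0 m \<times> {0}" using p m by (cases p) auto
  ultimately show ?thesis unfolding surface_boundary_def by blast
qed

text \<open>A boundary point is defined by the existence of some chart, so at an inner point all
  charts have to be excluded. By invariance of domain such a chart would map a planar neighbourhood
  onto an open set contained in a half-plane and touching its edge.\<close>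

lemma disc_not_boundary_point:
  assumes p: "norm (fst p) < m"
  shows "p \<notin> surface_boundary (cball 0 m \<times> {0} :: space3 set)"
proof
  assume "p \<in> surface_boundary (cball 0 m \<times> {0} :: space3 set)"
  then obtain U V and \<Phi> \<Psi> :: "space3 \<Rightarrow> space3" where
    *: "diffeomorphism_on U V \<Phi> \<Psi>" "p \<in> U" "fst (\<Phi> p) $ 1 = 0"
    "\<Phi> ` ((cball 0 m \<times> {0}) \<inter> U) = V \<inter> {z. snd z = 0 \<and> fst z $ 1 \<ge> 0}" "p \<in> cball 0 m \<times> {0}"
    unfolding surface_boundary_def mem_Collect_eq by (elim conjE exE)
  have hom: "homeomorphism U V \<Phi> \<Psi>" and "open U"
    using *(1) by (auto simp: diffeomorphism_on_def smooth_on_def)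
  define W where "W = {y :: real^2. norm y < m \<and> (y, 0) \<in> U}"
  define h where "h y = fst (\<Phi> (y, 0))" for y
  have WU: "(y, 0) \<in> (cball 0 m \<times> {0}) \<inter> U" if "y \<in> W" for y using that by (auto simp: W_def)
  have img: "snd (\<Phi> (y, 0)) = 0 \<and> h y $ 1 \<ge> 0" if "y \<in> W" for y
    using imageI[OF WU[OF that], of \<Phi>] *(4) by (auto simp: h_def)
  have "open W"
  proof -
    have "open ((\<lambda>y :: real^2. (y, 0 :: real)) -` U)"
      by (intro continuous_open_vimage \<open>open U\<close>) (auto intro!: continuous_intros)
    hence "open (ball 0 m \<inter> (\<lambda>y :: real^2. (y, 0 :: real)) -` U)" by (intro open_Int) auto
    moreover have "ball 0 m \<inter> (\<lambda>y :: real^2. (y, 0 :: real)) -` U = W" by (auto simp: W_def)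
    ultimately show ?thesis by simp
  qed
  have "continuous_on W h"
  proof -
    have "continuous_on W (\<lambda>y. \<Phi> (y, 0))"
      by (rule continuous_on_compose2[OF homeomorphism_cont1[OF hom]]) (auto intro!: continuous_intros simp: W_def)
    thus ?thesis unfolding h_def by (rule continuous_on_fst)
  qed
  moreover have "inj_on h W"
  proof (rule inj_onI)
    fix y y' assume y: "y \<in> W" "y' \<in> W" "h y = h y'"
    hence "\<Phi> (y, 0) = \<Phi> (y', 0)" using img by (auto simp: h_def prod_eq_iff)
    hence "\<Psi> (\<Phi> (y, 0)) = \<Psi> (\<Phi> (y', 0))" by simp
    thus "y = y'" using homeomorphism_apply1[OF hom] y by (auto simp: W_def)
  qed
  ultimately have "open (h ` W)" using \<open>open W\<close> by (intro invariance_of_domain)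
  moreover have pW: "fst p \<in> W" using *(2,5) p by (cases p) (auto simp: W_def)
  ultimately obtain \<epsilon> where \<epsilon>: "\<epsilon> > 0" "ball (h (fst p)) \<epsilon> \<subseteq> h ` W"
    by (meson open_contains_ball imageI)
  let ?q = "h (fst p) - (\<epsilon> / 2) *\<^sub>R axis 1 1"
  have "?q \<in> ball (h (fst p)) \<epsilon>" using \<epsilon>(1) by (simp add: dist_norm)
  then obtain y where "y \<in> W" "h y = ?q" using \<epsilon>(2) by (metis imageE subsetD)
  moreover have "h (fst p) $ 1 = 0" using *(3,5) by (cases p) (auto simp: h_def)
  ultimately have "(h y) $ 1 < 0" using \<epsilon>(1) by (simp add: axis_def)
  thus False using img[OF \<open>y \<in> W\<close>] by simp
qed

lemma surface_boundary_disc: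
  assumes "m > 0"
  shows "surface_boundary (cball 0 m \<times> {0} :: space3 set) = {p. norm (fst p) = m \<and> snd p = 0}"
proof (intro equalityI subsetI)
  fix p :: space3 assume p: "p \<in> surface_boundary (cball 0 m \<times> {0})"
  hence "p \<in> cball 0 m \<times> {0}" by (simp add: surface_boundary_def)
  hence "norm (fst p) \<le> m" "snd p = 0" by auto
  moreover have "\<not> norm (fst p) < m" using p disc_not_boundary_point by blast
  ultimately show "p \<in> {p. norm (fst p) = m \<and> snd p = 0}" by auto
qed (use disc_boundary_point[OF assms] in auto)

section \<open>Transversality, two-sidedness and admissibility of the waist disc\<close>

lemma tangent_spaceI:
  assumes "\<gamma> 0 = p" "\<And>t. t \<in> {0..1} \<Longrightarrow> \<gamma> t \<in> \<Sigma>" "(\<gamma> has_vector_derivative v) (at 0 within {0..1})"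
  shows "v \<in> tangent_space \<Sigma> p"
  unfolding tangent_space_def using assms by (intro span_base) blast

text \<open>On the waist circle the disc contributes the radial and the circular velocity, the
  catenoid the vertical one, since its meridians are vertical at the waist. A curve in the disc can
  only run inwards, so the outward radial vector comes from the span.\<close>

lemma transverse_disc_catenoid:
  assumes m: "m > 0"
  shows "transverse (cball 0 m \<times> {0}) (catenoid m)"
  unfolding transverse_def
proof
  fix p :: space3 assume "p \<in> (cball 0 m \<times> {0}) \<inter> catenoid m"
  then obtain y where y: "p = (y, 0)" "norm y = m" by (cases p) (auto simp: mem_catenoid)
  let ?A = "tangent_space (cball 0 m \<times> {0}) p" and ?B = "tangent_space (catenoid m) p"
  have "(- y, 0) \<in> ?A"
  proof (rule tangent_spaceI[of "\<lambda>t. ((1 - t) *\<^sub>R y, 0)"])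
    show "((\<lambda>t. ((1 - t) *\<^sub>R y, 0)) has_vector_derivative (- y, 0)) (at 0 within {0..1})"
      by (auto intro!: derivative_eq_intros)
  qed (use y m in \<open>auto simp: mult_left_le_one_le\<close>)
  hence "(-1) *\<^sub>R (- y, 0) \<in> ?A" unfolding tangent_space_def by (rule span_scale)
  hence y1: "(y, 0) \<in> ?A" by simp
  have nrm: "norm (cos t *\<^sub>R y + sin t *\<^sub>R rot y) = m" for t
  proof -
    have "(cos t *\<^sub>R y + sin t *\<^sub>R rot y) \<bullet> (cos t *\<^sub>R y + sin t *\<^sub>R rot y) = ((cos t)\<^sup>2 + (sin t)\<^sup>2) * (y \<bullet> y)"
      by (simp add: inner_add_left inner_add_right algebra_simps power2_eq_square
          del: sin_cos_squared_add sin_cos_squared_add2 sin_cos_squared_add3)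
    also have "\<dots> = m\<^sup>2" using y by (simp add: power2_norm_eq_inner[symmetric])
    finally show ?thesis using m by (simp add: norm_eq_sqrt_inner)
  qed
  have y2: "(rot y, 0) \<in> ?A"
  proof (rule tangent_spaceI[of "\<lambda>t. (cos t *\<^sub>R y + sin t *\<^sub>R rot y, 0)"])
    show "((\<lambda>t. (cos t *\<^sub>R y + sin t *\<^sub>R rot y, 0)) has_vector_derivative (rot y, 0)) (at 0 within {0..1})"
      by (auto intro!: derivative_eq_intros)
  qed (use y nrm in auto)
  have y3: "(0, 1) \<in> ?B"
  proof (rule tangent_spaceI[of "\<lambda>t. (cosh (t / m) *\<^sub>R y, t)"])
    show "((\<lambda>t. (cosh (t / m) *\<^sub>R y, t)) has_vector_derivative (0, 1)) (at 0 within {0..1})"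
      using m by (auto intro!: derivative_eq_intros)
  qed (use y m in \<open>auto simp: mem_catenoid\<close>)
  have "w \<in> {u + v | u v. u \<in> ?A \<and> v \<in> ?B}" for w :: space3
  proof -
    have "m\<^sup>2 *\<^sub>R fst w = (fst w \<bullet> y) *\<^sub>R y + (fst w \<bullet> rot y) *\<^sub>R rot y"
      using rot_expand[of y "fst w"] y by (simp add: power2_norm_eq_inner[symmetric])
    hence "(1 / m\<^sup>2) *\<^sub>R m\<^sup>2 *\<^sub>R fst w = (1 / m\<^sup>2) *\<^sub>R ((fst w \<bullet> y) *\<^sub>R y + (fst w \<bullet> rot y) *\<^sub>R rot y)" by simp
    hence "fst w = (fst w \<bullet> y / m\<^sup>2) *\<^sub>R y + (fst w \<bullet> rot y / m\<^sup>2) *\<^sub>R rot y"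
      using m by (simp add: scaleR_add_right)
    hence "w = ((fst w \<bullet> y / m\<^sup>2) *\<^sub>R (y, 0) + (fst w \<bullet> rot y / m\<^sup>2) *\<^sub>R (rot y, 0)) + snd w *\<^sub>R (0, 1)"
      by (simp add: prod_eq_iff)
    moreover have "(fst w \<bullet> y / m\<^sup>2) *\<^sub>R (y, 0) + (fst w \<bullet> rot y / m\<^sup>2) *\<^sub>R (rot y, 0) \<in> ?A"
      using y1 y2 unfolding tangent_space_def by (intro span_add span_scale)
    moreover have "snd w *\<^sub>R (0, 1) \<in> ?B"
      using y3 unfolding tangent_space_def by (intro span_scale)
    ultimately show ?thesis by blast
  qed
  thus "{u + v | u v. u \<in> ?A \<and> v \<in> ?B} = UNIV" by blast
qed

lemma two_sided_disc: "two_sided (cball 0 m \<times> {0} :: space3 set)"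
  unfolding two_sided_def
proof (intro exI conjI ballI)
  show "continuous_on (cball 0 m \<times> {0}) (\<lambda>p :: space3. (0, 1) :: space3)" by (rule continuous_on_const)
  fix p v :: space3 assume v: "v \<in> tangent_space (cball 0 m \<times> {0}) p"
  have "u \<in> {v. (0, 1) \<bullet> v = 0}"
    if \<gamma>: "\<gamma> 0 = p" "\<forall>t\<in>{0..1}. \<gamma> t \<in> cball 0 m \<times> {0}" "(\<gamma> has_vector_derivative u) (at 0 within {0..1})"
    for u and \<gamma> :: "real \<Rightarrow> space3"
  proof -
    have "((\<lambda>t. snd (\<gamma> t)) has_vector_derivative snd u) (at 0 within {0..1})"
      using \<gamma>(3) by (rule bounded_linear.has_vector_derivative[OF bounded_linear_snd])
    \<comment> \<open>The height vanishes along a curve in the disc, and one-sided derivatives on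
      the unit interval are unique.\<close>
    hence "((\<lambda>t. 0 :: real) has_vector_derivative snd u) (at 0 within {0..1})"
      by (rule has_vector_derivative_transform[rotated 2]) (use \<gamma>(2) in \<open>auto simp: mem_Times_iff\<close>)
    moreover have "((\<lambda>t. 0 :: real) has_vector_derivative 0) (at 0 within {0..1})"
      by (rule has_vector_derivative_const)
    ultimately have "snd u = 0"
      using vector_derivative_unique_within_closed_interval[of 0 1 0 "\<lambda>t. 0" "snd u" 0] by simp
    thus ?thesis by (cases u) simp
  qed
  hence "tangent_space (cball 0 m \<times> {0}) p \<subseteq> {v. (0, 1) \<bullet> v = 0}"
    unfolding tangent_space_def by (intro span_minimal subspace_hyperplane) blast
  thus "(0, 1) \<bullet> v = 0" using v by blast
qed simp

lemma disc_admissible: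
  assumes m: "m > 0" and Ep: "end_side m Ep s" and E1: "end_side m E1 (- s)"
  shows "admissible_separator (catenoid m) (catenoid_region m) Ep E1 (cball 0 m \<times> {0})"
proof -
  let ?D = "cball (0 :: real^2) m \<times> {0 :: real}"
  let ?X = "top_of_set (closure (catenoid_region m))"
  have s: "s \<in> {1, -1}" by (rule end_sideD(2)[OF Ep])
  have clM: "x \<in> closure (catenoid_region m) \<longleftrightarrow> norm (fst x) \<le> m * cosh (snd x / m)" for x
    by (simp add: closure_catenoid_region[OF m])
  have bd: "surface_boundary ?D = {p. norm (fst p) = m \<and> snd p = 0}" by (rule surface_boundary_disc[OF m])
  have "compact ?D" by (intro compact_Times) auto
  moreover have "?D \<subseteq> closure (catenoid_region m)" by (auto simp: clM)
  moreover have "smooth_embedded_surface ?D"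
    unfolding smooth_embedded_surface_def
  proof (intro equalityI subsetI)
    fix p assume "p \<in> ?D"
    thus "p \<in> surface_interior ?D \<union> surface_boundary ?D"
      using disc_interior_point[of p m] disc_boundary_point[OF m, of p] by (cases "norm (fst p) < m") auto
  qed (auto simp: surface_interior_def surface_boundary_def)
  moreover have "surface_boundary ?D = ?D \<inter> catenoid m" by (auto simp: bd mem_catenoid)
  moreover have "C \<inter> surface_boundary ?D \<noteq> {}" if "C \<in> components ?D" for C
  proof -
    have "connected ?D" by (intro connected_Times) auto
    moreover have "?D \<noteq> {}" using m by auto
    ultimately have "C = ?D" using that by (metis components_eq_sing_iff singletonD)
    moreover have "(m *\<^sub>R axis 1 1, 0) \<in> ?D \<inter> surface_boundary ?D" using m by (simp add: bd)
    ultimately show ?thesis by blast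
  qed
  moreover have "\<exists>\<Omega>. openin ?X \<Omega> \<and> ?X frontier_of \<Omega> = ?D \<and>
      (\<exists>A. full_tail (catenoid m) E1 A \<and> A \<subseteq> \<Omega>) \<and> (\<exists>A. full_tail (catenoid m) Ep A \<and> A \<inter> \<Omega> = {})"
  proof (intro exI conjI)
    \<comment> \<open>The sign of \<open>E1\<close> is \<open>- s\<close>. The strict inequality
      makes the separated set relatively open and leaves the disc as its frontier.\<close>
    let ?H = "{x :: space3. - s * snd x > 0}"
    let ?\<Omega> = "closure (catenoid_region m) \<inter> ?H"
    have "open ?H" by (intro open_Collect_less continuous_intros)
    thus op: "openin ?X ?\<Omega>" by (rule openin_open_Int)
    have "?X closure_of ?\<Omega> = closure (catenoid_region m) \<inter> closure ?\<Omega>"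
      by (simp add: closure_of_subtopology)
    moreover have "closure (catenoid_region m) \<inter> closure ?\<Omega> = closure (catenoid_region m) \<inter> {x. - s * snd x \<ge> 0}"
    proof (intro equalityI subsetI)
      fix x assume x: "x \<in> closure (catenoid_region m) \<inter> closure ?\<Omega>"
      have "closed {x :: space3. - s * snd x \<ge> 0}" by (intro closed_Collect_le continuous_intros)
      hence "closure ?\<Omega> \<subseteq> {x. - s * snd x \<ge> 0}" by (intro closure_minimal) auto
      thus "x \<in> closure (catenoid_region m) \<inter> {x. - s * snd x \<ge> 0}" using x by blast
    next
      fix x assume x: "x \<in> closure (catenoid_region m) \<inter> {x. - s * snd x \<ge> 0}"
      show "x \<in> closure (catenoid_region m) \<inter> closure ?\<Omega>"
      proof (cases "snd x = 0")
        case False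
        hence "x \<in> ?\<Omega>" using x s by auto
        thus ?thesis using x closure_subset[of ?\<Omega>] by blast
      next
        case True
        \<comment> \<open>Points of the disc are approached vertically from the side of
          \<open>E1\<close>. The region is narrowest at the waist, so the vertical segment stays
          inside its closure.\<close>
        have lim: "((\<lambda>t. (fst x, - s * t)) \<longlongrightarrow> (fst x, - s * 0)) (at_right (0::real))"
          by (intro tendsto_intros)
        have "(fst x, - s * t) \<in> ?\<Omega>" if "t > 0" for t
        proof -
          have "norm (fst x) \<le> m" using x True by (simp add: clM)
          also have "m \<le> m * cosh (- s * t / m)" using m cosh_real_ge_1[of "- s * t / m"] by simp
          finally have "(fst x, - s * t) \<in> closure (catenoid_region m)" by (simp add: clM)
          moreover have "- s * snd (fst x, - s * t) = t" using s by auto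
          ultimately show ?thesis using that by (simp only: Int_iff mem_Collect_eq)
        qed
        hence "(fst x, - s * t) \<in> closure ?\<Omega>" if "t > 0" for t
          using that by (intro subsetD[OF closure_subset])
        hence "eventually (\<lambda>t. (fst x, - s * t) \<in> closure ?\<Omega>) (at_right (0::real))"
          unfolding eventually_at_right_field by (intro exI[of _ 1] conjI allI impI zero_less_one)
        hence "(fst x, - s * 0) \<in> closure ?\<Omega>"
          by (rule Lim_in_closed_set[OF closed_closure _ _ lim]) simp
        moreover have "(fst x, - s * 0) = x" using True by (simp add: prod_eq_iff)
        ultimately show ?thesis using x by simp
      qed
    qed
    ultimately have "?X frontier_of ?\<Omega> = closure (catenoid_region m) \<inter> {x. - s * snd x \<ge> 0} - ?\<Omega>"
      using op by (simp add: frontier_of_openin)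
    also have "\<dots> = ?D" using s by (auto simp: clM)
    finally show "?X frontier_of ?\<Omega> = ?D" .
    show "full_tail (catenoid m) E1 (cat_half m (- s) 0)" by (rule full_tail_cat_half[OF E1 _ m]) simp
    show "cat_half m (- s) 0 \<subseteq> ?\<Omega>" by (auto simp: cat_half_def mem_catenoid clM)
    show "full_tail (catenoid m) Ep (cat_half m s 0)" by (rule full_tail_cat_half[OF Ep _ m]) simp
    show "cat_half m s 0 \<inter> ?\<Omega> = {}" by (auto simp: cat_half_def)
  qed
  ultimately show ?thesis
    unfolding admissible_separator_def using two_sided_disc transverse_disc_catenoid[OF m] by blast
qed

lemma separating_area_catenoid:
  assumes m: "m > 0" and Ep: "end_side m Ep s" and E1: "end_side m E1 (- s)"
  shows "separating_area (catenoid m) (catenoid_region m) Ep E1 = ennreal (pi * m\<^sup>2)"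
proof (rule antisym)
  let ?D = "cball (0 :: real^2) m \<times> {0 :: real}"
  have "separating_area (catenoid m) (catenoid_region m) Ep E1 \<le> emeasure (hausdorff_measure 2) ?D"
    unfolding separating_area_def by (rule INF_lower) (use disc_admissible[OF assms] in simp)
  also have "\<dots> = hausdorff_outer 2 ?D"
    by (intro emeasure_hausdorff_measure borel_compact compact_Times) auto
  also have "\<dots> \<le> ennreal (pi * m\<^sup>2)" by (rule hausdorff_outer_disc_le[OF m])
  finally show "separating_area (catenoid m) (catenoid_region m) Ep E1 \<le> ennreal (pi * m\<^sup>2)" .
  show "ennreal (pi * m\<^sup>2) \<le> separating_area (catenoid m) (catenoid_region m) Ep E1"
    unfolding separating_area_def by (rule INF_greatest) (use separator_area_ge[OF assms] in simp)
qed

theorem proposition4p5: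
  fixes m :: real and M :: "space3 set"
  assumes "m > 0"
    and "M \<in> components (- catenoid m)"
    and "{x. fst x = 0} \<subseteq> M"
  shows "card (ends (catenoid m)) = 2 \<and>
    (\<forall>Ep \<in> ends (catenoid m). \<forall>E1 \<in> ends (catenoid m) - {Ep}.
       has_extrinsic_mass (catenoid m) M Ep m \<and>
       extrinsic_mass (catenoid m) M Ep = m \<and>
       separating_area (catenoid m) M Ep E1 = ennreal (pi * m\<^sup>2) \<and>
       extrinsic_mass (catenoid m) M Ep =
         sqrt (enn2real (separating_area (catenoid m) M Ep E1) / pi))"
proof (intro conjI ballI)
  show "card (ends (catenoid m)) = 2" by (rule card_ends_catenoid[OF assms(1)])
next
  fix Ep E1 assume "Ep \<in> ends (catenoid m)" and E1: "E1 \<in> ends (catenoid m) - {Ep}"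
  then obtain s where s: "end_side m Ep s" using end_side_exists[OF assms(1)] by blast
  have s': "end_side m E1 (- s)" by (rule other_end_side[OF s E1 assms(1)])
  have M: "M = catenoid_region m" by (rule component_eq_catenoid_region[OF assms])
  show "has_extrinsic_mass (catenoid m) M Ep m"
    unfolding M by (rule has_mass_catenoid[OF assms(1) s])
  show mass: "extrinsic_mass (catenoid m) M Ep = m"
    unfolding M by (rule extrinsic_mass_catenoid[OF assms(1) s])
  show area: "separating_area (catenoid m) M Ep E1 = ennreal (pi * m\<^sup>2)"
    unfolding M by (rule separating_area_catenoid[OF assms(1) s s'])
  show "extrinsic_mass (catenoid m) M Ep =
      sqrt (enn2real (separating_area (catenoid m) M Ep E1) / pi)"
    using assms(1) by (simp add: mass area)
qed

end
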